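(* Let $(\phi_t)_{t\ge0}$ be a non-elliptic continuous one-parameter semigroup of holomorphic functions in the unit disk $\mathbb{D}$ with Koenigs function $h$, and suppose that $\zeta\in\partial\mathbb{D}$ is such that its boundary orbit $\gamma_\zeta$ is a boundary orbit of the third type. Let $\widetilde\Omega$ and $\widetilde{\mathbb{D}}$ be the simply connected domains associated with $\gamma_\zeta$ by reflection, as defined in the context. Then $\gamma_\zeta$ is Lipschitz if and only if $$\limsup_{t\to S_\zeta}\frac{\lambda_{\widetilde\Omega}(h(\zeta)+t)}{\lambda_{\widetilde{\mathbb{D}}}(\gamma_\zeta(t))}<+\infty.$$
   Context: A (continuous one-parameter) semigroup in $\mathbb{D}$ is a family $(\phi_t)_{t\ge0}$ of holomorphic functions $\phi_t:\mathbb{D}\to\mathbb{D}$ such that $\phi_0=\mathrm{id}_{\mathbb{D}}$, $\phi_{t+s}=\phi_t\circ\phi_s$ for all $t,s\ge0$, and $\phi_t\to\phi_0$ locally uniformly as $t\to0^+$. It is non-elliptic if there is $\tau\in\partial\mathbb{D}$ (the Denjoy-Wolff point) with $\phi_t(z)\to\tau$ as $t\to+\infty$ for all $z\in\mathbb{D}$. Its Koenigs function is then the conformal map $h:\mathbb{D}\to\mathbb{C}$ onto its image (unique up to an additive constant) with $h(\phi_t(z))=h(z)+t$ for all $t\ge0$, $z\in\mathbb{D}$; the Koenigs domain is $\Omega=h(\mathbb{D})$. Boundary orbits: for $\zeta\in\partial\mathbb{D}$ and $t\ge0$ the non-tangential limit $\phi_t(\zeta):=\angle\lim_{z\to\zeta}\phi_t(z)$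 exists, and $t\mapsto\phi_t(\zeta)$ is continuous on $[0,+\infty)$. The point $\zeta$ is a fixed point of $(\phi_t)$ if $\phi_t(\zeta)=\zeta$ for all $t\ge0$. The life-time of $\zeta$ is $S_\zeta:=\sup\{t\in[0,+\infty):\phi_t(\zeta)\in\partial\mathbb{D}\}$. The boundary orbit of $\zeta$ is the curve $\gamma_\zeta(t)=\phi_t(\zeta)$ restricted to $t\in[0,S_\zeta]$ (to $[0,+\infty)$ if $S_\zeta=+\infty$); it lies on $\partial\mathbb{D}$. Only points $\zeta$ with $S_\zeta>0$ that are not fixed points are considered. Then $\gamma_\zeta$ is exceptional if $S_\zeta=+\infty$; it is isolated if $S_\zeta<+\infty$ and there is $\epsilon>0$ with $D(h(\zeta)+S_\zeta,\epsilon)\cap\partial\Omega\subset L_\zeta:=\{h(\zeta)+s:s\in(-\infty,S_\zeta]\}$, where $h(\zeta)=\angle\lim_{z\to\zeta}h(z)\in\mathbb{C}$ is the non-tangential limit and $D(w,r)$ is the Euclidean disk of center $w$, radius $r$; and it is of the third type if it is neither exceptional nor isolated (in particular $0<S_\zeta<+\infty$). The functions $h$ and the infinitesimal generator extend holomorphically through the open arc $\gamma_\zeta((0,S_\zeta))$, and (still denoting the extension by $h$) $h(\gamma_\zeta(t))=h(\zeta)+t$. Construction of $\widetilde\Omega$ and $\widetilde{\mathbb{D}}$ for $\gamma_\zeta$ of the third type: there exist $\epsilon_1,\epsilon_2>0$ such that exactly one of the following inclusions can hold and does hold: $L^+=\{w:\mathrm{Re}\,h(\zeta)+\epsilon_1<\mathrm{Re}\,w<\mathrm{Re}\,h(\zeta)+S_\zeta,\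 \mathrm{Im}\,h(\zeta)<\mathrm{Im}\,w<\mathrm{Im}\,h(\zeta)+\epsilon_2\}\subset\Omega$, or $L^-=\{w:\mathrm{Re}\,h(\zeta)+\epsilon_1<\mathrm{Re}\,w<\mathrm{Re}\,h(\zeta)+S_\zeta,\ \mathrm{Im}\,h(\zeta)-\epsilon_2<\mathrm{Im}\,w<\mathrm{Im}\,h(\zeta)\}\subset\Omega$. Put $\Omega^*=\{w\in\Omega:\mathrm{Im}\,w>\mathrm{Im}\,h(\zeta)\}$ if $L^+\subset\Omega$, and $\Omega^*=\{w\in\Omega:\mathrm{Im}\,w<\mathrm{Im}\,h(\zeta)\}$ if $L^-\subset\Omega$. Let $R(\Omega^* )$ be the reflection of $\Omega^*$ in the horizontal line $\{\mathrm{Im}\,w=\mathrm{Im}\,h(\zeta)\}$ and set $\widetilde\Omega=\Omega^*\cup\{h(\zeta)+t:0<t<S_\zeta\}\cup R(\Omega^* )$, a simply connected domain. Let $\mathbb{D}^*=h^{-1}(\Omega^* )\subset\mathbb{D}$, let $R(\mathbb{D}^* )$ be its reflection through the arc $\gamma_\zeta((0,S_\zeta))$ of the unit circle (i.e. under $z\mapsto 1/\bar z$), and set $\widetilde{\mathbb{D}}=\mathbb{D}^*\cup\gamma_\zeta((0,S_\zeta))\cup R(\mathbb{D}^* )$. By Schwarz reflection, the extended $h$ maps $\widetilde{\mathbb{D}}$ conformally onto $\widetilde\Omega$. Hyperbolic density: $\lambda_{\mathbb{D}}(z)=\frac1{1-|z|^2}$, and for a simply connected domain $U\subsetneq\mathbb{C}$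 with Riemann map $f:U\to\mathbb{D}$, $\lambda_U(z)=\lambda_{\mathbb{D}}(f(z))|f'(z)|$. A function $\gamma:I\to\mathbb{C}$ on an interval $I\subset\mathbb{R}$ is Lipschitz if there is $C>0$ with $|\gamma(t)-\gamma(s)|\le C|t-s|$ for all $t,s\in I$. *)

theory Defs
  imports "HOL-Complex_Analysis.Complex_Analysis"
begin

abbreviation unit_disc :: "complex set" where
  "unit_disc \<equiv> ball 0 1"

abbreviation unit_circle :: "complex set" where
  "unit_circle \<equiv> sphere 0 1"


section \<open>Semigroups and Koenigs functions\<close>

definition disc_semigroup :: "(real \<Rightarrow> complex \<Rightarrow> complex) \<Rightarrow> bool" where
  "disc_semigroup \<phi> \<longleftrightarrow>
     (\<forall>t\<ge>0. \<phi> t holomorphic_on unit_disc \<and> \<phi> t ` unit_disc \<subseteq> unit_disc) \<and>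
     (\<forall>z\<in>unit_disc. \<phi> 0 z = z) \<and>
     (\<forall>t\<ge>0. \<forall>s\<ge>0. \<forall>z\<in>unit_disc. \<phi> (t + s) z = \<phi> t (\<phi> s z)) \<and>
     (\<forall>K. compact K \<and> K \<subseteq> unit_disc \<longrightarrow> uniform_limit K \<phi> (\<phi> 0) (at_right 0))"

definition non_elliptic :: "(real \<Rightarrow> complex \<Rightarrow> complex) \<Rightarrow> bool" where
  "non_elliptic \<phi> \<longleftrightarrow>
     (\<exists>\<tau>\<in>unit_circle. \<forall>z\<in>unit_disc. ((\<lambda>t. \<phi> t z) \<longlongrightarrow> \<tau>) at_top)"

definition koenigs_function ::
    "(real \<Rightarrow> complex \<Rightarrow> complex) \<Rightarrow> (complex \<Rightarrow> complex) \<Rightarrow> bool" where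
  "koenigs_function \<phi> h \<longleftrightarrow>
     h holomorphic_on unit_disc \<and> inj_on h unit_disc \<and>
     (\<forall>t\<ge>0. \<forall>z\<in>unit_disc. h (\<phi> t z) = h z + of_real t)"


section \<open>Boundary orbits\<close>

definition stolz_region :: "complex \<Rightarrow> real \<Rightarrow> complex set" where
  "stolz_region \<zeta> M = {z \<in> unit_disc. norm (z - \<zeta>) < M * (1 - norm z)}"

definition has_nontangential_limit ::
    "(complex \<Rightarrow> complex) \<Rightarrow> complex \<Rightarrow> complex \<Rightarrow> bool" where
  "has_nontangential_limit f l \<zeta> \<longleftrightarrow>
     (\<forall>M>1. (f \<longlongrightarrow> l) (at \<zeta> within stolz_region \<zeta> M))"

text \<open>
  The function \<open>\<gamma>\<close> below is \<open>t \<mapsto> \<phi>\<^sub>t(\<zeta>)\<close> on the whole of \<open>[0, \<infinity>)\<close>; the boundary orbit is its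
  restriction to the times up to the life-time. The values of \<open>\<gamma>\<close> at negative times
  are irrelevant.
\<close>

definition boundary_trajectory ::
    "(real \<Rightarrow> complex \<Rightarrow> complex) \<Rightarrow> complex \<Rightarrow> (real \<Rightarrow> complex) \<Rightarrow> bool" where
  "boundary_trajectory \<phi> \<zeta> \<gamma> \<longleftrightarrow> (\<forall>t\<ge>0. has_nontangential_limit (\<phi> t) (\<gamma> t) \<zeta>)"

definition boundary_fixed_point :: "(real \<Rightarrow> complex) \<Rightarrow> complex \<Rightarrow> bool" where
  "boundary_fixed_point \<gamma> \<zeta> \<longleftrightarrow> (\<forall>t\<ge>0. \<gamma> t = \<zeta>)"

definition life_time :: "(real \<Rightarrow> complex) \<Rightarrow> ereal" where
  "life_time \<gamma> = (SUP t\<in>{t. 0 \<le> t \<and> \<gamma> t \<in> unit_circle}. ereal t)"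

definition exceptional_orbit :: "(real \<Rightarrow> complex) \<Rightarrow> bool" where
  "exceptional_orbit \<gamma> \<longleftrightarrow> life_time \<gamma> = \<infinity>"

text \<open>Here and below, \<open>\<Omega>\<close> is the Koenigs domain and \<open>p\<close> is the non-tangential limit \<open>h(\<zeta>)\<close>.\<close>

definition isolated_orbit :: "complex set \<Rightarrow> complex \<Rightarrow> (real \<Rightarrow> complex) \<Rightarrow> bool" where
  "isolated_orbit \<Omega> p \<gamma> \<longleftrightarrow>
     (\<exists>S. life_time \<gamma> = ereal S \<and>
        (\<exists>\<epsilon>>0. ball (p + of_real S) \<epsilon> \<inter> frontier \<Omega> \<subseteq> {p + of_real s |s. s \<le> S}))"

definition third_type_orbit ::
    "complex set \<Rightarrow> complex \<Rightarrow> complex \<Rightarrow> (real \<Rightarrow> complex) \<Rightarrow> bool" where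
  "third_type_orbit \<Omega> p \<zeta> \<gamma> \<longleftrightarrow>
     0 < life_time \<gamma> \<and> \<not> boundary_fixed_point \<gamma> \<zeta> \<and>
     \<not> exceptional_orbit \<gamma> \<and> \<not> isolated_orbit \<Omega> p \<gamma>"


section \<open>The reflected domains\<close>

definition upper_rectangle :: "complex \<Rightarrow> real \<Rightarrow> real \<Rightarrow> real \<Rightarrow> complex set" where
  "upper_rectangle p S \<epsilon>1 \<epsilon>2 =
     {w. Re p + \<epsilon>1 < Re w \<and> Re w < Re p + S \<and> Im p < Im w \<and> Im w < Im p + \<epsilon>2}"

definition lower_rectangle :: "complex \<Rightarrow> real \<Rightarrow> real \<Rightarrow> real \<Rightarrow> complex set" where
  "lower_rectangle p S \<epsilon>1 \<epsilon>2 =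
     {w. Re p + \<epsilon>1 < Re w \<and> Re w < Re p + S \<and> Im p - \<epsilon>2 < Im w \<and> Im w < Im p}"

text \<open>
  Exactly one of the two rectangles has to lie in \<open>\<Omega>\<close>. This also excludes \<open>\<epsilon>1 \<ge> S\<close>, for which both
  rectangles are empty. For an orbit of the third type exactly one of the following two
  predicates holds.
\<close>

definition upper_side :: "complex set \<Rightarrow> complex \<Rightarrow> real \<Rightarrow> bool" where
  "upper_side \<Omega> p S \<longleftrightarrow>
     (\<exists>\<epsilon>1>0. \<exists>\<epsilon>2>0. upper_rectangle p S \<epsilon>1 \<epsilon>2 \<subseteq> \<Omega> \<and> \<not> lower_rectangle p S \<epsilon>1 \<epsilon>2 \<subseteq> \<Omega>)"

definition lower_side :: "complex set \<Rightarrow> complex \<Rightarrow> real \<Rightarrow> bool" where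
  "lower_side \<Omega> p S \<longleftrightarrow>
     (\<exists>\<epsilon>1>0. \<exists>\<epsilon>2>0. lower_rectangle p S \<epsilon>1 \<epsilon>2 \<subseteq> \<Omega> \<and> \<not> upper_rectangle p S \<epsilon>1 \<epsilon>2 \<subseteq> \<Omega>)"

definition Omega_star :: "complex set \<Rightarrow> complex \<Rightarrow> real \<Rightarrow> complex set" where
  "Omega_star \<Omega> p S =
     {w \<in> \<Omega>. (upper_side \<Omega> p S \<and> Im w > Im p) \<or> (lower_side \<Omega> p S \<and> Im w < Im p)}"

definition line_reflection :: "complex \<Rightarrow> complex \<Rightarrow> complex" where
  "line_reflection p w = Complex (Re w) (2 * Im p - Im w)"

definition Omega_tilde :: "complex set \<Rightarrow> complex \<Rightarrow> real \<Rightarrow> complex set" where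
  "Omega_tilde \<Omega> p S =
     Omega_star \<Omega> p S \<union> {p + of_real t |t. 0 < t \<and> t < S} \<union>
     line_reflection p ` Omega_star \<Omega> p S"

definition disc_star :: "(complex \<Rightarrow> complex) \<Rightarrow> complex \<Rightarrow> real \<Rightarrow> complex set" where
  "disc_star h p S = {z \<in> unit_disc. h z \<in> Omega_star (h ` unit_disc) p S}"

text \<open>
  The reflection of the point \<open>0\<close> in the unit circle is \<open>\<infinity>\<close>, so the reflected domain in the
  \<open>z\<close>-plane is in general a domain in the Riemann sphere. We represent the sphere by
  \<^typ>\<open>complex option\<close>, with \<^term>\<open>None\<close> for \<open>\<infinity>\<close>, and use \<open>w \<mapsto> 1/w\<close> as the chart at \<open>\<infinity>\<close>.
\<close>

definition sphere_inverse :: "complex \<Rightarrow> complex option" where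
  "sphere_inverse w = (if w = 0 then None else Some (1 / w))"

definition circle_reflection :: "complex \<Rightarrow> complex option" where
  "circle_reflection z = sphere_inverse (cnj z)"

definition disc_tilde ::
    "(complex \<Rightarrow> complex) \<Rightarrow> complex \<Rightarrow> real \<Rightarrow> (real \<Rightarrow> complex) \<Rightarrow> complex option set" where
  "disc_tilde h p S \<gamma> =
     Some ` disc_star h p S \<union> Some ` \<gamma> ` {0<..<S} \<union> circle_reflection ` disc_star h p S"


section \<open>Hyperbolic densities\<close>

definition disc_density :: "complex \<Rightarrow> real" where
  "disc_density z = 1 / (1 - (norm z)\<^sup>2)"

definition riemann_map :: "complex set \<Rightarrow> (complex \<Rightarrow> complex) \<Rightarrow> bool" where
  "riemann_map U f \<longleftrightarrow> f holomorphic_on U \<and> bij_betw f U unit_disc"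

text \<open>By the Schwarz-Pick lemma the value does not depend on the choice of the Riemann map.\<close>

definition hyperbolic_density :: "complex set \<Rightarrow> complex \<Rightarrow> real" where
  "hyperbolic_density U z =
     (THE d. \<exists>f. riemann_map U f \<and> d = disc_density (f z) * norm (deriv f z))"

text \<open>
  The same notions for a simply connected domain in the sphere; the density is taken at finite
  points only, with respect to the Euclidean coordinate.
\<close>

definition sphere_riemann_map ::
    "complex option set \<Rightarrow> (complex option \<Rightarrow> complex) \<Rightarrow> bool" where
  "sphere_riemann_map U f \<longleftrightarrow>
     (\<lambda>z. f (Some z)) holomorphic_on {z. Some z \<in> U} \<and>
     (\<lambda>w. f (sphere_inverse w)) holomorphic_on {w. sphere_inverse w \<in> U} \<and>
     bij_betw f U unit_disc"

definition sphere_hyperbolic_density :: "complex option set \<Rightarrow> complex \<Rightarrow> real" where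
  "sphere_hyperbolic_density U z =
     (THE d. \<exists>f. sphere_riemann_map U f \<and>
        d = disc_density (f (Some z)) * norm (deriv (\<lambda>w. f (Some w)) z))"

lemma sphere_riemann_map_finite:
  "sphere_riemann_map (Some ` U) f \<longleftrightarrow> riemann_map U (\<lambda>z. f (Some z))"
proof -
  have bij: "bij_betw f (Some ` U) unit_disc \<longleftrightarrow> bij_betw (\<lambda>z. f (Some z)) U unit_disc"
    by (auto simp: bij_betw_def inj_on_def image_image)
  have "(\<lambda>w. f (sphere_inverse w)) holomorphic_on {w. sphere_inverse w \<in> Some ` U}"
    if hol: "(\<lambda>z. f (Some z)) holomorphic_on U"
  proof -
    have eq: "{w. sphere_inverse w \<in> Some ` U} = {w. w \<noteq> 0 \<and> 1 / w \<in> U}"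
      by (auto simp: sphere_inverse_def split: if_splits)
    have "((\<lambda>z. f (Some z)) \<circ> (\<lambda>w. 1 / w)) holomorphic_on {w. w \<noteq> 0 \<and> 1 / w \<in> U}"
      by (rule holomorphic_on_compose_gen[OF _ hol]) (auto intro!: holomorphic_intros)
    then show ?thesis
      unfolding eq by (rule holomorphic_transform) (auto simp: sphere_inverse_def)
  qed
  moreover have "{z. Some z \<in> Some ` U} = U" by auto
  ultimately show ?thesis
    unfolding sphere_riemann_map_def riemann_map_def using bij by auto
qed

lemma sphere_hyperbolic_density_finite:
  "sphere_hyperbolic_density (Some ` U) z = hyperbolic_density U z"
proof -
  have "(\<exists>f. riemann_map U (\<lambda>z. f (Some z)) \<and>
          d = disc_density (f (Some z)) * norm (deriv (\<lambda>w. f (Some w)) z)) \<longleftrightarrow>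
        (\<exists>f. riemann_map U f \<and> d = disc_density (f z) * norm (deriv f z))" (is "?L \<longleftrightarrow> ?R") for d
  proof
    assume ?R
    then obtain f where "riemann_map U f" "d = disc_density (f z) * norm (deriv f z)" by blast
    then show ?L by (intro exI[of _ "\<lambda>x. f (the x)"]) simp
  qed blast
  then show ?thesis
    by (simp add: sphere_hyperbolic_density_def hyperbolic_density_def sphere_riemann_map_finite)
qed

end

theory Submission
  imports Defs
begin

text \<open>
  Write \<open>g\<close> for the inverse of the Koenigs function \<open>h\<close> and \<open>\<Omega>\<close> for the Koenigs domain, and normalise
  \<open>h(\<zeta>) = 0\<close>. Schwarz reflection extends \<open>g\<close> through the segment \<open>(0, S)\<close> to a conformal map of
  \<open>\<Omega>~\<close> onto \<open>\<D>~\<close> with \<open>g(t) = \<gamma>(t)\<close>, so the quotient of the two densities at time \<open>t\<close> is \<open>|\<gamma>'(t)|\<close>.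
  Hence only the boundedness of \<open>\<gamma>'\<close> away from \<open>S\<close> and the continuity of \<open>\<gamma>\<close> at \<open>0\<close> and \<open>S\<close> are at
  stake.

  Every \<open>b \<notin> \<Omega>\<close> comes with the ray \<open>b + (-\<infinity>, 0]\<close> outside \<open>\<Omega>\<close>. Harnack's inequality for
  \<open>\<surd>(h - b)\<close>, which takes values in the right half-plane, therefore gives
  \<open>1 - |g(w)| \<le> C Re \<surd>(w - b)\<close>, and by the Schwarz-Pick lemma \<open>|g'(w)| \<le> C dist(w, \<partial>\<Omega>)\<^sup>-\<^sup>1\<^sup>/\<^sup>2\<close>.
  This yields a continuous extension of \<open>g\<close> to \<open>(0, S]\<close> from the side of access, and the choice
  \<open>b = S\<close> gives \<open>|\<gamma>'(t)| \<le> C (S - t)\<^sup>-\<^sup>1\<^sup>/\<^sup>2\<close>. If \<open>\<gamma>(t)\<close> did not tend to \<open>\<zeta>\<close> as \<open>t \<rightarrow> 0\<close>, short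
  orbit pieces starting near \<open>\<zeta>\<close> would form Koebe arcs for \<open>\<phi>\<^sub>s - \<gamma>(s)\<close> with \<open>s = S/2\<close>, forcing
  \<open>\<phi>\<^sub>s(0) = \<gamma>(s)\<close>, which is impossible.
\<close>

section \<open>Schwarz-Pick estimates\<close>

lemma norm_one_minus_cnj_mult_pos:
  assumes "norm a < 1" "norm z < 1"
  shows "norm (1 - cnj a * z) > 0"
proof -
  have "norm (cnj a * z) < 1"
    using assms norm_mult_less[of "cnj a" 1 z 1] by simp
  then show ?thesis by auto
qed

lemma Schwarz_Pick:
  assumes hol: "F holomorphic_on ball 0 1" and maps: "\<And>z. norm z < 1 \<Longrightarrow> norm (F z) < 1"
    and a: "norm a < 1" and z: "norm z < 1"
  shows "norm (F z - F a) * norm (1 - cnj a * z) \<le> norm (z - a) * norm (1 - cnj (F a) * F z)"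
proof -
  define k where "k = Moebius_function 0 (F a) \<circ> (F \<circ> Moebius_function 0 (-a))"
  have M: "norm (Moebius_function 0 (-a) x) < 1" if "norm x < 1" for x
    using Moebius_function_norm_lt_1[of "-a" x] a that by simp
  have "F \<circ> Moebius_function 0 (-a) holomorphic_on ball 0 1"
    by (rule holomorphic_on_compose_gen[OF Moebius_function_holomorphic hol]) (use a M in auto)
  then have "k holomorphic_on ball 0 1"
    unfolding k_def
    by (rule holomorphic_on_compose_gen[OF _ Moebius_function_holomorphic]) (use a M maps in auto)
  moreover have "k 0 = 0"
    by (simp add: k_def Moebius_function_simple)
  moreover have "norm (k x) < 1" if "norm x < 1" for x
    using Moebius_function_norm_lt_1[of "F a"] maps M a that by (simp add: k_def)
  moreover have "norm (Moebius_function 0 a z) < 1"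
    using Moebius_function_norm_lt_1 a z by simp
  ultimately have "norm (k (Moebius_function 0 a z)) \<le> norm (Moebius_function 0 a z)"
    by (rule Schwarz_Lemma(1))
  moreover have "Moebius_function 0 (-a) (Moebius_function 0 a z) = z"
    using Moebius_function_compose[of "-a" a z] a z by simp
  ultimately have "norm (Moebius_function 0 (F a) (F z)) \<le> norm (Moebius_function 0 a z)"
    by (simp add: k_def)
  then show ?thesis
    using norm_one_minus_cnj_mult_pos[OF a z] norm_one_minus_cnj_mult_pos[OF maps[OF a] maps[OF z]]
    by (simp add: Moebius_function_simple norm_divide field_simps)
qed

lemma Schwarz_Pick_deriv:
  assumes hol: "F holomorphic_on ball 0 1" and maps: "\<And>z. norm z < 1 \<Longrightarrow> norm (F z) < 1"
    and a: "norm a < 1"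
  shows "norm (deriv F a) * (1 - (norm a)\<^sup>2) \<le> 1 - (norm (F a))\<^sup>2"
proof -
  have der: "(F has_field_derivative deriv F a) (at a)"
    using hol a holomorphic_derivI by auto
  then have lim1: "((\<lambda>z. norm ((F z - F a) / (z - a)) * norm (1 - cnj a * z))
      \<longlongrightarrow> norm (deriv F a) * norm (1 - cnj a * a)) (at a)"
    unfolding has_field_derivative_iff by (intro tendsto_intros)
  have "isCont F a" using der DERIV_isCont by blast
  then have lim2: "((\<lambda>z. norm (1 - cnj (F a) * F z)) \<longlongrightarrow> norm (1 - cnj (F a) * F a)) (at a)"
    by (intro tendsto_intros) (simp add: isCont_def)
  have "\<forall>\<^sub>F z in at a. z \<in> ball 0 1 - {a}"
    by (rule eventually_at_in_open) (use a in auto)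
  then have "\<forall>\<^sub>F z in at a. norm ((F z - F a) / (z - a)) * norm (1 - cnj a * z)
      \<le> norm (1 - cnj (F a) * F z)"
  proof eventually_elim
    case (elim z)
    then have "z \<noteq> a" "norm z < 1" by auto
    then show ?case
      using Schwarz_Pick[OF hol maps a, of z] by (simp add: norm_divide field_simps)
  qed
  then have "norm (deriv F a) * norm (1 - cnj a * a) \<le> norm (1 - cnj (F a) * F a)"
    by (rule tendsto_le[OF _ lim2 lim1, rotated]) simp
  moreover have "norm (1 - cnj x * x) = 1 - (norm x)\<^sup>2" if "norm x < 1" for x :: complex
  proof -
    have "1 - cnj x * x = of_real (1 - (norm x)\<^sup>2)"
      using complex_norm_square[of x] by (simp add: mult.commute)
    then show ?thesis
      using that by (simp only: norm_of_real) (simp add: abs_square_le_1)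
  qed
  ultimately show ?thesis using a maps by simp
qed

lemma norm_deriv_le_disc:
  assumes hol: "f holomorphic_on ball w r" and "r > 0"
    and maps: "\<And>z. z \<in> ball w r \<Longrightarrow> norm (f z) < 1"
  shows "norm (deriv f w) \<le> (1 - (norm (f w))\<^sup>2) / r"
proof -
  define F where "F = (\<lambda>z. f (w + of_real r * z))"
  have inb: "w + of_real r * z \<in> ball w r" if "norm z < 1" for z
    using that \<open>r > 0\<close> by (simp add: dist_norm norm_mult)
  have "f \<circ> (\<lambda>z. w + of_real r * z) holomorphic_on ball 0 1"
    by (rule holomorphic_on_compose_gen[OF _ hol]) (use inb in \<open>auto intro!: holomorphic_intros\<close>)
  then have holF: "F holomorphic_on ball 0 1" by (simp add: F_def o_def)
  have "(f has_field_derivative deriv f w) (at (w + of_real r * 0))"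
    using hol \<open>r > 0\<close> holomorphic_derivI by force
  then have "(F has_field_derivative deriv f w * of_real r) (at 0)"
    unfolding F_def by (rule DERIV_chain2) (auto intro!: derivative_eq_intros)
  then have "deriv F 0 = deriv f w * of_real r" by (rule DERIV_imp_deriv)
  moreover have "norm (deriv F 0) * (1 - (norm (0::complex))\<^sup>2) \<le> 1 - (norm (F 0))\<^sup>2"
    by (rule Schwarz_Pick_deriv[OF holF]) (use inb maps in \<open>auto simp: F_def\<close>)
  ultimately show ?thesis using \<open>r > 0\<close> by (simp add: F_def norm_mult field_simps)
qed

lemma Harnack_halfplane:
  assumes hol: "q holomorphic_on ball 0 1" and pos: "\<And>z. norm z < 1 \<Longrightarrow> 0 < Re (q z)"
    and z: "norm z < 1"
  shows "(1 - norm z) * Re (q 0) \<le> 4 * Re (q z)"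
proof -
  define k where "k = (\<lambda>z. (q z - q 0) / (q z + cnj (q 0)))"
  have nz: "q x + cnj (q 0) \<noteq> 0" if "norm x < 1" for x
  proof -
    have "Re (q x + cnj (q 0)) > 0" using pos[of x] pos[of 0] that by simp
    then show ?thesis by force
  qed
  have key: "(norm (x + cnj c))\<^sup>2 - (norm (x - c))\<^sup>2 = 4 * Re x * Re c" for x c :: complex
    by (simp add: cmod_power2) (simp add: power2_eq_square algebra_simps)
  have "k holomorphic_on ball 0 1"
    unfolding k_def using hol nz by (intro holomorphic_intros) auto
  moreover have "k 0 = 0" by (simp add: k_def)
  moreover have "norm (k x) < 1" if "norm x < 1" for x
  proof -
    have "(norm (q x - q 0))\<^sup>2 < (norm (q x + cnj (q 0)))\<^sup>2"
    proof -
      have "0 < 4 * Re (q x) * Re (q 0)" using pos[of x] pos[of 0] that by simp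
      with key[of "q x" "q 0"] show ?thesis by linarith
    qed
    then have "norm (q x - q 0) < norm (q x + cnj (q 0))"
      by (simp add: power2_less_imp_less)
    then show ?thesis using nz[OF that] by (simp add: k_def norm_divide)
  qed
  ultimately have "norm (k z) \<le> norm z" by (rule Schwarz_Lemma(1)) (use z in auto)
  then have "norm (q z - q 0) \<le> norm z * norm (q z + cnj (q 0))"
    using nz[OF z] by (simp add: k_def norm_divide field_simps)
  then have "(norm (q z - q 0))\<^sup>2 \<le> (norm z)\<^sup>2 * (norm (q z + cnj (q 0)))\<^sup>2"
    using power_mono[of _ _ 2] by (fastforce simp: power_mult_distrib)
  then have 1: "(1 - (norm z)\<^sup>2) * (norm (q z + cnj (q 0)))\<^sup>2 \<le> 4 * Re (q z) * Re (q 0)"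
    using key[of "q z" "q 0"] by (simp add: algebra_simps)
  have q0: "Re (q 0) > 0" using pos by simp
  have "Re (q 0) \<le> norm (q z + cnj (q 0))"
    using pos[OF z] complex_Re_le_cmod[of "q z + cnj (q 0)"] by simp
  then have "(Re (q 0))\<^sup>2 \<le> (norm (q z + cnj (q 0)))\<^sup>2"
    using q0 by (intro power_mono) auto
  moreover have "1 - norm z \<le> 1 - (norm z)\<^sup>2"
    using z by (simp add: power2_eq_square mult_left_le)
  ultimately have "(1 - norm z) * (Re (q 0))\<^sup>2 \<le> (1 - (norm z)\<^sup>2) * (norm (q z + cnj (q 0)))\<^sup>2"
    using z by (intro mult_mono) (auto simp: abs_square_le_1)
  with 1 have "((1 - norm z) * Re (q 0)) * Re (q 0) \<le> (4 * Re (q z)) * Re (q 0)"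
    by (simp add: power2_eq_square mult_ac)
  then show ?thesis using q0 by (simp add: mult_le_cancel_right)
qed


section \<open>Koebe arcs\<close>

lemma power_eq_imp_root_of_unity_multiple:
  fixes d z :: complex
  assumes "n \<ge> 1" "z ^ n = d ^ n" "z \<noteq> 0"
  shows "\<exists>k<n. d = exp (2 * of_real pi * \<i> * of_nat k / of_nat n) * z"
proof -
  have "(d / z) ^ n = 1"
    using assms by (metis power_divide power_not_zero right_inverse_eq)
  then obtain k where "k < n" "d / z = exp (2 * of_real pi * \<i> * of_nat k / of_nat n)"
    using complex_roots_unity[OF assms(1)] by blast
  then show ?thesis using assms(3) by (auto simp: field_simps)
qed

lemma prod_le_one_small_factor:
  fixes f :: "'a \<Rightarrow> real"
  assumes "finite I" "j \<in> I" "\<And>i. i \<in> I \<Longrightarrow> 0 \<le> f i \<and> f i \<le> M" "f j \<le> e"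
  shows "prod f I \<le> e * M ^ (card I - 1)"
proof -
  have "prod f I = f j * prod f (I - {j})"
    using assms by (simp add: prod.remove)
  also have "\<dots> \<le> e * M ^ card (I - {j})"
    using assms order_trans[of 0 "f j" e]
    by (intro mult_mono prod_nonneg order_trans[OF prod_mono[of _ f "\<lambda>_. M"]]) auto
  finally show ?thesis using assms by simp
qed

lemma inside_path_image_subset_ball:
  assumes "path_image \<kappa> \<subseteq> ball (0::complex) r"
  shows "inside (path_image \<kappa>) \<subseteq> ball 0 r"
proof -
  have "- ball 0 r \<subseteq> outside (path_image \<kappa>)"
    using outside_subset_convex[OF convex_ball assms] .
  then show ?thesis using inside_Int_outside[of "path_image \<kappa>"] by blast
qed

text \<open>
  A quantitative form of Koebe's lemma on arcs. After a rotation, the \<open>N\<close>-th power of a piece of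
  the arc runs from the positive to the negative real axis. Closed up with its complex conjugate it
  surrounds the origin, so the maximum principle applies to the product of the \<open>2N\<close> images of \<open>F\<close>
  under the dihedral group.
\<close>

lemma Koebe_arc_estimate:
  fixes c :: "real \<Rightarrow> complex" and N :: nat
  assumes hol: "F holomorphic_on ball 0 1" and M: "\<And>z. norm z < 1 \<Longrightarrow> norm (F z) \<le> M"
    and "path c" and c: "path_image c \<subseteq> ball 0 1 - {0}"
    and e: "\<And>z. z \<in> path_image c \<Longrightarrow> norm (F z) \<le> e"
    and N: "N \<ge> 1" "pi / N \<le> norm (sgn (pathfinish c) - sgn (pathstart c))"
  shows "norm (F 0) ^ (2 * N) \<le> e * M ^ (2 * N - 1)"
proof -
  have "0 \<notin> path_image c" using c by auto
  then obtain q where q: "path q" and cq: "\<And>t. t \<in> {0..1} \<Longrightarrow> c t = exp (q t)"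
    using winding_number_as_continuous_log[OF \<open>path c\<close>, of 0] by (metis add_0)
  have contq: "continuous_on {0..1} q" using q by (simp add: path_def)
  define \<theta> where "\<theta> t = Im (q t) - Im (q 0)" for t
  have sgnc: "sgn (c t) = exp (\<i> * Im (q t))" if "t \<in> {0..1}" for t
  proof -
    have "exp (q t) = of_real (norm (exp (q t))) * exp (\<i> * Im (q t))"
      by (metis cis_conv_exp exp_eq_polar norm_exp_eq_Re)
    then have "sgn (exp (q t)) = exp (\<i> * Im (q t))"
      by (metis exp_not_eq_zero nonzero_mult_div_cancel_left norm_eq_zero of_real_eq_0_iff sgn_eq)
    then show ?thesis by (simp add: cq[OF that])
  qed
  have "norm (sgn (c 1) - sgn (c 0)) \<le> \<bar>\<theta> 1\<bar>"
  proof -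
    have "sgn (c 1) - sgn (c 0) = exp (\<i> * Im (q 0)) * (exp (\<i> * \<theta> 1) - 1)"
      by (simp add: sgnc \<theta>_def algebra_simps flip: exp_add)
    moreover have "norm (exp (\<i> * \<theta> 1) - 1) \<le> \<bar>\<theta> 1\<bar>"
      using abs_sin_x_le_abs_x[of "\<theta> 1 / 2"] by (simp only: dist_exp_i_1)
    ultimately show ?thesis by (simp add: norm_mult)
  qed
  then have "pi / N \<le> \<bar>\<theta> 1\<bar>" using N by (simp add: pathstart_def pathfinish_def)
  moreover have "\<bar>\<theta> 0\<bar> \<le> pi / N" by (simp add: \<theta>_def)
  moreover have "continuous_on {0..1} (\<lambda>t. \<bar>\<theta> t\<bar>)"
    unfolding \<theta>_def by (intro continuous_intros contq)
  ultimately obtain s where s: "0 \<le> s" "s \<le> 1" and \<theta>s: "\<bar>\<theta> s\<bar> = pi / N"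
    using IVT'[of "\<lambda>t. \<bar>\<theta> t\<bar>" 0 "pi / N" 1] by auto
  define u where "u = exp (\<i> * Im (q 0))"
  have nu: "norm u = 1" by (simp add: u_def)
  define L where "L t = of_nat N * (q (s * t) - \<i> * Im (q 0))" for t
  have st: "s * t \<in> {0..1}" if "t \<in> {0..1}" for t
    using s that by (auto intro: mult_le_one)
  have pathL: "path L"
    unfolding path_def L_def
    by (intro continuous_intros continuous_on_compose2[OF contq]) (use st in auto)
  define p where "p = exp \<circ> L"
  have pathp: "path p"
    using pathL unfolding p_def path_def by (intro continuous_on_compose continuous_intros) auto
  have pt: "p t = (c (s * t) / u) ^ N" if "t \<in> {0..1}" for t
    by (simp add: p_def L_def cq[OF st[OF that]] exp_of_nat_mult u_def exp_diff)
  have ImL: "Im (L t) = of_nat N * \<theta> (s * t)" for t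
    by (simp add: L_def \<theta>_def)
  have real_p: "cnj (p t) = p t" if "sin (Im (L t)) = 0" for t
    using that by (simp add: p_def complex_eq_iff Im_exp)
  have N0: "real N > 0" using N by simp
  have "Im (L 0) = 0" by (simp add: ImL \<theta>_def)
  then have p0: "cnj (p 0) = p 0" by (intro real_p) simp
  have ImL1: "\<bar>Im (L 1)\<bar> = pi" using \<theta>s N0 by (simp add: ImL abs_mult)
  then have "Im (L 1) = pi \<or> Im (L 1) = - pi" by linarith
  then have p1: "cnj (p 1) = p 1" by (intro real_p) auto
  have np: "0 \<notin> path_image p" by (auto simp: p_def path_image_def)
  define \<kappa> where "\<kappa> = p +++ reversepath (cnj \<circ> p)"
  have pathcp: "path (cnj \<circ> p)" using pathp unfolding path_def
    by (intro continuous_on_compose continuous_intros) auto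
  have ncp: "0 \<notin> path_image (cnj \<circ> p)" using np by (auto simp: path_image_def)
  have match: "pathfinish p = pathstart (reversepath (cnj \<circ> p))"
    using p1 by (simp add: pathfinish_def pathstart_def reversepath_def)
  have path\<kappa>: "path \<kappa>"
    unfolding \<kappa>_def using pathp pathcp match by (intro path_join_imp) auto
  have loop\<kappa>: "pathfinish \<kappa> = pathstart \<kappa>"
    using p0 by (simp add: \<kappa>_def pathfinish_def pathstart_def joinpaths_def reversepath_def)
  have im\<kappa>: "path_image \<kappa> = path_image p \<union> cnj ` path_image p"
    unfolding \<kappa>_def using match by (subst path_image_join) (auto simp: path_image_compose)
  define w where "w = winding_number p 0"
  have "winding_number \<kappa> 0 = w + winding_number (reversepath (cnj \<circ> p)) 0"
    unfolding \<kappa>_def w_def using pathp pathcp np ncp match by (intro winding_number_join) auto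
  also have "\<dots> = w + cnj w"
    using winding_number_reversepath[OF pathcp ncp] winding_number_cnj[OF pathp np]
    by (simp add: w_def)
  also have "\<dots> = of_real (2 * Re w)" by (rule complex_add_cnj)
  also have "Re w = (Im (L 1) - Im (L 0)) / (2 * pi)"
  proof -
    have "w = (L 1 - L 0) / (2 * of_real pi * \<i>)"
      unfolding w_def p_def using winding_number_compose_exp[OF pathL]
      by (simp add: pathfinish_def pathstart_def)
    also have "\<dots> = - \<i> * (L 1 - L 0) / of_real (2 * pi)"
      by (simp add: field_simps)
    finally have "w = - \<i> * (L 1 - L 0) / of_real (2 * pi)" .
    then show ?thesis by (simp only: Re_divide_of_real) simp
  qed
  finally have "winding_number \<kappa> 0 \<noteq> 0"
    using ImL1 \<open>Im (L 0) = 0\<close> pi_gt_zero by auto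
  moreover have "0 \<notin> path_image \<kappa>" using np unfolding im\<kappa> by auto
  ultimately have 0: "0 \<in> inside (path_image \<kappa>)"
    using winding_number_zero_in_outside[OF path\<kappa> loop\<kappa>] inside_Un_outside[of "path_image \<kappa>"] by blast
  define U where "U = inside (path_image \<kappa>)"
  define V where "V = {z::complex. z ^ N \<in> U}"
  have cl\<kappa>: "closed (path_image \<kappa>)" using path\<kappa> by (rule closed_path_image)
  have openU: "open U" unfolding U_def using cl\<kappa> by (rule open_inside)
  have contpow: "continuous_on UNIV (\<lambda>z::complex. z ^ N)" by (intro continuous_intros)
  have openV: "open V"
    using open_vimage[OF openU contpow] by (simp add: V_def vimage_def)
  have cin: "c (s * t) \<in> path_image c" if "t \<in> {0..1}" for t
    using st[OF that] by (auto simp: path_image_def)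
  have pball: "path_image p \<subseteq> ball 0 1"
  proof
    fix x assume "x \<in> path_image p"
    then obtain t where t: "t \<in> {0..1}" "x = (c (s * t) / u) ^ N"
      using pt by (auto simp: path_image_def)
    have "norm (c (s * t)) < 1" using cin[OF t(1)] c by auto
    then show "x \<in> ball 0 1" using N by (simp add: t nu norm_power norm_divide power_Suc_less_one power_less_one_iff)
  qed
  then have \<kappa>ball: "path_image \<kappa> \<subseteq> ball 0 1" unfolding im\<kappa> by auto
  have pow_ball: "norm z < 1" if "z ^ N \<in> ball 0 1" for z :: complex
    using that by (simp add: norm_power power_less_one_iff)
  have Vball: "V \<subseteq> ball 0 1"
    using inside_path_image_subset_ball[OF \<kappa>ball] pow_ball by (auto simp: V_def U_def)
  have frV: "z ^ N \<in> path_image \<kappa>" if "z \<in> frontier V" for z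
  proof -
    have "closed {z::complex. z ^ N \<in> closure U}"
      using closed_vimage[OF closed_closure contpow, of U] by (simp add: vimage_def)
    moreover have "V \<subseteq> {z. z ^ N \<in> closure U}" using closure_subset by (auto simp: V_def)
    ultimately have "closure V \<subseteq> {z. z ^ N \<in> closure U}" by (rule closure_minimal[rotated])
    then have "z ^ N \<in> closure U" "z ^ N \<notin> U"
      using that openV by (auto simp: frontier_def interior_open V_def)
    then have "z ^ N \<in> frontier U" using openU by (simp add: frontier_def interior_open)
    then show ?thesis unfolding U_def using frontier_inside_subset[OF cl\<kappa>] by blast
  qed
  have clV: "closure V \<subseteq> ball 0 1"
    using Vball frV \<kappa>ball pow_ball unfolding closure_Un_frontier by fastforce
  define \<omega> where "\<omega> k = exp (2 * of_real pi * \<i> * of_nat k / of_nat N)" for k :: nat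
  have n\<omega>: "norm (\<omega> k) = 1" for k
  proof -
    have "\<omega> k = exp (\<i> * of_real (2 * pi * k / N))" by (simp add: \<omega>_def mult_ac)
    then show ?thesis by (simp only: norm_exp_i_times)
  qed
  define F1 where "F1 z = F (u * z)" for z
  have "F \<circ> (\<lambda>z. u * z) holomorphic_on ball 0 1"
    by (rule holomorphic_on_compose_gen[OF _ hol]) (auto intro!: holomorphic_intros simp: norm_mult nu)
  then have holF1: "F1 holomorphic_on ball 0 1" by (simp add: F1_def[abs_def] o_def)
  have "cnj \<circ> F1 \<circ> cnj holomorphic_on ball 0 1"
    by (rule holomorphic_on_compose_cnj_cnj)
      (auto intro!: holomorphic_on_subset[OF holF1])
  then have holF1': "(\<lambda>z. cnj (F1 (cnj z))) holomorphic_on ball 0 1" by (simp add: o_def)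
  have F1M: "norm (F1 z) \<le> M" if "norm z < 1" for z
    using M[of "u * z"] that by (simp add: F1_def norm_mult nu)
  define I where "I = {..<N} \<times> (UNIV :: bool set)"
  define f where "f i z = (if snd i then F1 (\<omega> (fst i) * z) else cnj (F1 (cnj (\<omega> (fst i) * z))))"
    for i :: "nat \<times> bool" and z
  have I: "finite I" "card I = 2 * N" by (auto simp: I_def card_cartesian_product)
  have holf: "f i holomorphic_on ball 0 1" for i
  proof -
    have rot: "(\<lambda>z. \<omega> (fst i) * z) ` ball 0 1 \<subseteq> ball 0 1"
      by (auto simp: norm_mult n\<omega>)
    have rh: "(\<lambda>z. \<omega> (fst i) * z) holomorphic_on ball 0 1" by (intro holomorphic_intros)
    show ?thesis
      using holomorphic_on_compose_gen[OF rh holF1 rot] holomorphic_on_compose_gen[OF rh holF1' rot]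
      by (cases "snd i") (auto simp: f_def[abs_def] o_def)
  qed
  define P where "P z = (\<Prod>i\<in>I. f i z)" for z
  have holP: "P holomorphic_on ball 0 1"
    unfolding P_def[abs_def] by (intro holomorphic_on_prod holf)
  have "norm (P 0) \<le> e * M ^ (2 * N - 1)"
  proof (rule maximum_modulus_frontier[of P V])
    show "P holomorphic_on interior V"
      using holomorphic_on_subset[OF holP] Vball interior_subset by blast
    show "continuous_on (closure V) P"
      using holP clV holomorphic_on_imp_continuous_on continuous_on_subset by blast
    show "bounded V" using Vball bounded_subset bounded_ball by blast
    show "0 \<in> V" using 0 N by (simp add: V_def U_def power_0_left)
  next
    fix z assume z: "z \<in> frontier V"
    then have nz: "norm z < 1" using clV by (auto simp: frontier_def)
    have z0: "z \<noteq> 0" using frV[OF z] \<open>0 \<notin> path_image \<kappa>\<close> N by (auto simp: power_0_left)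
    have "\<exists>j\<in>I. norm (f j z) \<le> e"
    proof -
      obtain t where t: "t \<in> {0..1}"
        and zt: "z ^ N = (c (s * t) / u) ^ N \<or> z ^ N = cnj ((c (s * t) / u) ^ N)"
        using frV[OF z] unfolding im\<kappa> using pt by (auto simp: path_image_def)
      define d where "d = c (s * t) / u"
      have d: "norm (F1 d) \<le> e"
        using e[OF cin[OF t]] nu by (cases "u = 0") (auto simp: F1_def d_def)
      from zt show ?thesis
      proof
        assume "z ^ N = (c (s * t) / u) ^ N"
        then obtain k where "k < N" "d = \<omega> k * z"
          using power_eq_imp_root_of_unity_multiple[OF N(1) _ z0, of d] by (auto simp: d_def \<omega>_def)
        then show ?thesis using d by (intro bexI[of _ "(k, True)"]) (auto simp: f_def I_def)
      next
        assume "z ^ N = cnj ((c (s * t) / u) ^ N)"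
        then obtain k where k: "k < N" "cnj d = \<omega> k * z"
          using power_eq_imp_root_of_unity_multiple[OF N(1) _ z0, of "cnj d"] by (auto simp: d_def \<omega>_def)
        then have "cnj (\<omega> k * z) = d" by (metis complex_cnj_cnj)
        then show ?thesis using d k by (intro bexI[of _ "(k, False)"]) (auto simp: f_def I_def)
      qed
    qed
    then obtain j where "j \<in> I" "norm (f j z) \<le> e" by blast
    moreover have "norm (f i z) \<le> M" for i
      using F1M[of "\<omega> (fst i) * z"] F1M[of "cnj (\<omega> (fst i) * z)"] nz
      by (auto simp: f_def norm_mult n\<omega>)
    ultimately show "norm (P z) \<le> e * M ^ (2 * N - 1)"
      unfolding P_def prod_norm[symmetric] I(2)[symmetric]
      by (intro prod_le_one_small_factor[OF I(1)]) auto
  qed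
  moreover have "norm (P 0) = norm (F 0) ^ (2 * N)"
  proof -
    have "norm (f i 0) = norm (F 0)" for i by (simp add: f_def F1_def)
    then show ?thesis by (simp add: P_def prod_norm[symmetric] I)
  qed
  ultimately show ?thesis by simp
qed


section \<open>Boundary decay in domains slit to the left\<close>

lemma Re_csqrt_pos:
  assumes "z \<notin> \<real>\<^sub>\<le>\<^sub>0"
  shows "0 < Re (csqrt z)"
proof (rule ccontr)
  assume "\<not> ?thesis"
  then have "Re (csqrt z) = 0" using Re_csqrt[of z] by linarith
  then have "csqrt z = \<i> * of_real (Im (csqrt z))" by (simp add: complex_eq_iff)
  then have "(csqrt z)\<^sup>2 = of_real (- ((Im (csqrt z))\<^sup>2))"
    by (metis mult_minus1 of_real_minus of_real_power power2_i power_mult_distrib)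
  then have "z = of_real (- ((Im (csqrt z))\<^sup>2))" by simp
  then show False using assms by (metis neg_le_0_iff_le nonpos_Reals_of_real_iff zero_le_power2)
qed

lemma Re_csqrt_le_Im:
  assumes "Re z < 0" "0 < Im z"
  shows "Re (csqrt z) \<le> Im z / (2 * sqrt (- Re z))"
proof -
  define q where "q = csqrt z"
  have z: "z = q\<^sup>2" by (simp add: q_def)
  have re: "Re z = (Re q)\<^sup>2 - (Im q)\<^sup>2" and im: "Im z = 2 * Re q * Im q"
    unfolding z by (simp_all add: Re_power2 Im_power2)
  have "0 \<le> Re q" unfolding q_def by (rule Re_csqrt)
  with im assms have "0 < Im q" by (smt (verit) mult_nonneg_nonpos)
  have "sqrt (- Re z) \<le> Im q"
    using \<open>0 < Im q\<close> re by (intro real_le_lsqrt) auto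
  then have "Re q * (2 * sqrt (- Re z)) \<le> Re q * (2 * Im q)"
    using \<open>0 \<le> Re q\<close> by (intro mult_left_mono) auto
  then show ?thesis
    using assms im by (simp add: q_def[symmetric] field_simps)
qed

lemma Re_csqrt_le_sqrt: "Re (csqrt z) \<le> sqrt (norm z)"
  using complex_Re_le_cmod[of "csqrt z"] norm_csqrt by metis

locale slit_domain =
  fixes \<Omega> :: "complex set" and g :: "complex \<Rightarrow> complex" and S :: real
  assumes open_\<Omega>: "open \<Omega>" and holg: "g holomorphic_on \<Omega>" and injg: "inj_on g \<Omega>"
    and img: "g ` \<Omega> = ball 0 1"
    and shift: "\<And>w t. w \<in> \<Omega> \<Longrightarrow> 0 \<le> t \<Longrightarrow> w + of_real t \<in> \<Omega>"
    and S_pos: "0 < S" and slit: "\<And>x. x \<le> S \<Longrightarrow> of_real x \<notin> \<Omega>"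
begin

lemma norm_g_less: "w \<in> \<Omega> \<Longrightarrow> norm (g w) < 1"
  using img by auto

lemma left_ray: "b \<notin> \<Omega> \<Longrightarrow> 0 \<le> t \<Longrightarrow> b - of_real t \<notin> \<Omega>"
  using shift[of "b - of_real t" t] by auto

lemma diff_not_nonpos: 
  assumes "b \<notin> \<Omega>" "w \<in> \<Omega>"
  shows "w - b \<notin> \<real>\<^sub>\<le>\<^sub>0"
proof
  assume "w - b \<in> \<real>\<^sub>\<le>\<^sub>0"
  then obtain r where r: "w - b = of_real r" "r \<le> 0" by (auto elim: nonpos_Reals_cases)
  then have "w = b - of_real (- r)" by (simp add: algebra_simps)
  then show False using left_ray[OF assms(1), of "-r"] r assms(2) by simp
qed

lemma holomorphic_inverse:
  obtains H where "H holomorphic_on ball 0 1" "\<And>w. w \<in> \<Omega> \<Longrightarrow> H (g w) = w"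
    "\<And>z. norm z < 1 \<Longrightarrow> H z \<in> \<Omega> \<and> g (H z) = z"
proof -
  obtain H where H: "H holomorphic_on (g ` \<Omega>)" "\<And>w. w \<in> \<Omega> \<Longrightarrow> H (g w) = w"
    using holomorphic_has_inverse[OF holg open_\<Omega> injg] by metis
  have "H z \<in> \<Omega> \<and> g (H z) = z" if "norm z < 1" for z
  proof -
    have "z \<in> g ` \<Omega>" using that img by simp
    then show ?thesis using H(2) by auto
  qed
  then show thesis using H that unfolding img by blast
qed

lemma connected_\<Omega>: "connected \<Omega>"
proof -
  obtain H where H: "H holomorphic_on ball 0 1" "\<And>w. w \<in> \<Omega> \<Longrightarrow> H (g w) = w"
    "\<And>z. norm z < 1 \<Longrightarrow> H z \<in> \<Omega> \<and> g (H z) = z"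
    using holomorphic_inverse by blast
  have "\<Omega> = H ` ball 0 1"
    using H(2,3) norm_g_less by (force simp: image_iff)
  then show ?thesis
    using connected_continuous_image[OF holomorphic_on_imp_continuous_on[OF H(1)]] by simp
qed

lemma boundary_decay:
  "\<exists>C>0. \<forall>b w. b \<notin> \<Omega> \<longrightarrow> norm b \<le> R \<longrightarrow> w \<in> \<Omega> \<longrightarrow> 1 - norm (g w) \<le> C * Re (csqrt (w - b))"
proof -
  obtain H where H: "H holomorphic_on ball 0 1" "\<And>w. w \<in> \<Omega> \<Longrightarrow> H (g w) = w"
    "\<And>z. norm z < 1 \<Longrightarrow> H z \<in> \<Omega> \<and> g (H z) = z"
    using holomorphic_inverse by blast
  define w0 where "w0 = H 0"
  have "w0 \<in> \<Omega>" using H(3)[of 0] by (simp add: w0_def)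
  then obtain d where d: "0 < d" "ball w0 d \<subseteq> \<Omega>" using open_\<Omega> openE by blast
  define K where "K = sqrt (norm w0 + \<bar>R\<bar> + 1)"
  have K: "0 < K" using norm_ge_zero[of w0] by (simp add: K_def add_nonneg_pos)
  have "1 - norm (g w) \<le> 8 * K / d * Re (csqrt (w - b))"
    if b: "b \<notin> \<Omega>" "norm b \<le> R" and w: "w \<in> \<Omega>" for b w
  proof -
    define q where "q = csqrt \<circ> (\<lambda>z. H z - b)"
    have nonpos: "H z - b \<notin> \<real>\<^sub>\<le>\<^sub>0" if "norm z < 1" for z
      using diff_not_nonpos[OF b(1)] H(3)[OF that] by blast
    have "q holomorphic_on ball 0 1"
      unfolding q_def
      by (rule holomorphic_on_compose_gen[where t = "- \<real>\<^sub>\<le>\<^sub>0"])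
        (use H(1) nonpos in \<open>auto intro!: holomorphic_intros\<close>)
    moreover have pos: "0 < Re (q z)" if "norm z < 1" for z
      using Re_csqrt_pos[OF nonpos[OF that]] by (simp add: q_def)
    ultimately have 1: "(1 - norm (g w)) * Re (q 0) \<le> 4 * Re (q (g w))"
      using norm_g_less[OF w] by (intro Harnack_halfplane) auto
    define s where "s = Im (q 0)"
    have q0: "(q 0)\<^sup>2 = w0 - b" by (simp add: q_def w0_def)
    have "norm (q 0) = sqrt (norm (w0 - b))" by (simp add: q_def w0_def)
    also have "\<dots> \<le> K"
      unfolding K_def using norm_triangle_ineq4[of w0 b] b(2) by (intro real_sqrt_le_mono) linarith
    finally have nq: "norm (q 0) \<le> K" .
    have "b - of_real (s\<^sup>2) \<notin> \<Omega>" by (rule left_ray[OF b(1)]) simp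
    then have "d \<le> norm (w0 - (b - of_real (s\<^sup>2)))"
      using d(2) by (auto simp: dist_norm not_less[symmetric])
    also have "w0 - (b - of_real (s\<^sup>2)) = (q 0 - \<i> * s) * (q 0 + \<i> * s)"
      using q0 by (simp add: power2_eq_square algebra_simps)
    also have "q 0 - \<i> * s = of_real (Re (q 0))"
      by (simp add: s_def complex_eq_iff)
    also have "norm (of_real (Re (q 0)) * (q 0 + \<i> * s)) = Re (q 0) * norm (q 0 + \<i> * s)"
      using pos[of 0] by (simp add: norm_mult)
    also have "\<dots> \<le> Re (q 0) * (2 * K)"
    proof -
      have "norm (q 0 + \<i> * s) \<le> norm (q 0) + \<bar>s\<bar>"
        using norm_triangle_ineq[of "q 0" "\<i> * s"] by (simp add: norm_mult)
      also have "\<dots> \<le> 2 * K" using nq abs_Im_le_cmod[of "q 0"] by (simp add: s_def)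
      finally show ?thesis using pos[of 0] by (intro mult_left_mono) auto
    qed
    finally have "d \<le> 2 * K * Re (q 0)" by (simp add: mult_ac)
    then have "(1 - norm (g w)) * d \<le> (1 - norm (g w)) * (2 * K * Re (q 0))"
      using norm_g_less[OF w] by (intro mult_left_mono) auto
    also have "\<dots> = 2 * K * ((1 - norm (g w)) * Re (q 0))" by (simp add: mult_ac)
    also have "\<dots> \<le> 2 * K * (4 * Re (q (g w)))"
      using 1 K by (intro mult_left_mono) auto
    also have "Re (q (g w)) = Re (csqrt (w - b))" using H(2)[OF w] by (simp add: q_def)
    finally show ?thesis using d(1) by (simp add: field_simps)
  qed
  then show ?thesis using K d(1) by (intro exI[of _ "8 * K / d"]) auto
qed

lemma deriv_le_dist:
  assumes "0 < r" "ball w r \<subseteq> \<Omega>"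
  shows "norm (deriv g w) \<le> 2 * (1 - norm (g w)) / r"
proof -
  have "norm (deriv g w) \<le> (1 - (norm (g w))\<^sup>2) / r"
    using holomorphic_on_subset[OF holg assms(2)] assms norm_g_less by (intro norm_deriv_le_disc) auto
  also have "1 - (norm (g w))\<^sup>2 = (1 + norm (g w)) * (1 - norm (g w))"
    by (simp add: power2_eq_square algebra_simps)
  also have "\<dots> \<le> 2 * (1 - norm (g w))"
    using norm_g_less[of w] assms by (intro mult_right_mono) (auto simp: subset_eq less_imp_le)
  finally show ?thesis using assms(1) by (simp add: divide_right_mono)
qed

lemma deriv_le_inverse_sqrt_dist:
  "\<exists>C>0. \<forall>w y. norm w \<le> R \<longrightarrow> 0 < y \<longrightarrow> ball w y \<subseteq> \<Omega> \<longrightarrow> norm (deriv g w) \<le> C / sqrt y"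
proof -
  obtain C where C: "0 < C" and decay: "\<And>b w. b \<notin> \<Omega> \<Longrightarrow> norm b \<le> 2 * R \<Longrightarrow> w \<in> \<Omega> \<Longrightarrow>
      1 - norm (g w) \<le> C * Re (csqrt (w - b))"
    using boundary_decay[of "2 * R"] by blast
  have "norm (deriv g w) \<le> 2 * C / sqrt y"
    if w: "norm w \<le> R" and y: "0 < y" "ball w y \<subseteq> \<Omega>" for w y
  proof -
    have "0 \<notin> \<Omega>" using slit[of 0] S_pos by simp
    then obtain b where b: "b \<in> - \<Omega>" "\<And>x. x \<in> - \<Omega> \<Longrightarrow> dist w b \<le> dist w x"
      using distance_attains_inf[of "- \<Omega>" w] open_\<Omega> by (auto simp: closed_def)
    define d where "d = dist w b"
    have "y \<le> d" using b(1) y(2) by (auto simp: d_def not_less[symmetric])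
    then have "0 < d" using y by linarith
    have "d \<le> norm w" using b(2)[of 0] \<open>0 \<notin> \<Omega>\<close> by (simp add: d_def dist_norm)
    have "norm b \<le> norm w + d" by (simp add: d_def norm_triangle_sub dist_norm norm_minus_commute)
    then have "norm b \<le> 2 * R" using \<open>d \<le> norm w\<close> w by linarith
    have "w \<in> \<Omega>" using y by auto
    have "ball w d \<subseteq> \<Omega>" using b(2) by (force simp: d_def)
    then have "norm (deriv g w) \<le> 2 * (1 - norm (g w)) / d"
      using \<open>0 < d\<close> by (intro deriv_le_dist)
    also have "\<dots> \<le> 2 * (C * sqrt d) / d"
    proof -
      have "1 - norm (g w) \<le> C * Re (csqrt (w - b))"
        using decay b(1) \<open>norm b \<le> 2 * R\<close> \<open>w \<in> \<Omega>\<close> by simp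
      also have "\<dots> \<le> C * sqrt d"
        using C Re_csqrt_le_sqrt[of "w - b"] by (intro mult_left_mono) (auto simp: d_def dist_norm)
      finally show ?thesis using \<open>0 < d\<close> by (intro divide_right_mono mult_left_mono) auto
    qed
    also have "\<dots> = 2 * C / sqrt d" using \<open>0 < d\<close> by (simp add: field_simps)
    also have "\<dots> \<le> 2 * C / sqrt y" using \<open>y \<le> d\<close> y C by (intro divide_left_mono) auto
    finally show ?thesis .
  qed
  then show ?thesis using C by (intro exI[of _ "2 * C"]) auto
qed

lemma linear_boundary_decay:
  "\<exists>C>0. \<forall>w\<in>\<Omega>. Re w < S \<longrightarrow> 0 < Im w \<longrightarrow> 1 - norm (g w) \<le> C * Im w / sqrt (S - Re w)"
proof -
  obtain C where C: "0 < C" and decay: "\<And>b w. b \<notin> \<Omega> \<Longrightarrow> norm b \<le> S \<Longrightarrow> w \<in> \<Omega> \<Longrightarrow>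
      1 - norm (g w) \<le> C * Re (csqrt (w - b))"
    using boundary_decay[of S] by blast
  have "1 - norm (g w) \<le> C * Im w / sqrt (S - Re w)" if w: "w \<in> \<Omega>" "Re w < S" "0 < Im w" for w
  proof -
    have "1 - norm (g w) \<le> C * Re (csqrt (w - of_real S))"
      using decay[of "of_real S"] slit[of S] w S_pos by simp
    also have "\<dots> \<le> C * (Im w / (2 * sqrt (S - Re w)))"
      using Re_csqrt_le_Im[of "w - of_real S"] w C by (intro mult_left_mono) auto
    also have "\<dots> \<le> C * Im w / sqrt (S - Re w)"
      using C w by (simp add: field_simps)
    finally show ?thesis .
  qed
  then show ?thesis using C by blast
qed

lemma norm_g_tendsto_1:
  assumes "b \<notin> \<Omega>"
  shows "((\<lambda>w. norm (g w)) \<longlongrightarrow> 1) (at b within \<Omega>)"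
proof -
  obtain C where C: "0 < C" and decay: "\<And>w. w \<in> \<Omega> \<Longrightarrow> 1 - norm (g w) \<le> C * Re (csqrt (w - b))"
    using boundary_decay[of "norm b"] assms by blast
  have "((\<lambda>w. C * sqrt (norm (w - b))) \<longlongrightarrow> C * sqrt (norm (b - b))) (at b within \<Omega>)"
    by (intro tendsto_intros)
  then have lim: "((\<lambda>w. 1 - C * sqrt (norm (w - b))) \<longlongrightarrow> 1) (at b within \<Omega>)"
    using tendsto_diff[OF tendsto_const[of 1]] by fastforce
  show ?thesis
  proof (rule tendsto_sandwich[OF _ _ lim tendsto_const])
    show "\<forall>\<^sub>F w in at b within \<Omega>. 1 - C * sqrt (norm (w - b)) \<le> norm (g w)"
      unfolding eventually_at_filter
    proof (intro always_eventually allI impI)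
      fix w assume "w \<noteq> b" "w \<in> \<Omega>"
      have "C * Re (csqrt (w - b)) \<le> C * sqrt (norm (w - b))"
        using mult_left_mono[OF Re_csqrt_le_sqrt, of C "w - b"] C by linarith
      with decay[OF \<open>w \<in> \<Omega>\<close>] show "1 - C * sqrt (norm (w - b)) \<le> norm (g w)" by linarith
    qed
    show "\<forall>\<^sub>F w in at b within \<Omega>. norm (g w) \<le> 1"
      unfolding eventually_at_filter
      by (intro always_eventually allI impI) (use norm_g_less in \<open>force intro: less_imp_le\<close>)
  qed
qed

end


section \<open>Continuous extension to the slit\<close>

lemma Holder_vertical:
  fixes f :: "complex \<Rightarrow> complex"
  assumes der: "\<And>s. 0 \<le> s \<Longrightarrow> s \<le> \<rho> \<Longrightarrow> (f has_field_derivative f' s) (at (w + \<i> * of_real s))"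
    and bound: "\<And>s. 0 \<le> s \<Longrightarrow> s \<le> \<rho> \<Longrightarrow> norm (f' s) \<le> C / sqrt (Im w + s)"
    and "0 < Im w" "0 < \<rho>" "0 \<le> C"
  shows "norm (f (w + \<i> * of_real \<rho>) - f w) \<le> 2 * C * sqrt \<rho>"
proof -
  define F where "F s = f (w + \<i> * of_real s)" for s :: real
  define \<Phi> where "\<Phi> s = 2 * C * sqrt (Im w + s)" for s
  have F': "(F has_vector_derivative \<i> * f' s) (at s within T)" if "0 \<le> s" "s \<le> \<rho>" for s T
  proof -
    have 1: "((\<lambda>s. w + \<i> * of_real s) has_vector_derivative \<i>) (at s within T)"
      by (auto intro!: derivative_eq_intros)
    have "((f \<circ> (\<lambda>s. w + \<i> * of_real s)) has_vector_derivative \<i> * f' s) (at s within T)"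
      by (rule field_vector_diff_chain_within[OF 1]) (rule has_field_derivative_at_within[OF der[OF that]])
    then show ?thesis by (simp add: F_def[abs_def] o_def)
  qed
  have \<Phi>': "(\<Phi> has_vector_derivative C / sqrt (Im w + s)) (at s within T)" if "0 \<le> s" for s T
    unfolding \<Phi>_def[abs_def] has_real_derivative_iff_has_vector_derivative[symmetric]
    using that \<open>0 < Im w\<close> by (auto intro!: derivative_eq_intros simp: field_simps)
  have "norm (F \<rho> - F 0) \<le> \<Phi> \<rho> - \<Phi> 0"
  proof (rule differentiable_bound_general[OF \<open>0 < \<rho>\<close>, where f' = "\<lambda>s. \<i> * f' s"
        and \<phi>' = "\<lambda>s. C / sqrt (Im w + s)"])
    show "continuous_on {0..\<rho>} F"
      using F' has_vector_derivative_continuous by (fastforce simp: continuous_on_eq_continuous_within)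
    show "continuous_on {0..\<rho>} \<Phi>"
      unfolding \<Phi>_def[abs_def] by (intro continuous_intros)
  next
    fix s assume s: "0 < s" "s < \<rho>"
    show "(F has_vector_derivative \<i> * f' s) (at s)" using s by (intro F') auto
    show "(\<Phi> has_vector_derivative C / sqrt (Im w + s)) (at s)" using s by (intro \<Phi>') auto
    show "norm (\<i> * f' s) \<le> C / sqrt (Im w + s)" using s bound[of s] by (simp add: norm_mult)
  qed
  also have "\<dots> = 2 * C * (sqrt (Im w + \<rho>) - sqrt (Im w))" by (simp add: \<Phi>_def algebra_simps)
  also have "\<dots> \<le> 2 * C * sqrt \<rho>"
    using \<open>0 < Im w\<close> \<open>0 < \<rho>\<close> \<open>0 \<le> C\<close> sqrt_add_le_add_sqrt[of "Im w" \<rho>]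
    by (intro mult_left_mono) auto
  finally show ?thesis by (simp add: F_def)
qed

lemma uniformly_continuous_on_strip:
  fixes f :: "complex \<Rightarrow> complex"
  assumes hol: "f holomorphic_on {w. a < Re w \<and> Re w < b \<and> 0 < Im w \<and> Im w < 2 * \<delta>}"
    and bound: "\<And>w. a < Re w \<Longrightarrow> Re w < b \<Longrightarrow> 0 < Im w \<Longrightarrow> Im w < 2 * \<delta> \<Longrightarrow>
      norm (deriv f w) \<le> C / sqrt (Im w)"
    and "0 < \<delta>" "0 \<le> C"
  shows "uniformly_continuous_on {w. a < Re w \<and> Re w < b \<and> 0 < Im w \<and> Im w < \<delta>} f"
proof -
  define T2 where "T2 = {w. a < Re w \<and> Re w < b \<and> 0 < Im w \<and> Im w < 2 * \<delta>}"
  define T where "T = {w. a < Re w \<and> Re w < b \<and> 0 < Im w \<and> Im w < \<delta>}"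
  have T2: "T2 = {w. a < Re w} \<inter> {w. Re w < b} \<inter> ({w. 0 < Im w} \<inter> {w. Im w < 2 * \<delta>})"
    by (auto simp: T2_def)
  have "open T2" unfolding T2
    by (intro open_Int open_halfspace_Re_gt open_halfspace_Re_lt open_halfspace_Im_gt open_halfspace_Im_lt)
  have der: "(f has_field_derivative deriv f w) (at w)" if "w \<in> T2" for w
    by (rule holomorphic_derivI[OF hol[folded T2_def] \<open>open T2\<close> that])
  have up: "norm (f (w + \<i> * of_real \<rho>) - f w) \<le> 2 * C * sqrt \<rho>" if "w \<in> T" "0 < \<rho>" "\<rho> < \<delta>" for w \<rho>
  proof (rule Holder_vertical)
    fix s assume "0 \<le> s" "s \<le> \<rho>"
    then show "(f has_field_derivative deriv f (w + \<i> * of_real s)) (at (w + \<i> * of_real s))"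
      "norm (deriv f (w + \<i> * of_real s)) \<le> C / sqrt (Im w + s)"
      using that bound[of "w + \<i> * of_real s"] by (auto intro!: der simp: T_def T2_def)
  qed (use that \<open>0 \<le> C\<close> in \<open>auto simp: T_def\<close>)
  have Holder: "norm (f w1 - f w2) \<le> 5 * C * sqrt \<rho>"
    if w: "w1 \<in> T" "w2 \<in> T" "norm (w1 - w2) \<le> \<rho>" and \<rho>: "0 < \<rho>" "\<rho> < \<delta>" for w1 w2 \<rho>
  proof -
    define R where "R = {w. a < Re w} \<inter> {w. Re w < b} \<inter> ({w. \<rho> < Im w} \<inter> {w. Im w < 2 * \<delta>})"
    have "convex R" unfolding R_def
      by (intro convex_Int convex_halfspace_Re_gt convex_halfspace_Re_lt convex_halfspace_Im_gt convex_halfspace_Im_lt)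
    moreover have "w1 + \<i> * of_real \<rho> \<in> R" "w2 + \<i> * of_real \<rho> \<in> R"
      using w \<rho> by (auto simp: R_def T_def)
    moreover have "(f has_field_derivative deriv f w) (at w within R)" if "w \<in> R" for w
      using that \<rho> by (intro has_field_derivative_at_within[OF der]) (auto simp: R_def T2_def)
    moreover have "norm (deriv f w) \<le> C / sqrt \<rho>" if "w \<in> R" for w
    proof -
      have "norm (deriv f w) \<le> C / sqrt (Im w)" using that \<rho> by (intro bound) (auto simp: R_def)
      also have "\<dots> \<le> C / sqrt \<rho>"
        using that \<rho> \<open>0 \<le> C\<close> by (intro divide_left_mono mult_pos_pos) (auto simp: R_def)
      finally show ?thesis .
    qed
    ultimately have "norm (f (w2 + \<i> * of_real \<rho>) - f (w1 + \<i> * of_real \<rho>))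
        \<le> C / sqrt \<rho> * norm ((w2 + \<i> * of_real \<rho>) - (w1 + \<i> * of_real \<rho>))"
      using field_differentiable_bound[of R f "deriv f"] by blast
    also have "\<dots> = C / sqrt \<rho> * norm (w1 - w2)" by (simp add: norm_minus_commute)
    also have "\<dots> \<le> C / sqrt \<rho> * \<rho>" using w(3) \<rho> \<open>0 \<le> C\<close> by (intro mult_left_mono) auto
    also have "\<dots> = C * sqrt \<rho>" using \<rho> by (simp add: field_simps)
    finally have across: "norm (f (w2 + \<i> * of_real \<rho>) - f (w1 + \<i> * of_real \<rho>)) \<le> C * sqrt \<rho>" .
    have "f w1 - f w2 = (f (w2 + \<i> * of_real \<rho>) - f w2) - (f (w1 + \<i> * of_real \<rho>) - f w1)
        - (f (w2 + \<i> * of_real \<rho>) - f (w1 + \<i> * of_real \<rho>))" by simp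
    also have "norm \<dots> \<le> 2 * C * sqrt \<rho> + 2 * C * sqrt \<rho> + C * sqrt \<rho>"
      by (intro norm_triangle_le_diff add_mono up w \<rho> across)
    finally show ?thesis by simp
  qed
  show ?thesis
    unfolding T_def[symmetric] uniformly_continuous_on_def
  proof (intro allI impI)
    fix e :: real assume "0 < e"
    define \<rho> where "\<rho> = min (\<delta> / 2) ((e / (5 * (C + 1)) / 2)\<^sup>2)"
    have \<rho>: "0 < \<rho>" "\<rho> < \<delta>" using \<open>0 < \<delta>\<close> \<open>0 < e\<close> \<open>0 \<le> C\<close> by (auto simp: \<rho>_def)
    have "sqrt \<rho> \<le> sqrt ((e / (5 * (C + 1)) / 2)\<^sup>2)"
      by (intro real_sqrt_le_mono) (simp only: \<rho>_def min.cobounded2)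
    also have "\<dots> = e / (5 * (C + 1)) / 2" using \<open>0 < e\<close> \<open>0 \<le> C\<close> by (subst real_sqrt_abs) auto
    finally have "sqrt \<rho> \<le> e / (5 * (C + 1)) / 2" .
    then have "5 * (C + 1) * sqrt \<rho> \<le> e / 2"
      using \<open>0 \<le> C\<close> by (simp add: field_simps)
    moreover have "5 * C * sqrt \<rho> \<le> 5 * (C + 1) * sqrt \<rho>" using \<rho> by (intro mult_right_mono) auto
    ultimately have small: "5 * C * sqrt \<rho> < e" using \<open>0 < e\<close> by linarith
    show "\<exists>d>0. \<forall>x\<in>T. \<forall>x'\<in>T. dist x' x < d \<longrightarrow> dist (f x') (f x) < e"
      using Holder[OF _ _ _ \<rho>] small \<rho>(1)
      by (intro exI[of _ \<rho>]) (auto simp: dist_norm intro!: le_less_trans[OF Holder[OF _ _ _ \<rho>]])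
  qed
qed

text \<open>\<open>\<Gamma>\<close> is the image of the radius ending at \<open>\<zeta>\<close>, seen from above the slit, and \<open>\<gamma>\<close> the boundary orbit.\<close>

locale slit_domain_access = slit_domain +
  fixes \<Gamma> \<gamma> :: "real \<Rightarrow> complex" and r0 :: real
  assumes r0: "r0 < 1" and cont_\<Gamma>: "continuous_on {r0<..<1} \<Gamma>"
    and \<Gamma>_in: "\<And>r. r0 < r \<Longrightarrow> r < 1 \<Longrightarrow> \<Gamma> r \<in> \<Omega> \<and> 0 < Im (\<Gamma> r)"
    and \<Gamma>_lim: "(\<Gamma> \<longlongrightarrow> 0) (at_left 1)"
    and \<gamma>_lim: "\<And>t. 0 \<le> t \<Longrightarrow> t \<le> S \<Longrightarrow> ((\<lambda>r. g (\<Gamma> r + of_real t)) \<longlongrightarrow> \<gamma> t) (at_left 1)"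
begin

lemma eventually_\<Gamma>_in: "\<forall>\<^sub>F r in at_left 1. \<Gamma> r \<in> \<Omega> \<and> 0 < Im (\<Gamma> r)"
  using eventually_at_left_field[of _ 1] r0 \<Gamma>_in by blast

lemma half_strip:
  assumes "0 < a"
  shows "\<exists>\<delta>>0. \<forall>w. a < Re w \<longrightarrow> 0 < Im w \<longrightarrow> Im w < \<delta> \<longrightarrow> w \<in> \<Omega>"
proof -
  have "\<forall>\<^sub>F r in at_left 1. dist (\<Gamma> r) 0 < a" using \<Gamma>_lim assms by (rule tendstoD)
  then obtain r' where r': "r' < 1" "\<And>r. r' < r \<Longrightarrow> r < 1 \<Longrightarrow> norm (\<Gamma> r) < a"
    unfolding eventually_at_left_field by auto
  define r1 where "r1 = (max r' r0 + 1) / 2"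
  have r1: "r' < r1" "r0 < r1" "r1 < 1" using r'(1) r0 by (auto simp: r1_def)
  have "w \<in> \<Omega>" if w: "a < Re w" "0 < Im w" "Im w < Im (\<Gamma> r1)" for w
  proof -
    have "((\<lambda>r. Im (\<Gamma> r)) \<longlongrightarrow> Im 0) (at_left 1)" by (intro tendsto_intros \<Gamma>_lim)
    then have "\<forall>\<^sub>F r in at_left 1. Im (\<Gamma> r) < Im w" using w by (intro order_tendstoD) auto
    moreover have "\<forall>\<^sub>F r in at_left 1. r \<in> {r1<..<1}" using r1 by (intro eventually_at_leftI) auto
    ultimately have "\<forall>\<^sub>F r in at_left 1. Im (\<Gamma> r) < Im w \<and> r \<in> {r1<..<1}" by eventually_elim auto
    then obtain r2 where r2: "Im (\<Gamma> r2) < Im w" "r1 < r2" "r2 < 1"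
      using eventually_happens[of _ "at_left (1::real)"] by auto
    have "continuous_on {r1..r2} (\<lambda>r. Im (\<Gamma> r))"
      by (intro continuous_intros continuous_on_subset[OF cont_\<Gamma>]) (use r1 r2 in auto)
    then obtain r where r: "r1 \<le> r" "r \<le> r2" "Im (\<Gamma> r) = Im w"
      using IVT2'[of "\<lambda>r. Im (\<Gamma> r)" r2 "Im w" r1] r2 w by auto
    have "norm (\<Gamma> r) < a" "\<Gamma> r \<in> \<Omega>" using r r1 r2 r'(2) \<Gamma>_in by auto
    then have "\<Gamma> r + of_real (Re w - Re (\<Gamma> r)) \<in> \<Omega>"
      using w complex_Re_le_cmod[of "\<Gamma> r"] by (intro shift) auto
    also have "\<Gamma> r + of_real (Re w - Re (\<Gamma> r)) = w" using r by (simp add: complex_eq_iff)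
    finally show ?thesis .
  qed
  moreover have "0 < Im (\<Gamma> r1)" using \<Gamma>_in r1 by blast
  ultimately show ?thesis by blast
qed

lemma \<Gamma>_shift_tendsto: "((\<lambda>r. \<Gamma> r + of_real t) \<longlongrightarrow> of_real t) (at_left 1)"
  using tendsto_add[OF \<Gamma>_lim tendsto_const] by fastforce

lemma norm_\<gamma>:
  assumes "0 \<le> t" "t \<le> S"
  shows "norm (\<gamma> t) = 1"
proof -
  have nin: "of_real t \<notin> \<Omega>" using slit assms by simp
  have "filterlim (\<lambda>r. \<Gamma> r + of_real t) (at (of_real t) within \<Omega>) (at_left 1)"
    unfolding filterlim_at using \<Gamma>_shift_tendsto eventually_\<Gamma>_in
  proof safe
    show "\<forall>\<^sub>F r in at_left 1. \<Gamma> r + of_real t \<in> \<Omega> \<and> \<Gamma> r + of_real t \<noteq> of_real t"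
      using eventually_\<Gamma>_in
    proof eventually_elim
      case (elim r)
      then show ?case using shift[of "\<Gamma> r" t] assms nin by auto
    qed
  qed
  then have "((\<lambda>r. norm (g (\<Gamma> r + of_real t))) \<longlongrightarrow> 1) (at_left 1)"
    by (rule filterlim_compose[OF norm_g_tendsto_1[OF nin]])
  moreover have "((\<lambda>r. norm (g (\<Gamma> r + of_real t))) \<longlongrightarrow> norm (\<gamma> t)) (at_left 1)"
    by (intro tendsto_norm \<gamma>_lim assms)
  ultimately show ?thesis by (intro tendsto_unique[of "at_left (1::real)"]) auto
qed

definition g_bar :: "complex \<Rightarrow> complex" where
  "g_bar w = (if 0 < Im w then g w else \<gamma> (Re w))"

lemma g_bar_continuous:
  assumes "0 < a"
  shows "\<exists>\<delta>>0. {w. a < Re w \<and> 0 < Im w \<and> Im w < \<delta>} \<subseteq> \<Omega> \<and>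
    continuous_on {w. a < Re w \<and> Re w \<le> S \<and> 0 \<le> Im w \<and> Im w < \<delta>} g_bar"
proof -
  obtain \<delta>1 where \<delta>1: "0 < \<delta>1" "\<And>w. a / 2 < Re w \<Longrightarrow> 0 < Im w \<Longrightarrow> Im w < \<delta>1 \<Longrightarrow> w \<in> \<Omega>"
    using half_strip[of "a / 2"] assms by auto
  define \<delta> where "\<delta> = min (\<delta>1 / 4) (a / 8)"
  have \<delta>: "0 < \<delta>" "4 * \<delta> \<le> \<delta>1" "4 * \<delta> \<le> a / 2" using \<delta>1 assms by (auto simp: \<delta>_def)
  define T where "T = {w. a < Re w \<and> Re w < S + 1 \<and> 0 < Im w \<and> Im w < \<delta>}"
  obtain C where C: "0 < C" "\<And>w y. norm w \<le> S + 1 + 2 * \<delta> \<Longrightarrow> 0 < y \<Longrightarrow> ball w y \<subseteq> \<Omega> \<Longrightarrow>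
      norm (deriv g w) \<le> C / sqrt y"
    using deriv_le_inverse_sqrt_dist by blast
  have ballin: "ball w (Im w) \<subseteq> \<Omega>" if "a < Re w" "0 < Im w" "Im w < 2 * \<delta>" for w
  proof
    fix x assume "x \<in> ball w (Im w)"
    then have "\<bar>Re x - Re w\<bar> < Im w" "\<bar>Im x - Im w\<bar> < Im w"
      using abs_Re_le_cmod[of "x - w"] abs_Im_le_cmod[of "x - w"]
      by (auto simp: dist_norm norm_minus_commute)
    then show "x \<in> \<Omega>" using that \<delta> by (intro \<delta>1) auto
  qed
  have "uniformly_continuous_on T g"
    unfolding T_def
  proof (rule uniformly_continuous_on_strip[where C = C])
    show "g holomorphic_on {w. a < Re w \<and> Re w < S + 1 \<and> 0 < Im w \<and> Im w < 2 * \<delta>}"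
      using \<delta> assms by (intro holomorphic_on_subset[OF holg]) (auto intro!: \<delta>1)
  next
    fix w assume w: "a < Re w" "Re w < S + 1" "0 < Im w" "Im w < 2 * \<delta>"
    have "norm w \<le> \<bar>Re w\<bar> + \<bar>Im w\<bar>" by (rule cmod_le)
    then show "norm (deriv g w) \<le> C / sqrt (Im w)"
      using w assms by (intro C ballin) auto
  qed (use \<delta> C in auto)
  then obtain E where E: "uniformly_continuous_on (closure T) E" "\<And>w. w \<in> T \<Longrightarrow> g w = E w"
    by (rule uniformly_continuous_on_extension_on_closure) blast
  have contE: "continuous_on (closure T) E" using E(1) by (rule uniformly_continuous_imp_continuous)
  have E\<gamma>: "of_real t \<in> closure T \<and> E (of_real t) = \<gamma> t" if t: "a < t" "t \<le> S" for t
  proof -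
    have "\<forall>\<^sub>F r in at_left 1. dist (\<Gamma> r) 0 < min \<delta> (min (t - a) 1)"
      using \<Gamma>_lim t \<delta> by (intro tendstoD) auto
    with eventually_\<Gamma>_in have inT: "\<forall>\<^sub>F r in at_left 1. \<Gamma> r + of_real t \<in> T"
    proof eventually_elim
      case (elim r)
      then show ?case using abs_Re_le_cmod[of "\<Gamma> r"] abs_Im_le_cmod[of "\<Gamma> r"] t
        by (auto simp: T_def)
    qed
    then have cl: "of_real t \<in> closure T"
      using closure_subset by (intro Lim_in_closed_set[OF closed_closure _ _ \<Gamma>_shift_tendsto])
        (auto elim!: eventually_mono)
    have "((\<lambda>r. E (\<Gamma> r + of_real t)) \<longlongrightarrow> E (of_real t)) (at_left 1)"
      by (rule continuous_on_tendsto_compose[OF contE \<Gamma>_shift_tendsto cl])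
        (use inT closure_subset in \<open>auto elim!: eventually_mono\<close>)
    then have "((\<lambda>r. g (\<Gamma> r + of_real t)) \<longlongrightarrow> E (of_real t)) (at_left 1)"
      by (rule Lim_transform_eventually) (use inT E(2) in \<open>auto elim!: eventually_mono\<close>)
    moreover have "((\<lambda>r. g (\<Gamma> r + of_real t)) \<longlongrightarrow> \<gamma> t) (at_left 1)"
      using t assms by (intro \<gamma>_lim) auto
    ultimately show ?thesis using cl by (auto intro: tendsto_unique[of "at_left (1::real)"])
  qed
  define Q where "Q = {w. a < Re w \<and> Re w \<le> S \<and> 0 \<le> Im w \<and> Im w < \<delta>}"
  have Q: "w \<in> closure T \<and> E w = g_bar w" if "w \<in> Q" for w
  proof (cases "0 < Im w")
    case True
    then have "w \<in> T" using that by (auto simp: Q_def T_def)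
    then show ?thesis using True E(2) closure_subset by (auto simp: g_bar_def)
  next
    case False
    then have "w = of_real (Re w)" using that by (auto simp: Q_def complex_eq_iff)
    then show ?thesis using E\<gamma>[of "Re w"] False that by (auto simp: g_bar_def Q_def)
  qed
  have "continuous_on Q g_bar"
    by (rule continuous_on_eq[OF continuous_on_subset[OF contE]]) (use Q in auto)
  moreover have "{w. a < Re w \<and> 0 < Im w \<and> Im w < \<delta>} \<subseteq> \<Omega>"
    using \<delta> assms by (auto intro!: \<delta>1)
  ultimately show ?thesis using \<delta>(1) unfolding Q_def
    by (intro exI[of _ \<delta>] conjI)
qed

lemma \<gamma>_continuous: "continuous_on {0<..S} \<gamma>"
proof -
  have "continuous_on {a<..S} \<gamma>" if "0 < a" for a
  proof -
    obtain \<delta> where \<delta>: "0 < \<delta>"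
      "continuous_on {w. a < Re w \<and> Re w \<le> S \<and> 0 \<le> Im w \<and> Im w < \<delta>} g_bar"
      using g_bar_continuous[OF \<open>0 < a\<close>] by blast
    have "continuous_on {a<..S} (\<lambda>t. g_bar (of_real t))"
      by (rule continuous_on_compose2[OF \<delta>(2)]) (use \<delta> in \<open>auto intro!: continuous_intros\<close>)
    then show ?thesis by (simp add: g_bar_def)
  qed
  note loc = this
  have "continuous (at t within {0<..S}) \<gamma>" if "t \<in> {0<..S}" for t
  proof -
    have "continuous (at t within {t/2<..S}) \<gamma>"
      using loc[of "t/2"] that unfolding continuous_on_eq_continuous_within by simp
    moreover have "at t within {t/2<..S} = at t within {0<..S}"
      using that by (intro at_within_nhd[of _ "{t/2<..}"]) auto
    ultimately show ?thesis by simp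
  qed
  then show ?thesis by (simp add: continuous_on_eq_continuous_within)
qed

end


section \<open>The initial point and reflection\<close>

lemma inverse_cnj_unit:
  assumes "norm z = 1"
  shows "1 / cnj z = z"
proof -
  have "cnj z \<noteq> 0" using assms by auto
  moreover have "z * cnj z = 1" using assms by (simp add: complex_norm_square[symmetric])
  ultimately show ?thesis by (simp add: field_simps)
qed

lemma open_cnj_Collect: "open {w. cnj w \<in> U}" if "open U"
  using open_vimage[OF that continuous_on_cnj[OF continuous_on_id]] by (simp add: vimage_def)

lemma holomorphic_cnj_Collect:
  assumes "f holomorphic_on U" "open U"
  shows "(\<lambda>w. cnj (f (cnj w))) holomorphic_on {w. cnj w \<in> U}"
proof -
  have "cnj ` {w. cnj w \<in> U} = U" by (simp add: image_cnj_conv_vimage_cnj vimage_def)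
  then show ?thesis
    using holomorphic_on_compose_cnj_cnj[of f "{w. cnj w \<in> U}"] assms open_cnj_Collect
    by (simp add: o_def)
qed

context slit_domain_access
begin

lemma \<gamma>_tendsto_start: "(\<gamma> \<longlongrightarrow> \<gamma> 0) (at_right 0)"
proof (rule ccontr)
  assume "\<not> ?thesis"
  then obtain d where d: "0 < d" "\<not> (\<forall>\<^sub>F t in at_right 0. dist (\<gamma> t) (\<gamma> 0) < d)"
    by (auto simp: tendsto_iff)
  obtain N :: nat where N: "N \<ge> 1" "pi / N \<le> d / 2"
  proof -
    obtain N :: nat where "N > 2 * pi / d" using reals_Archimedean2 by blast
    moreover from this have "N \<ge> 1" using d(1) pi_gt_zero
      by (cases N) (auto simp: field_simps)
    ultimately show thesis using that[of N] d(1) by (auto simp: field_simps)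
  qed
  obtain H where H: "H holomorphic_on ball 0 1" "\<And>w. w \<in> \<Omega> \<Longrightarrow> H (g w) = w"
    "\<And>z. norm z < 1 \<Longrightarrow> H z \<in> \<Omega> \<and> g (H z) = z"
    using holomorphic_inverse by blast
  define t0 where "t0 = S / 2"
  define F where "F z = g (H z + of_real t0) - \<gamma> t0" for z
  have t0: "0 < t0" "t0 \<le> S" using S_pos by (auto simp: t0_def)
  have inF: "H z + of_real t0 \<in> \<Omega>" if "norm z < 1" for z
    using H(3)[OF that] t0 by (intro shift) auto
  have "g \<circ> (\<lambda>z. H z + of_real t0) holomorphic_on ball 0 1"
    by (rule holomorphic_on_compose_gen[OF _ holg])
      (use H(1) inF in \<open>auto intro!: holomorphic_intros\<close>)
  then have holF: "F holomorphic_on ball 0 1"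
    unfolding F_def[abs_def] by (intro holomorphic_intros) (simp add: o_def)
  have F2: "norm (F z) \<le> 2" if "norm z < 1" for z
    using norm_g_less[OF inF[OF that]] norm_\<gamma>[of t0] t0
      norm_triangle_ineq4[of "g (H z + of_real t0)" "\<gamma> t0"] by (simp add: F_def)
  have "F 0 \<noteq> 0"
    using norm_g_less[OF inF[of 0]] norm_\<gamma>[of t0] t0 by (auto simp: F_def)
  define e where "e = norm (F 0) ^ (2 * N) / 2 ^ (2 * N - 1) / 2"
  have e: "0 < e" using \<open>F 0 \<noteq> 0\<close> by (simp add: e_def)
  obtain \<delta> where \<delta>: "0 < \<delta>"
    "continuous_on {w. S / 4 < Re w \<and> Re w \<le> S \<and> 0 \<le> Im w \<and> Im w < \<delta>} g_bar"
    using g_bar_continuous[of "S / 4"] S_pos by auto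
  have "of_real t0 \<in> {w. S / 4 < Re w \<and> Re w \<le> S \<and> 0 \<le> Im w \<and> Im w < \<delta>}"
    using S_pos \<delta> by (simp add: t0_def)
  then obtain \<eta> where \<eta>: "0 < \<eta>" "\<And>w. S / 4 < Re w \<Longrightarrow> Re w \<le> S \<Longrightarrow> 0 \<le> Im w \<Longrightarrow> Im w < \<delta> \<Longrightarrow>
      dist w (of_real t0) < \<eta> \<Longrightarrow> dist (g_bar w) (g_bar (of_real t0)) < e"
    using \<delta>(2) e unfolding continuous_on_iff by (metis (mono_tags, lifting) mem_Collect_eq)
  define \<tau> where "\<tau> = min (\<eta> / 2) (S / 8)"
  have \<tau>: "0 < \<tau>" "\<tau> \<le> \<eta> / 2" "\<tau> \<le> S / 8" using \<eta> S_pos by (auto simp: \<tau>_def)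
  obtain t where t: "0 < t" "t < \<tau>" "d \<le> dist (\<gamma> t) (\<gamma> 0)"
    using d(2) \<tau>(1) unfolding eventually_at_right_field by (metis not_less)
  have tS: "t \<le> S" using t \<tau> by linarith
  obtain C where C: "0 < C" "\<And>w. w \<in> \<Omega> \<Longrightarrow> Re w < S \<Longrightarrow> 0 < Im w \<Longrightarrow>
      1 - norm (g w) \<le> C * Im w / sqrt (S - Re w)"
    using linear_boundary_decay by blast
  define \<mu> where "\<mu> = min \<tau> (min \<delta> (sqrt (S / 2) / C))"
  have \<mu>: "0 < \<mu>" "\<mu> \<le> \<tau>" "\<mu> \<le> \<delta>" "C * \<mu> \<le> sqrt (S / 2)"
  proof -
    show "0 < \<mu>" using \<tau> \<delta> C S_pos by (simp add: \<mu>_def)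
    show "\<mu> \<le> \<tau>" "\<mu> \<le> \<delta>" by (auto simp: \<mu>_def)
    have "\<mu> \<le> sqrt (S / 2) / C" by (simp add: \<mu>_def)
    then show "C * \<mu> \<le> sqrt (S / 2)" using C by (simp add: field_simps)
  qed
  have "((\<lambda>r. g (\<Gamma> r + of_real 0)) \<longlongrightarrow> \<gamma> 0) (at_left 1)" using S_pos by (intro \<gamma>_lim) auto
  moreover have "((\<lambda>r. g (\<Gamma> r + of_real t)) \<longlongrightarrow> \<gamma> t) (at_left 1)" using t tS by (intro \<gamma>_lim) auto
  ultimately have "((\<lambda>r. norm (sgn (g (\<Gamma> r + of_real t)) - sgn (g (\<Gamma> r + of_real 0))))
      \<longlongrightarrow> norm (sgn (\<gamma> t) - sgn (\<gamma> 0))) (at_left 1)"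
    using norm_\<gamma>[of 0] norm_\<gamma>[of t] t tS S_pos by (intro tendsto_intros) auto
  moreover have "norm (sgn (\<gamma> t) - sgn (\<gamma> 0)) \<ge> d"
    using t tS S_pos norm_\<gamma>[of 0] norm_\<gamma>[of t] by (simp add: sgn_eq dist_norm)
  ultimately have "\<forall>\<^sub>F r in at_left 1.
      d / 2 < norm (sgn (g (\<Gamma> r + of_real t)) - sgn (g (\<Gamma> r + of_real 0)))"
    using d(1) by (intro order_tendstoD(1)) auto
  moreover have "\<forall>\<^sub>F r in at_left 1. dist (\<Gamma> r) 0 < \<mu>" using \<Gamma>_lim \<mu> by (intro tendstoD) auto
  ultimately have "\<forall>\<^sub>F r in at_left 1. \<Gamma> r \<in> \<Omega> \<and> 0 < Im (\<Gamma> r) \<and> norm (\<Gamma> r) < \<mu> \<and>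
      d / 2 < norm (sgn (g (\<Gamma> r + of_real t)) - sgn (g (\<Gamma> r + of_real 0)))"
    using eventually_\<Gamma>_in by eventually_elim auto
  then obtain r where r: "\<Gamma> r \<in> \<Omega>" "0 < Im (\<Gamma> r)" "norm (\<Gamma> r) < \<mu>"
      "d / 2 < norm (sgn (g (\<Gamma> r + of_real t)) - sgn (g (\<Gamma> r + of_real 0)))"
    using eventually_happens[of _ "at_left (1::real)"] by auto
  define c where "c s = g (\<Gamma> r + of_real (s * t))" for s
  have cin: "\<Gamma> r + of_real (s * t) \<in> \<Omega>" if "0 \<le> s" for s
    using r t that by (intro shift) auto
  have Re_r: "\<bar>Re (\<Gamma> r)\<bar> < \<mu>" "Im (\<Gamma> r) < \<mu>"
    using r abs_Re_le_cmod[of "\<Gamma> r"] abs_Im_le_cmod[of "\<Gamma> r"] by auto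
  have st: "0 \<le> s * t \<and> s * t \<le> t" if "0 \<le> s" "s \<le> 1" for s
    using that t by (auto intro: mult_left_le_one_le)
  have "path c"
    unfolding path_def c_def
    by (intro continuous_on_compose2[OF holomorphic_on_imp_continuous_on[OF holg]] continuous_intros)
      (use cin in auto)
  moreover have "path_image c \<subseteq> ball 0 1 - {0}"
  proof -
    have "norm (c s) < 1 \<and> c s \<noteq> 0" if s: "0 \<le> s" "s \<le> 1" for s
    proof -
      let ?w = "\<Gamma> r + of_real (s * t)"
      have "Re ?w = Re (\<Gamma> r) + s * t" by simp
      then have "S / 2 \<le> S - Re ?w" using Re_r \<mu> \<tau> t st[OF s] by linarith
      then have "C * Im ?w / sqrt (S - Re ?w) \<le> C * Im ?w / sqrt (S / 2)"
        using S_pos r C by (intro divide_left_mono mult_pos_pos) auto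
      also have "\<dots> < C * \<mu> / sqrt (S / 2)"
        using S_pos C Re_r by (intro divide_strict_right_mono mult_strict_left_mono) auto
      also have "\<dots> \<le> 1" using \<mu>(4) S_pos by (simp add: field_simps)
      finally have "1 - norm (g ?w) < 1"
        using C(2)[OF cin[OF s(1)]] \<open>S / 2 \<le> S - Re ?w\<close> r S_pos by auto
      then show ?thesis using norm_g_less[OF cin[OF s(1)]] by (auto simp: c_def)
    qed
    then show ?thesis by (auto simp: path_image_def)
  qed
  moreover have "norm (F z) \<le> e" if z: "z \<in> path_image c" for z
  proof -
    obtain s where "s \<in> {0..1}" "z = c s" using z unfolding path_image_def by blast
    then have s: "0 \<le> s" "s \<le> 1" "z = c s" by auto
    let ?w = "\<Gamma> r + of_real (s * t) + of_real t0"
    have "dist ?w (of_real t0) = norm (\<Gamma> r + of_real (s * t))" by (simp add: dist_norm)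
    also have "\<dots> \<le> norm (\<Gamma> r) + norm (of_real (s * t) :: complex)" by (rule norm_triangle_ineq)
    also have "norm (of_real (s * t) :: complex) = s * t"
      using st[OF s(1,2)] by (metis abs_of_nonneg norm_of_real)
    finally have near: "dist ?w (of_real t0) < \<eta>" using r \<mu> \<tau> t st[OF s(1,2)] by linarith
    have "Re ?w = Re (\<Gamma> r) + s * t + S / 2" "Im ?w = Im (\<Gamma> r)" by (simp_all add: t0_def)
    then have "S / 4 < Re ?w \<and> Re ?w \<le> S \<and> 0 \<le> Im ?w \<and> Im ?w < \<delta>"
      using Re_r st[OF s(1,2)] \<mu> \<tau> t r S_pos by linarith
    then have "dist (g_bar ?w) (g_bar (of_real t0)) < e"
      using near by (intro \<eta>(2)) blast+
    moreover have "F z = g_bar ?w - g_bar (of_real t0)"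
      using H(2)[OF cin[OF s(1)]] r by (simp add: F_def s(3) c_def g_bar_def)
    ultimately show ?thesis by (simp add: dist_norm)
  qed
  moreover have "pi / N \<le> norm (sgn (pathfinish c) - sgn (pathstart c))"
    by (rule order_trans[OF N(2)]) (use r(4) in \<open>simp add: c_def pathfinish_def pathstart_def\<close>)
  ultimately have "norm (F 0) ^ (2 * N) \<le> e * 2 ^ (2 * N - 1)"
    using N(1) by (intro Koebe_arc_estimate[OF holF F2, where c = c]) auto
  also have "\<dots> = norm (F 0) ^ (2 * N) / 2" by (simp add: e_def)
  finally show False using \<open>F 0 \<noteq> 0\<close> by simp
qed

definition refl_dom :: "complex set" where
  "refl_dom = {w. (0 < Im w \<and> w \<in> \<Omega>) \<or> (Im w = 0 \<and> 0 < Re w \<and> Re w < S) \<or> (Im w < 0 \<and> cnj w \<in> \<Omega>)}"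

definition g_refl :: "complex \<Rightarrow> complex" where
  "g_refl w = (if 0 < Im w then g w else if Im w = 0 then \<gamma> (Re w) else 1 / cnj (g (cnj w)))"

definition refl_dom_fin :: "complex set" where
  "refl_dom_fin = {w \<in> refl_dom. Im w < 0 \<longrightarrow> g (cnj w) \<noteq> 0}"

lemma real_points: "0 < t \<Longrightarrow> t < S \<Longrightarrow> of_real t \<in> refl_dom_fin"
  by (simp add: refl_dom_def refl_dom_fin_def)

lemma g_refl_of_real [simp]: "g_refl (of_real t) = \<gamma> t"
  by (simp add: g_refl_def)

lemma g_refl_continuous_near_real:
  assumes t: "0 < t" "t < S"
  shows "\<exists>\<rho>>0. ball (of_real t) \<rho> \<subseteq> refl_dom_fin \<and> continuous_on (ball (of_real t) \<rho>) g_refl"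
proof -
  obtain \<delta> where \<delta>: "0 < \<delta>" "{w. t / 2 < Re w \<and> 0 < Im w \<and> Im w < \<delta>} \<subseteq> \<Omega>"
    "continuous_on {w. t / 2 < Re w \<and> Re w \<le> S \<and> 0 \<le> Im w \<and> Im w < \<delta>} g_bar"
    using g_bar_continuous[of "t / 2"] t by auto
  have "of_real t \<in> {w. t / 2 < Re w \<and> Re w \<le> S \<and> 0 \<le> Im w \<and> Im w < \<delta>}" using t \<delta> by auto
  then obtain \<eta> where \<eta>: "0 < \<eta>" "\<And>w. t / 2 < Re w \<Longrightarrow> Re w \<le> S \<Longrightarrow> 0 \<le> Im w \<Longrightarrow> Im w < \<delta> \<Longrightarrow>
      dist w (of_real t) < \<eta> \<Longrightarrow> dist (g_bar w) (g_bar (of_real t)) < 1"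
    using \<delta>(3) zero_less_one unfolding continuous_on_iff by (metis (mono_tags, lifting) mem_Collect_eq)
  define \<rho> where "\<rho> = min (min \<eta> \<delta>) (min (t / 2) (S - t))"
  have \<rho>: "0 < \<rho>" "\<rho> \<le> \<eta>" "\<rho> \<le> \<delta>" "\<rho> \<le> t / 2" "\<rho> \<le> S - t"
    using \<eta> \<delta> t unfolding \<rho>_def min_le_iff_disj by simp_all
  have coords: "t / 2 < Re w" "Re w < S" "\<bar>Im w\<bar> < \<delta>" if "w \<in> ball (of_real t) \<rho>" for w
    using that \<rho> abs_Re_le_cmod[of "w - of_real t"] abs_Im_le_cmod[of "w - of_real t"]
    by (auto simp: dist_norm norm_minus_commute)
  have cnj_ball: "cnj w \<in> ball (of_real t) \<rho>" if "w \<in> ball (of_real t) \<rho>" for w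
  proof -
    have "norm (cnj (of_real t - w)) < \<rho>" using that by (simp only: complex_mod_cnj) (simp add: dist_norm)
    then show ?thesis by (simp add: dist_norm)
  qed
  have nz: "g_bar w \<noteq> 0" if "w \<in> ball (of_real t) \<rho>" "0 \<le> Im w" for w
  proof
    assume "g_bar w = 0"
    moreover have "dist (g_bar w) (g_bar (of_real t)) < 1"
      using coords[OF that(1)] that \<rho> by (intro \<eta>(2)) (auto simp: dist_commute)
    ultimately show False using norm_\<gamma>[of t] t by (simp add: dist_norm g_bar_def)
  qed
  have "ball (of_real t) \<rho> \<subseteq> refl_dom_fin"
  proof
    fix w :: complex assume w: "w \<in> ball (of_real t) \<rho>"
    consider "0 < Im w" | "Im w = 0" | "Im w < 0" by linarith
    then show "w \<in> refl_dom_fin"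
    proof cases
      case 1 then show ?thesis using coords[OF w] \<delta>(2) by (auto simp: refl_dom_fin_def refl_dom_def)
    next
      case 2 then show ?thesis using coords[OF w] t by (auto simp: refl_dom_fin_def refl_dom_def)
    next
      case 3
      then have "cnj w \<in> \<Omega>" using coords[OF cnj_ball[OF w]] \<delta>(2) by auto
      moreover have "g (cnj w) \<noteq> 0" using nz[OF cnj_ball[OF w]] 3 by (auto simp: g_bar_def)
      ultimately show ?thesis using 3 by (auto simp: refl_dom_fin_def refl_dom_def)
    qed
  qed
  moreover have "continuous_on (ball (of_real t) \<rho>) g_refl"
  proof -
    let ?B = "ball (of_real t :: complex) \<rho>"
    have up: "continuous_on {w \<in> ?B. 0 \<le> Im w} g_bar"
      by (rule continuous_on_subset[OF \<delta>(3)]) (use coords in force)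
    have low: "continuous_on {w \<in> ?B. Im w \<le> 0} (\<lambda>w. 1 / cnj (g_bar (cnj w)))"
      by (intro continuous_intros continuous_on_compose2[OF up]) (use cnj_ball nz in auto)
    have "continuous_on ?B (\<lambda>w. if Im w \<le> 0 then 1 / cnj (g_bar (cnj w)) else g_bar w)"
    proof (rule continuous_on_cases_le[OF low up])
      fix w assume w: "w \<in> ?B" "Im w = 0"
      then have "norm (\<gamma> (Re w)) = 1" using coords[OF w(1)] t by (intro norm_\<gamma>) auto
      then show "1 / cnj (g_bar (cnj w)) = g_bar w"
        using w by (simp add: g_bar_def inverse_cnj_unit)
    qed (intro continuous_intros)
    then show ?thesis
    proof (rule continuous_on_eq)
      fix w assume w: "w \<in> ?B"
      have "1 / cnj (\<gamma> (Re w)) = \<gamma> (Re w)"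
        using coords[OF w(1)] t by (intro inverse_cnj_unit norm_\<gamma>) auto
      then show "(if Im w \<le> 0 then 1 / cnj (g_bar (cnj w)) else g_bar w) = g_refl w"
        by (auto simp: g_refl_def g_bar_def)
    qed
  qed
  ultimately show ?thesis using \<rho>(1) by blast
qed

lemma holg_cnj: "(\<lambda>w. cnj (g (cnj w))) holomorphic_on {w. cnj w \<in> \<Omega>}"
  by (rule holomorphic_cnj_Collect[OF holg open_\<Omega>])

lemma open_upper: "open {w \<in> \<Omega>. 0 < Im w}"
  using open_Int[OF open_\<Omega> open_halfspace_Im_gt[of 0]] by (simp add: Int_def)

lemma open_lower: "open {w. cnj w \<in> \<Omega> \<and> Im w < 0}"
proof -
  have "open (cnj -` {w \<in> \<Omega>. 0 < Im w})"
    by (intro open_vimage open_upper continuous_intros)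
  then show ?thesis by (simp add: vimage_def)
qed

lemma open_lower_fin: "open {w. cnj w \<in> \<Omega> \<and> Im w < 0 \<and> g (cnj w) \<noteq> 0}"
proof -
  have "open (g -` (- {0}) \<inter> \<Omega>)"
    using holomorphic_on_imp_continuous_on[OF holg] open_\<Omega> by (auto simp: continuous_on_open_vimage)
  then have "open (cnj -` (g -` (- {0}) \<inter> \<Omega>) \<inter> {w. Im w < 0})"
    by (intro open_Int[OF open_vimage[OF _ continuous_on_cnj[OF continuous_on_id]]] open_halfspace_Im_lt)
  moreover have "cnj -` (g -` (- {0}) \<inter> \<Omega>) \<inter> {w. Im w < 0} = {w. cnj w \<in> \<Omega> \<and> Im w < 0 \<and> g (cnj w) \<noteq> 0}"
    by auto
  ultimately show ?thesis by simp
qed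

lemma open_refl_dom: "open refl_dom" and open_refl_dom_fin: "open refl_dom_fin"
proof -
  have "\<exists>T. open T \<and> w \<in> T \<and> T \<subseteq> refl_dom" if "w \<in> refl_dom" for w
  proof -
    consider "0 < Im w" | "Im w = 0" | "Im w < 0" by linarith
    then show ?thesis
    proof cases
      case 1 then show ?thesis using that open_upper
        by (intro exI[of _ "{w \<in> \<Omega>. 0 < Im w}"]) (auto simp: refl_dom_def)
    next
      case 2
      then have "w = of_real (Re w)" by (simp add: complex_eq_iff)
      moreover have re: "0 < Re w" "Re w < S" using 2 that by (auto simp: refl_dom_def)
      moreover obtain \<rho> where "0 < \<rho>" "ball (of_real (Re w)) \<rho> \<subseteq> refl_dom_fin"
        using g_refl_continuous_near_real[OF re] by blast
      ultimately show ?thesis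
        by (intro exI[of _ "ball w \<rho>"]) (auto simp: refl_dom_fin_def)
    next
      case 3 then show ?thesis using that open_lower
        by (intro exI[of _ "{w. cnj w \<in> \<Omega> \<and> Im w < 0}"]) (auto simp: refl_dom_def)
    qed
  qed
  then show "open refl_dom" by (subst open_subopen) blast
  have "\<exists>T. open T \<and> w \<in> T \<and> T \<subseteq> refl_dom_fin" if "w \<in> refl_dom_fin" for w
  proof -
    consider "0 < Im w" | "Im w = 0" | "Im w < 0" by linarith
    then show ?thesis
    proof cases
      case 1 then show ?thesis using that open_upper
        by (intro exI[of _ "{w \<in> \<Omega>. 0 < Im w}"]) (auto simp: refl_dom_def refl_dom_fin_def)
    next
      case 2
      then have "w = of_real (Re w)" by (simp add: complex_eq_iff)
      moreover have re: "0 < Re w" "Re w < S" using 2 that by (auto simp: refl_dom_def refl_dom_fin_def)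
      moreover obtain \<rho> where "0 < \<rho>" "ball (of_real (Re w)) \<rho> \<subseteq> refl_dom_fin"
        using g_refl_continuous_near_real[OF re] by blast
      ultimately show ?thesis
        by (intro exI[of _ "ball w \<rho>"]) auto
    next
      case 3 then show ?thesis using that open_lower_fin
        by (intro exI[of _ "{w. cnj w \<in> \<Omega> \<and> Im w < 0 \<and> g (cnj w) \<noteq> 0}"]) (auto simp: refl_dom_def refl_dom_fin_def)
    qed
  qed
  then show "open refl_dom_fin" by (subst open_subopen) blast
qed

lemma g_refl_holomorphic: "g_refl holomorphic_on refl_dom_fin"
proof (rule holomorphic_on_paste_across_line[OF open_refl_dom_fin, of \<i> _ 0])
  have i: "\<i> \<bullet> z = Im z" for z by (simp add: inner_complex_def)
  have up: "g_refl holomorphic_on {w \<in> \<Omega>. 0 < Im w}"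
    by (rule holomorphic_transform[of g]) (auto intro: holomorphic_on_subset[OF holg] simp: g_refl_def)
  have low: "g_refl holomorphic_on {w. cnj w \<in> \<Omega> \<and> Im w < 0 \<and> g (cnj w) \<noteq> 0}"
  proof (rule holomorphic_transform)
    show "(\<lambda>w. 1 / cnj (g (cnj w))) holomorphic_on {w. cnj w \<in> \<Omega> \<and> Im w < 0 \<and> g (cnj w) \<noteq> 0}"
      by (intro holomorphic_on_divide holomorphic_on_const holomorphic_on_subset[OF holg_cnj]) auto
  qed (auto simp: g_refl_def)
  show "g_refl holomorphic_on refl_dom_fin \<inter> {z. 0 < \<i> \<bullet> z}"
    by (rule holomorphic_on_subset[OF up]) (auto simp: i refl_dom_def refl_dom_fin_def)
  show "g_refl holomorphic_on refl_dom_fin \<inter> {z. \<i> \<bullet> z < 0}"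
    by (rule holomorphic_on_subset[OF low]) (auto simp: i refl_dom_def refl_dom_fin_def)
  have "isCont g_refl w" if "w \<in> refl_dom_fin" for w
  proof -
    consider "0 < Im w" | "Im w = 0" | "Im w < 0" by linarith
    then show ?thesis
    proof cases
      case 1 then show ?thesis
        using that holomorphic_on_imp_continuous_on[OF up] open_upper
        by (auto simp: continuous_on_eq_continuous_at refl_dom_def refl_dom_fin_def)
    next
      case 2
      then have w: "w = of_real (Re w)" by (simp add: complex_eq_iff)
      have re: "0 < Re w" "Re w < S" using 2 that by (auto simp: refl_dom_def refl_dom_fin_def)
      obtain \<rho> where "0 < \<rho>" "continuous_on (ball w \<rho>) g_refl"
        using g_refl_continuous_near_real[OF re] w by auto
      then show ?thesis by (simp add: continuous_on_eq_continuous_at)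
    next
      case 3 then show ?thesis
        using that holomorphic_on_imp_continuous_on[OF low] open_lower_fin
        by (auto simp: continuous_on_eq_continuous_at refl_dom_def refl_dom_fin_def)
    qed
  qed
  then show "continuous_on refl_dom_fin g_refl" by (simp add: continuous_at_imp_continuous_on)
qed auto

lemma norm_g_refl:
  assumes "w \<in> refl_dom_fin"
  shows "0 < Im w \<Longrightarrow> norm (g_refl w) < 1" "Im w = 0 \<Longrightarrow> norm (g_refl w) = 1"
    "Im w < 0 \<Longrightarrow> 1 < norm (g_refl w)"
  using assms norm_g_less[of w] norm_g_less[of "cnj w"] norm_\<gamma>[of "Re w"]
  by (auto simp: g_refl_def refl_dom_fin_def refl_dom_def norm_divide field_simps)

lemma \<gamma>_inj:
  assumes t: "0 < t1" "t1 < S" "0 < t2" "t2 < S" and eq: "\<gamma> t1 = \<gamma> t2"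
  shows "t1 = t2"
proof (rule ccontr)
  assume "t1 \<noteq> t2"
  have ball: "\<exists>\<rho>>0. \<rho> < e \<and> ball (of_real t) \<rho> \<subseteq> refl_dom_fin \<and> open (g_refl ` ball (of_real t) \<rho>)"
    if t: "0 < t" "t < S" and "0 < e" for t e
  proof -
    obtain \<rho>' where \<rho>': "0 < \<rho>'" "ball (of_real t) \<rho>' \<subseteq> refl_dom_fin"
      using g_refl_continuous_near_real[OF t] by blast
    define \<rho> where "\<rho> = min (e / 2) \<rho>'"
    have \<rho>: "0 < \<rho>" "\<rho> < e" "ball (of_real t) \<rho> \<subseteq> refl_dom_fin"
      using \<rho>' \<open>0 < e\<close> by (auto simp: \<rho>_def)
    have "\<not> g_refl constant_on ball (of_real t) \<rho>"
    proof
      assume "g_refl constant_on ball (of_real t) \<rho>"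
      moreover have "of_real t \<in> ball (of_real t) \<rho>" "of_real t + \<i> * of_real (\<rho> / 2) \<in> ball (of_real t) \<rho>"
        using \<rho> by (auto simp: dist_norm norm_mult)
      ultimately have "g_refl (of_real t) = g_refl (of_real t + \<i> * of_real (\<rho> / 2))"
        unfolding constant_on_def by metis
      moreover have "of_real t + \<i> * of_real (\<rho> / 2) \<in> refl_dom_fin"
        using \<rho> by (auto simp: subset_eq dist_norm norm_mult)
      ultimately show False
        using norm_g_refl(1)[of "of_real t + \<i> * of_real (\<rho> / 2)"] norm_\<gamma>[of t] t \<rho>(1) by auto
    qed
    then have "open (g_refl ` ball (of_real t) \<rho>)"
      using holomorphic_on_subset[OF g_refl_holomorphic \<rho>(3)]
      by (intro open_mapping_thm[of g_refl "ball (of_real t) \<rho>"]) auto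
    then show ?thesis using \<rho> by blast
  qed
  define e where "e = \<bar>t1 - t2\<bar> / 2"
  have "0 < e" using \<open>t1 \<noteq> t2\<close> by (simp add: e_def)
  obtain \<rho>1 where 1: "0 < \<rho>1" "\<rho>1 < e" "ball (of_real t1) \<rho>1 \<subseteq> refl_dom_fin" "open (g_refl ` ball (of_real t1) \<rho>1)"
    using ball[OF t(1,2) \<open>0 < e\<close>] by blast
  obtain \<rho>2 where 2: "0 < \<rho>2" "\<rho>2 < e" "ball (of_real t2) \<rho>2 \<subseteq> refl_dom_fin" "open (g_refl ` ball (of_real t2) \<rho>2)"
    using ball[OF t(3,4) \<open>0 < e\<close>] by blast
  define V where "V = g_refl ` ball (of_real t1) \<rho>1 \<inter> g_refl ` ball (of_real t2) \<rho>2"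
  have "open V" using 1 2 by (auto simp: V_def)
  moreover have "\<gamma> t1 \<in> V"
  proof -
    have "g_refl (of_real t1) \<in> g_refl ` ball (of_real t1) \<rho>1" by (rule imageI) (use 1 in simp)
    moreover have "g_refl (of_real t2) \<in> g_refl ` ball (of_real t2) \<rho>2" by (rule imageI) (use 2 in simp)
    ultimately show ?thesis using eq by (simp add: V_def)
  qed
  ultimately obtain d where d: "0 < d" "ball (\<gamma> t1) d \<subseteq> V" by (auto elim: openE)
  have n1: "norm (\<gamma> t1) = 1" using norm_\<gamma> t by simp
  define s where "s = min (1/2) (d / 2)"
  have s: "0 < s" "s < 1" "s < d" using d by (auto simp: s_def)
  have "of_real (1 - s) * \<gamma> t1 \<in> ball (\<gamma> t1) d"
  proof -
    have "\<gamma> t1 - of_real (1 - s) * \<gamma> t1 = of_real s * \<gamma> t1" by (simp add: algebra_simps)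
    then show ?thesis using s n1 by (simp add: dist_norm norm_mult)
  qed
  then have "of_real (1 - s) * \<gamma> t1 \<in> V" using d by blast
  then obtain w1 w2 where w: "w1 \<in> ball (of_real t1) \<rho>1" "w2 \<in> ball (of_real t2) \<rho>2"
    "of_real (1 - s) * \<gamma> t1 = g_refl w1" "of_real (1 - s) * \<gamma> t1 = g_refl w2"
    unfolding V_def by auto
  have "norm (of_real (1 - s) * \<gamma> t1) = 1 - s" using s n1 by (simp add: norm_mult del: of_real_diff)
  then have "norm (g_refl w1) < 1" "norm (g_refl w2) < 1" using w s by auto
  moreover have in1: "w1 \<in> refl_dom_fin" and in2: "w2 \<in> refl_dom_fin" using w 1 2 by auto
  ultimately have "0 < Im w1 \<and> 0 < Im w2" using norm_g_refl[OF in1] norm_g_refl[OF in2]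
    by (metis linorder_neqE_linordered_idom order_less_asym order_less_irrefl)
  then have "g w1 = g w2" "w1 \<in> \<Omega>" "w2 \<in> \<Omega>" using w in1 in2 by (auto simp: g_refl_def refl_dom_fin_def refl_dom_def)
  then have "w1 = w2" using injg by (auto dest: inj_onD)
  then have "dist (of_real t1 :: complex) (of_real t2) < 2 * e"
    using w(1,2) 1(2) 2(2) dist_triangle2[of "of_real t1 :: complex" "of_real t2" w1] by auto
  moreover have "dist (of_real t1 :: complex) (of_real t2) = \<bar>t1 - t2\<bar>"
    by (metis dist_norm norm_of_real of_real_diff)
  ultimately show False by (simp add: e_def)
qed

lemma g_refl_inj: "inj_on g_refl refl_dom_fin"
proof (rule inj_onI)
  fix w1 w2 assume in1: "w1 \<in> refl_dom_fin" and in2: "w2 \<in> refl_dom_fin" and eq: "g_refl w1 = g_refl w2"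
  note n = norm_g_refl[OF in1] norm_g_refl[OF in2]
  consider "0 < Im w1" "0 < Im w2" | "Im w1 = 0" "Im w2 = 0" | "Im w1 < 0" "Im w2 < 0"
    using n eq by (metis linorder_neqE_linordered_idom order_less_asym order_less_irrefl)
  then show "w1 = w2"
  proof cases
    case 1 then show ?thesis using eq in1 in2 injg by (auto simp: g_refl_def refl_dom_fin_def refl_dom_def dest: inj_onD)
  next
    case 2 then show ?thesis using eq in1 in2 \<gamma>_inj[of "Re w1" "Re w2"]
      by (auto simp: g_refl_def refl_dom_fin_def refl_dom_def complex_eq_iff)
  next
    case 3
    then have "g (cnj w1) = g (cnj w2)" "cnj w1 \<in> \<Omega>" "cnj w2 \<in> \<Omega>"
      using eq in1 in2 by (auto simp: g_refl_def refl_dom_fin_def refl_dom_def)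
    then have "cnj w1 = cnj w2" using injg by (auto dest: inj_onD)
    then show ?thesis by simp
  qed
qed

lemma \<gamma>_has_derivative:
  assumes "0 < t" "t < S"
  shows "(\<gamma> has_vector_derivative deriv g_refl (of_real t)) (at t)"
proof -
  have "(g_refl has_field_derivative deriv g_refl (of_real t)) (at (of_real t))"
    using g_refl_holomorphic open_refl_dom_fin real_points[OF assms] by (rule holomorphic_derivI)
  moreover have "((\<lambda>s. of_real s :: complex) has_vector_derivative 1) (at t)"
    by (auto intro!: derivative_eq_intros)
  ultimately have "((g_refl \<circ> of_real) has_vector_derivative 1 * deriv g_refl (of_real t)) (at t)"
    by (intro field_vector_diff_chain_at)
  then show ?thesis by (simp add: o_def)
qed

lemma deriv_g_refl_bound:
  "\<exists>C>0. \<forall>t. 0 < t \<longrightarrow> t < S \<longrightarrow> norm (deriv g_refl (of_real t)) \<le> C / sqrt (S - t)"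
proof -
  obtain C where C: "0 < C" "\<And>w. w \<in> \<Omega> \<Longrightarrow> Re w < S \<Longrightarrow> 0 < Im w \<Longrightarrow>
      1 - norm (g w) \<le> C * Im w / sqrt (S - Re w)"
    using linear_boundary_decay by blast
  have "norm (deriv g_refl (of_real t)) \<le> 2 * C / sqrt (S - t)" if t: "0 < t" "t < S" for t
  proof -
    obtain \<delta> where \<delta>: "0 < \<delta>" "\<And>w. t / 2 < Re w \<Longrightarrow> 0 < Im w \<Longrightarrow> Im w < \<delta> \<Longrightarrow> w \<in> \<Omega>"
      using half_strip[of "t / 2"] t by auto
    define \<eta> where "\<eta> = min (\<delta> / 2) (t / 2)"
    have \<eta>: "0 < \<eta>" "2 * \<eta> \<le> \<delta>" "\<eta> \<le> t / 2" using \<delta> t by (auto simp: \<eta>_def)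
    have bound: "norm (deriv g_refl (of_real t + \<i> * of_real y)) \<le> 2 * C / sqrt (S - t)" if y: "0 < y" "y < \<eta>" for y
    proof -
      let ?w = "of_real t + \<i> * of_real y"
      have "x \<in> \<Omega>" if "x \<in> ball ?w y" for x
      proof (rule \<delta>(2))
        have "\<bar>Re (x - ?w)\<bar> < y" "\<bar>Im (x - ?w)\<bar> < y"
          using that abs_Re_le_cmod[of "x - ?w"] abs_Im_le_cmod[of "x - ?w"]
          by (auto simp only: dist_norm norm_minus_commute mem_ball)
        then show "t / 2 < Re x" "0 < Im x" "Im x < \<delta>" using y \<eta> by auto
      qed
      then have sub: "ball ?w y \<subseteq> \<Omega>" by blast
      have in\<Omega>: "?w \<in> \<Omega>" using sub y by (meson centre_in_ball subsetD)
      have "deriv g_refl ?w = deriv g ?w"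
      proof (rule complex_derivative_transform_within_open[OF _ _ open_upper])
        show "g holomorphic_on {w \<in> \<Omega>. 0 < Im w}" using holg by (rule holomorphic_on_subset) auto
        show "g_refl holomorphic_on {w \<in> \<Omega>. 0 < Im w}"
          using g_refl_holomorphic by (rule holomorphic_on_subset) (auto simp: refl_dom_def refl_dom_fin_def)
      qed (use in\<Omega> y in \<open>auto simp: g_refl_def\<close>)
      also have "norm \<dots> \<le> 2 * (1 - norm (g ?w)) / y" by (rule deriv_le_dist[OF y(1) sub])
      also have "\<dots> \<le> 2 * (C * y / sqrt (S - t)) / y"
        using C(2)[OF in\<Omega>] y t by (intro divide_right_mono mult_left_mono) auto
      also have "\<dots> = 2 * C / sqrt (S - t)" using y by simp
      finally show ?thesis .
    qed
    have "isCont (deriv g_refl) (of_real t)"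
      using holomorphic_on_imp_continuous_on[OF holomorphic_deriv[OF g_refl_holomorphic open_refl_dom_fin]]
        open_refl_dom_fin real_points[OF t] by (simp add: continuous_on_eq_continuous_at)
    moreover have "((\<lambda>y. of_real t + \<i> * of_real y :: complex) \<longlongrightarrow> of_real t + \<i> * of_real 0) (at_right 0)"
      by (intro tendsto_intros)
    ultimately have "((\<lambda>y. deriv g_refl (of_real t + \<i> * of_real y)) \<longlongrightarrow> deriv g_refl (of_real t)) (at_right 0)"
      by (intro isCont_tendsto_compose[of _ "deriv g_refl"]) auto
    then have "((\<lambda>y. norm (deriv g_refl (of_real t + \<i> * of_real y))) \<longlongrightarrow> norm (deriv g_refl (of_real t))) (at_right 0)"
      by (rule tendsto_norm)
    moreover have "\<forall>\<^sub>F y in at_right 0. norm (deriv g_refl (of_real t + \<i> * of_real y)) \<le> 2 * C / sqrt (S - t)"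
      unfolding eventually_at_right_field using bound \<eta>(1) by blast
    ultimately show ?thesis by (intro tendsto_upperbound) auto
  qed
  then show ?thesis using C(1) by (intro exI[of _ "2 * C"]) auto
qed

end


section \<open>Simple connectivity of the reflected domain\<close>

lemma simply_connected_contracting_homotopies:
  fixes U :: "'a::real_normed_vector set"
  assumes "\<And>K. compact K \<Longrightarrow> K \<subseteq> U \<Longrightarrow> \<exists>c q. continuous_on K q \<and>
    (\<forall>w\<in>K. closed_segment w (q w) \<subseteq> U \<and> closed_segment (q w) c \<subseteq> U)"
  shows "simply_connected U"
  unfolding simply_connected_def
proof (intro allI impI)
  fix p p' :: "real \<Rightarrow> 'a"
  assume pp: "path p \<and> pathfinish p = pathstart p \<and> path_image p \<subseteq> U \<and>
    path p' \<and> pathfinish p' = pathstart p' \<and> path_image p' \<subseteq> U"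
  define K where "K = path_image p \<union> path_image p'"
  have "compact K" "K \<subseteq> U" using pp by (auto simp: K_def compact_path_image)
  then obtain c q where q: "continuous_on K q"
    "\<And>w. w \<in> K \<Longrightarrow> closed_segment w (q w) \<subseteq> U" "\<And>w. w \<in> K \<Longrightarrow> closed_segment (q w) c \<subseteq> U"
    using assms[of K] by blast
  have contract: "homotopic_loops U r (\<lambda>t. c)"
    if r: "path r" "pathfinish r = pathstart r" "path_image r \<subseteq> K" for r
  proof -
    have inK: "r t \<in> K" if "t \<in> {0..1}" for t using r(3) that by (auto simp: path_image_def)
    have path: "path (q \<circ> r)"
      using r(1,3) q(1) by (intro path_continuous_image continuous_on_subset[OF q(1)])
    have loop: "pathfinish (q \<circ> r) = pathstart (q \<circ> r)"
      using r(2) by (simp add: pathfinish_def pathstart_def)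
    have "homotopic_loops U r (q \<circ> r)"
      using r path loop q(2)[OF inK] by (intro homotopic_loops_linear) auto
    moreover have "homotopic_loops U (q \<circ> r) (\<lambda>t. c)"
      using path loop q(3)[OF inK]
      by (intro homotopic_loops_linear) (auto simp: path_def pathfinish_def pathstart_def)
    ultimately show ?thesis by (rule homotopic_loops_trans)
  qed
  have "homotopic_loops U p (\<lambda>t. c)" "homotopic_loops U p' (\<lambda>t. c)"
    using pp by (auto intro!: contract simp: K_def)
  then show "homotopic_loops U p p'" by (metis homotopic_loops_sym homotopic_loops_trans)
qed

context slit_domain_access
begin

lemma refl_dom_iff:
  "v \<in> refl_dom \<longleftrightarrow> (if Im v = 0 then 0 < Re v \<and> Re v < S else Complex (Re v) \<bar>Im v\<bar> \<in> \<Omega>)"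
proof -
  have "Complex (Re v) \<bar>Im v\<bar> = (if 0 \<le> Im v then v else cnj v)" by (auto simp: complex_eq_iff)
  then show ?thesis by (auto simp: refl_dom_def)
qed

lemma eventually_right:
  assumes "0 < \<eta>" "y1 \<in> Im ` \<Omega>"
  shows "\<exists>M. \<forall>w. \<eta> \<le> Im w \<longrightarrow> Im w \<le> y1 \<longrightarrow> M \<le> Re w \<longrightarrow> w \<in> \<Omega>"
proof -
  obtain \<delta> where \<delta>: "0 < \<delta>" "\<And>w. 1 < Re w \<Longrightarrow> 0 < Im w \<Longrightarrow> Im w < \<delta> \<Longrightarrow> w \<in> \<Omega>"
    using half_strip[of 1] by auto
  define y0 where "y0 = min \<eta> (\<delta> / 2)"
  have y0: "0 < y0" "y0 \<le> \<eta>" "y0 < \<delta>" using \<delta> assms by (auto simp: y0_def)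
  have "Complex 2 y0 \<in> \<Omega>" using y0 by (intro \<delta>) auto
  then have y0in: "y0 \<in> Im ` \<Omega>" by (metis complex.sel(2) image_eqI)
  have conn: "connected (Im ` \<Omega>)" by (intro connected_continuous_image connected_\<Omega> continuous_intros)
  have cov: "{\<eta>..y1} \<subseteq> (\<Union>n::nat. {y. Complex (real n) y \<in> \<Omega>})"
  proof
    fix y assume "y \<in> {\<eta>..y1}"
    then have "y \<in> Im ` \<Omega>" using connectedD_interval[OF conn y0in assms(2), of y] y0 by auto
    then obtain w where w: "w \<in> \<Omega>" "Im w = y" by auto
    obtain n :: nat where "Re w \<le> real n" using real_arch_simple by blast
    then have "w + of_real (real n - Re w) \<in> \<Omega>" using w by (intro shift) auto
    also have "w + of_real (real n - Re w) = Complex (real n) y" using w by (simp add: complex_eq_iff)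
    finally show "y \<in> (\<Union>n::nat. {y. Complex (real n) y \<in> \<Omega>})" by blast
  qed
  have op: "open {y. Complex (real n) y \<in> \<Omega>}" for n :: nat
  proof -
    have "open ((\<lambda>y. of_real (real n) + \<i> * of_real y) -` \<Omega>)"
      by (intro open_vimage open_\<Omega> continuous_intros)
    then show ?thesis by (simp add: vimage_def Complex_eq)
  qed
  obtain D where D: "finite D" "{\<eta>..y1} \<subseteq> (\<Union>n\<in>D. {y. Complex (real n) y \<in> \<Omega>})"
    using compactE_image[OF compact_Icc _ cov] op by metis
  define M where "M = (\<Sum>n\<in>D. real n)"
  have "w \<in> \<Omega>" if w: "\<eta> \<le> Im w" "Im w \<le> y1" "M \<le> Re w" for w
  proof -
    obtain n where n: "n \<in> D" "Complex (real n) (Im w) \<in> \<Omega>" using D(2) w by auto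
    have "real n \<le> M" unfolding M_def using D(1) n(1) by (intro member_le_sum) auto
    then have "Complex (real n) (Im w) + of_real (Re w - real n) \<in> \<Omega>" using n w by (intro shift) auto
    also have "Complex (real n) (Im w) + of_real (Re w - real n) = w" by (simp add: complex_eq_iff)
    finally show ?thesis .
  qed
  then show ?thesis by blast
qed

text \<open>
  A compact part of the domain is first sheared to the right, away from the real slit, after
  which it is visible from a point of the segment.
\<close>

lemma simply_connected_refl_dom: "simply_connected refl_dom"
proof (rule simply_connected_contracting_homotopies)
  fix K assume K: "compact K" "K \<subseteq> refl_dom"
  show "\<exists>c q. continuous_on K q \<and>
    (\<forall>w\<in>K. closed_segment w (q w) \<subseteq> refl_dom \<and> closed_segment (q w) c \<subseteq> refl_dom)"
  proof (cases "K = {}")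
    case True then show ?thesis by (intro exI[of _ 0] exI[of _ id]) auto
  next
    case False
    define K0 where "K0 = K \<inter> {w. Im w = 0}"
    have "closed {w. Im w = 0}" by (intro closed_Collect_eq continuous_intros)
    then have "compact K0" using K by (auto simp: K0_def)
    have "\<exists>a>0. a < S \<and> (\<forall>w\<in>K0. a < Re w)"
    proof (cases "K0 = {}")
      case True then show ?thesis using S_pos by (intro exI[of _ "S / 2"]) auto
    next
      case False
      have "continuous_on K0 Re" by (intro continuous_intros)
      then obtain w0 where w0: "w0 \<in> K0" "\<And>w. w \<in> K0 \<Longrightarrow> Re w0 \<le> Re w"
        using continuous_attains_inf[OF \<open>compact K0\<close> False] by blast
      then have "0 < Re w0" "Re w0 < S" using K by (auto simp: K0_def refl_dom_def)
      then show ?thesis using w0(2) by (intro exI[of _ "Re w0 / 2"]) force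
    qed
    then obtain a where a: "0 < a" "a < S" "\<And>w. w \<in> K0 \<Longrightarrow> a < Re w" by blast
    have "\<exists>\<delta>1>0. \<forall>w\<in>K. \<bar>Im w\<bar> < \<delta>1 \<longrightarrow> a < Re w"
    proof (cases "K \<inter> {w. Re w \<le> a} = {}")
      case True then show ?thesis by (intro exI[of _ 1]) (auto simp: not_le[symmetric])
    next
      case False
      have "compact (K \<inter> {w. Re w \<le> a})"
        by (rule compact_Int_closed[OF K(1) closed_halfspace_Re_le])
      moreover have "continuous_on (K \<inter> {w. Re w \<le> a}) (\<lambda>w. \<bar>Im w\<bar>)" by (intro continuous_intros)
      ultimately obtain w0 where w0: "w0 \<in> K \<inter> {w. Re w \<le> a}"
        "\<And>w. w \<in> K \<inter> {w. Re w \<le> a} \<Longrightarrow> \<bar>Im w0\<bar> \<le> \<bar>Im w\<bar>"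
        using continuous_attains_inf[OF _ False] by blast
      have "Im w0 \<noteq> 0" using w0(1) a(3)[of w0] by (auto simp: K0_def)
      then show ?thesis using w0(2) by (intro exI[of _ "\<bar>Im w0\<bar>"]) force
    qed
    then obtain \<delta>1 where \<delta>1: "0 < \<delta>1" "\<And>w. w \<in> K \<Longrightarrow> \<bar>Im w\<bar> < \<delta>1 \<Longrightarrow> a < Re w" by blast
    obtain \<delta>2 where \<delta>2: "0 < \<delta>2" "\<And>w. a < Re w \<Longrightarrow> 0 < Im w \<Longrightarrow> Im w < \<delta>2 \<Longrightarrow> w \<in> \<Omega>"
      using half_strip[OF a(1)] by blast
    define \<delta> where "\<delta> = min \<delta>1 \<delta>2"
    have \<delta>: "0 < \<delta>" "\<delta> \<le> \<delta>1" "\<delta> \<le> \<delta>2" using \<delta>1 \<delta>2 by (auto simp: \<delta>_def)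
    have "continuous_on K (\<lambda>w. \<bar>Im w\<bar>)" by (intro continuous_intros)
    then obtain wY where wY: "wY \<in> K" "\<And>w. w \<in> K \<Longrightarrow> \<bar>Im w\<bar> \<le> \<bar>Im wY\<bar>"
      using continuous_attains_sup[OF K(1) False] by blast
    define Y where "Y = \<bar>Im wY\<bar>"
    have "\<exists>M. \<forall>w. \<delta> \<le> Im w \<longrightarrow> Im w \<le> Y \<longrightarrow> M \<le> Re w \<longrightarrow> w \<in> \<Omega>"
    proof (cases "Im wY = 0")
      case True then show ?thesis using \<delta> by (auto simp: Y_def)
    next
      case False
      then have "Complex (Re wY) Y \<in> \<Omega>" using wY(1) K(2) by (auto simp: refl_dom_iff Y_def)
      then have "Y \<in> Im ` \<Omega>" by (metis complex.sel(2) image_eqI)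
      then show ?thesis by (rule eventually_right[OF \<delta>(1)])
    qed
    then obtain M where M: "\<And>w. \<delta> \<le> Im w \<Longrightarrow> Im w \<le> Y \<Longrightarrow> M \<le> Re w \<Longrightarrow> w \<in> \<Omega>" by blast
    obtain B where B: "\<And>w. w \<in> K \<Longrightarrow> norm w \<le> B"
      using compact_imp_bounded[OF K(1)] by (auto simp: bounded_iff)
    have B0: "0 \<le> B" using B[OF wY(1)] norm_ge_zero[of wY] by linarith
    define m where "m = \<bar>M\<bar> * Y / \<delta>"
    define T where "T = (B + a + 1 + m) / \<delta>"
    have Y0: "0 \<le> Y" by (simp add: Y_def)
    have m: "0 \<le> m" using Y0 \<delta> by (simp add: m_def)
    have T: "0 < T" "T * \<delta> = B + a + 1 + m" using \<delta> a B0 m by (auto simp: T_def)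
    define c0 where "c0 = (a + S) / 2"
    have c0: "a < c0" "c0 < S" using a by (auto simp: c0_def)
    define q where "q w = w + of_real (T * \<bar>Im w\<bar>)" for w
    have qa: "a < Re (q w)" if "w \<in> K" for w
    proof (cases "\<bar>Im w\<bar> < \<delta>")
      case True
      then have "a < Re w" using \<delta>1(2)[OF that] \<delta> by auto
      moreover have "0 \<le> T * \<bar>Im w\<bar>" using T by simp
      ultimately show ?thesis by (simp add: q_def)
    next
      case False
      then have "T * \<delta> \<le> T * \<bar>Im w\<bar>" using T by (intro mult_left_mono) auto
      then show ?thesis using T m B[OF that] abs_Re_le_cmod[of w] by (simp add: q_def)
    qed
    have seg1: "closed_segment w (q w) \<subseteq> refl_dom" if w: "w \<in> K" for w
    proof
      fix v assume "v \<in> closed_segment w (q w)"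
      then obtain s where s: "0 \<le> s" "s \<le> 1" "v = (1 - s) *\<^sub>R w + s *\<^sub>R q w"
        by (auto simp: closed_segment_def)
      have v: "Re v = Re w + s * (T * \<bar>Im w\<bar>)" "Im v = Im w"
        unfolding s(3) by (simp_all add: q_def algebra_simps)
      show "v \<in> refl_dom"
      proof (cases "Im w = 0")
        case True then show ?thesis using w K(2) v by (auto simp: refl_dom_iff)
      next
        case False
        then have "Complex (Re w) \<bar>Im w\<bar> \<in> \<Omega>" using w K(2) by (auto simp: refl_dom_iff)
        then have "Complex (Re w) \<bar>Im w\<bar> + of_real (s * (T * \<bar>Im w\<bar>)) \<in> \<Omega>"
          using s T by (intro shift) auto
        also have "Complex (Re w) \<bar>Im w\<bar> + of_real (s * (T * \<bar>Im w\<bar>)) = Complex (Re v) \<bar>Im v\<bar>"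
          by (simp add: complex_eq_iff v)
        finally show ?thesis using False v by (simp add: refl_dom_iff)
      qed
    qed
    have seg2: "closed_segment (q w) (of_real c0) \<subseteq> refl_dom" if w: "w \<in> K" for w
    proof
      fix v assume "v \<in> closed_segment (q w) (of_real c0)"
      then have "v \<in> closed_segment (of_real c0) (q w)" by (simp add: closed_segment_commute)
      then obtain s where s: "0 \<le> s" "s \<le> 1" "v = (1 - s) *\<^sub>R of_real c0 + s *\<^sub>R q w"
        by (auto simp: closed_segment_def)
      have Rev: "Re v = (1 - s) * c0 + s * Re (q w)" and Imv: "Im v = s * Im w"
        unfolding s(3) by (simp_all add: q_def)
      have Rev_a: "a < Re v"
      proof -
        have "convex {a<..}" by simp
        then have "(1 - s) *\<^sub>R c0 + s *\<^sub>R Re (q w) \<in> {a<..}"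
          using s c0 qa[OF w] by (intro convexD) auto
        then show ?thesis by (simp add: Rev)
      qed
      show "v \<in> refl_dom"
      proof (cases "Im v = 0")
        case True
        have "Re v < S"
        proof (cases "s = 0")
          case True then show ?thesis using c0 by (simp add: Rev)
        next
          case False
          then have "Im w = 0" using True Imv by simp
          then have "Re (q w) < S" using w K(2) by (auto simp: q_def refl_dom_iff)
          have "convex {..<S}" by simp
          then have "(1 - s) *\<^sub>R c0 + s *\<^sub>R Re (q w) \<in> {..<S}"
            using s c0 \<open>Re (q w) < S\<close> by (intro convexD) auto
          then show ?thesis by (simp add: Rev)
        qed
        then show ?thesis using True Rev_a a by (simp add: refl_dom_iff)
      next
        case False
        have "Complex (Re v) \<bar>Im v\<bar> \<in> \<Omega>"
        proof (cases "\<bar>Im v\<bar> < \<delta>")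
          case True then show ?thesis using False Rev_a \<delta> by (intro \<delta>2(2)) auto
        next
          case large: False
          have "s * \<bar>Im w\<bar> \<le> s * Y" using wY(2)[OF w] s by (intro mult_left_mono) (auto simp: Y_def)
          moreover have Imv': "\<bar>Im v\<bar> = s * \<bar>Im w\<bar>" by (simp only: Imv abs_mult abs_of_nonneg[OF s(1)])
          ultimately have sY: "\<delta> \<le> s * Y" using large by linarith
          have "\<bar>Im v\<bar> \<le> 1 * \<bar>Im w\<bar>" unfolding Imv' using s by (intro mult_right_mono) auto
          then have Imw: "\<delta> \<le> \<bar>Im w\<bar>" "\<bar>Im v\<bar> \<le> Y" using large wY(2)[OF w] by (auto simp: Y_def)
          have "T * \<delta> \<le> T * \<bar>Im w\<bar>" using T Imw by (intro mult_left_mono) auto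
          then have "m \<le> Re (q w)" using T a B[OF w] abs_Re_le_cmod[of w] by (simp add: q_def)
          then have "s * m \<le> s * Re (q w)" using s by (intro mult_left_mono) auto
          also have "\<dots> \<le> Re v" using s c0 a by (simp add: Rev)
          finally have "s * m \<le> Re v" .
          moreover have "\<bar>M\<bar> \<le> s * m"
          proof -
            have "\<bar>M\<bar> * \<delta> \<le> \<bar>M\<bar> * (s * Y)" using sY by (intro mult_left_mono) auto
            then show ?thesis using \<delta>(1) by (simp add: m_def field_simps)
          qed
          ultimately show ?thesis using large Imw by (intro M) auto
        qed
        then show ?thesis using False by (simp add: refl_dom_iff)
      qed
    qed
    have "continuous_on K q" unfolding q_def[abs_def] by (intro continuous_intros)
    then show ?thesis using seg1 seg2 by blast
  qed
qed

end


section \<open>Transfer of hyperbolic densities\<close>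

lemma riemann_map_density_le:
  assumes "open U" and f: "riemann_map U f" and f': "riemann_map U f'" and z: "z \<in> U"
  shows "disc_density (f' z) * norm (deriv f' z) \<le> disc_density (f z) * norm (deriv f z)"
proof -
  have holf: "f holomorphic_on U" and inj: "inj_on f U" and img: "f ` U = ball 0 1"
    using f by (auto simp: riemann_map_def bij_betw_def)
  have holf': "f' holomorphic_on U" and img': "f' ` U = ball 0 1"
    using f' by (auto simp: riemann_map_def bij_betw_def)
  obtain G where G: "G holomorphic_on (f ` U)" "\<And>w. w \<in> U \<Longrightarrow> G (f w) = w"
    using holomorphic_has_inverse[OF holf \<open>open U\<close> inj] by metis
  have Gin: "G x \<in> U" if "x \<in> ball 0 1" for x
    using that G(2) unfolding img[symmetric] by auto
  have holF: "f' \<circ> G holomorphic_on ball 0 1"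
    using G(1) Gin unfolding img by (intro holomorphic_on_compose_gen[OF _ holf']) auto
  have maps: "norm ((f' \<circ> G) x) < 1" if "norm x < 1" for x
    using Gin[of x] that img' by auto
  have fz: "norm (f z) < 1" "norm (f' z) < 1" using z img img' by auto
  have "(f has_field_derivative deriv f z) (at z)" using holf \<open>open U\<close> z by (rule holomorphic_derivI)
  moreover have "((f' \<circ> G) has_field_derivative deriv (f' \<circ> G) (f z)) (at (f z))"
    using holF fz by (intro holomorphic_derivI[of _ "ball 0 1"]) auto
  ultimately have "((f' \<circ> G) \<circ> f has_field_derivative deriv (f' \<circ> G) (f z) * deriv f z) (at z)"
    by (intro DERIV_chain)
  then have "(f' has_field_derivative deriv (f' \<circ> G) (f z) * deriv f z) (at z)"
    by (rule has_field_derivative_transform_within_open[OF _ \<open>open U\<close> z]) (simp add: G(2))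
  then have der: "deriv f' z = deriv (f' \<circ> G) (f z) * deriv f z" by (rule DERIV_imp_deriv)
  have "norm (deriv (f' \<circ> G) (f z)) * (1 - (norm (f z))\<^sup>2) \<le> 1 - (norm (f' z))\<^sup>2"
    using Schwarz_Pick_deriv[OF holF maps fz(1)] G(2)[OF z] by (simp add: o_def)
  moreover have "0 < 1 - (norm (f z))\<^sup>2" "0 < 1 - (norm (f' z))\<^sup>2"
    using fz by (simp_all add: abs_square_less_1)
  ultimately have "norm (deriv (f' \<circ> G) (f z)) / (1 - (norm (f' z))\<^sup>2) \<le> 1 / (1 - (norm (f z))\<^sup>2)"
    by (simp add: field_simps)
  then have "norm (deriv (f' \<circ> G) (f z)) / (1 - (norm (f' z))\<^sup>2) * norm (deriv f z)
      \<le> 1 / (1 - (norm (f z))\<^sup>2) * norm (deriv f z)"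
    by (rule mult_right_mono) simp
  then show ?thesis by (simp add: disc_density_def der norm_mult)
qed

lemma hyperbolic_density_eq:
  assumes "open U" "riemann_map U f" "z \<in> U"
  shows "hyperbolic_density U z = disc_density (f z) * norm (deriv f z)"
  unfolding hyperbolic_density_def
  using assms riemann_map_density_le[OF assms(1) _ _ assms(3)]
  by (intro the_equality) (auto intro!: antisym)

lemma ex_riemann_map:
  assumes "open U" "simply_connected U" "U \<noteq> {}" "U \<noteq> UNIV"
  shows "\<exists>f. riemann_map U f"
proof -
  obtain f g where fg: "f holomorphic_on U" "\<forall>z\<in>U. f z \<in> ball 0 1 \<and> g (f z) = z"
    "\<forall>z\<in>ball 0 1. g z \<in> U \<and> f (g z) = z"
    using Riemann_mapping_theorem[of U] assms by blast
  then have "bij_betw f U (ball 0 1)" by (intro bij_betw_byWitness[of _ g]) auto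
  then show ?thesis using fg(1) by (auto simp: riemann_map_def)
qed

lemma inj_sphere_inverse: "inj sphere_inverse"
  by (auto simp: inj_def sphere_inverse_def split: if_splits)

text \<open>\<open>k1\<close> and \<open>k2\<close> are \<open>K\<close> read in the coordinates \<open>z\<close> and \<open>1/z\<close> of the sphere.\<close>

locale sphere_chart =
  fixes W W1 W2 :: "complex set" and K :: "complex \<Rightarrow> complex option" and k1 k2 :: "complex \<Rightarrow> complex"
  assumes open_W: "open W" and inj_K: "inj_on K W"
    and open_W1: "open W1" and W1: "W1 = {w \<in> W. K w \<noteq> None}"
    and hol_k1: "k1 holomorphic_on W1" and k1: "\<And>w. w \<in> W1 \<Longrightarrow> K w = Some (k1 w)"
    and open_W2: "open W2" and W2: "W2 \<subseteq> W" and cover: "W \<subseteq> W1 \<union> W2"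
    and hol_k2: "k2 holomorphic_on W2" and k2: "\<And>w. w \<in> W2 \<Longrightarrow> K w = sphere_inverse (k2 w)"
begin

lemma inj_k1: "inj_on k1 W1"
proof (rule inj_onI)
  fix x y assume xy: "x \<in> W1" "y \<in> W1" "k1 x = k1 y"
  then have "K x = K y" by (simp add: k1)
  then show "x = y" using xy inj_K by (auto simp: W1 dest: inj_onD)
qed

lemma inj_k2: "inj_on k2 W2"
proof (rule inj_onI)
  fix x y assume xy: "x \<in> W2" "y \<in> W2" "k2 x = k2 y"
  then have "K x = K y" by (simp add: k2)
  then show "x = y" using xy inj_K W2 by (auto dest: inj_onD)
qed

lemma image_k1: "{z. Some z \<in> K ` W} = k1 ` W1"
proof -
  have "z \<in> k1 ` W1" if "Some z = K w" "w \<in> W" for z w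
  proof -
    have "w \<in> W1" using that by (auto simp: W1 simp flip: that(1))
    then show ?thesis using that(1) k1 by auto
  qed
  moreover have "Some (k1 w) \<in> K ` W" if "w \<in> W1" for w
    using that k1[OF that] by (auto simp: W1 image_iff intro!: bexI[of _ w])
  ultimately show ?thesis by auto
qed

lemma pullback_riemann_map:
  assumes F: "sphere_riemann_map (K ` W) F"
  shows "riemann_map W (F \<circ> K)"
proof -
  have F1: "(\<lambda>z. F (Some z)) holomorphic_on k1 ` W1"
    and F2: "(\<lambda>w. F (sphere_inverse w)) holomorphic_on {w. sphere_inverse w \<in> K ` W}"
    and bij: "bij_betw F (K ` W) unit_disc"
    using F unfolding sphere_riemann_map_def image_k1 by auto
  have "(\<lambda>z. F (Some z)) \<circ> k1 holomorphic_on W1"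
    by (rule holomorphic_on_compose[OF hol_k1 F1])
  then have 1: "F \<circ> K holomorphic_on W1"
    by (rule holomorphic_transform) (simp add: k1)
  have "(\<lambda>w. F (sphere_inverse w)) \<circ> k2 holomorphic_on W2"
  proof (rule holomorphic_on_compose_gen[OF hol_k2 F2])
    have "sphere_inverse (k2 w) \<in> K ` W" if "w \<in> W2" for w
      using that W2 unfolding k2[OF that, symmetric] by blast
    then show "k2 ` W2 \<subseteq> {w. sphere_inverse w \<in> K ` W}" by auto
  qed
  then have 2: "F \<circ> K holomorphic_on W2"
    by (rule holomorphic_transform) (simp add: k2)
  have "F \<circ> K holomorphic_on W"
    using holomorphic_on_Un[OF 1 2 open_W1 open_W2] cover holomorphic_on_subset by blast
  moreover have "bij_betw (F \<circ> K) W unit_disc"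
    using bij_betw_trans[OF inj_on_imp_bij_betw[OF inj_K] bij] .
  ultimately show ?thesis by (simp add: riemann_map_def)
qed

lemma pushforward_riemann_map:
  assumes f: "riemann_map W f"
  shows "sphere_riemann_map (K ` W) (f \<circ> inv_into W K)"
proof -
  have holf: "f holomorphic_on W" and bij: "bij_betw f W unit_disc"
    using f by (auto simp: riemann_map_def)
  have inv: "inv_into W K (K w) = w" if "w \<in> W" for w using inv_into_f_f[OF inj_K that] .
  obtain G1 where G1: "G1 holomorphic_on (k1 ` W1)" "\<And>w. w \<in> W1 \<Longrightarrow> G1 (k1 w) = w"
    using holomorphic_has_inverse[OF hol_k1 open_W1 inj_k1] by metis
  obtain G2 where G2: "G2 holomorphic_on (k2 ` W2)" "\<And>w. w \<in> W2 \<Longrightarrow> G2 (k2 w) = w"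
    using holomorphic_has_inverse[OF hol_k2 open_W2 inj_k2] by metis
  let ?F = "f \<circ> inv_into W K"
  have F1: "(\<lambda>z. ?F (Some z)) holomorphic_on k1 ` W1"
  proof (rule holomorphic_transform)
    show "f \<circ> G1 holomorphic_on k1 ` W1"
      by (rule holomorphic_on_compose_gen[OF G1(1) holf]) (auto simp: G1(2), simp add: W1)
    show "(f \<circ> G1) z = ?F (Some z)" if "z \<in> k1 ` W1" for z
    proof -
      obtain w where w: "w \<in> W1" "z = k1 w" using \<open>z \<in> k1 ` W1\<close> by blast
      then have "w \<in> W" by (simp add: W1)
      then show ?thesis using w G1(2) inv[of w] k1[of w] by simp
    qed
  qed
  have open1: "open (k1 ` W1)" by (rule open_mapping_thm3[OF hol_k1 open_W1 inj_k1])
  have open2: "open (k2 ` W2)" by (rule open_mapping_thm3[OF hol_k2 open_W2 inj_k2])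
  have F2: "(\<lambda>z. ?F (sphere_inverse z)) holomorphic_on k2 ` W2"
  proof (rule holomorphic_transform)
    show "f \<circ> G2 holomorphic_on k2 ` W2"
      using W2 by (intro holomorphic_on_compose_gen[OF G2(1) holf]) (auto simp: G2(2))
    show "(f \<circ> G2) z = ?F (sphere_inverse z)" if "z \<in> k2 ` W2" for z
      using that inv W2 by (auto simp: G2(2) simp flip: k2)
  qed
  let ?V = "{z. z \<noteq> 0 \<and> 1 / z \<in> k1 ` W1}"
  have "open ((\<lambda>z. 1 / z) -` (k1 ` W1) \<inter> (- {0}))"
    unfolding Int_commute[of _ "- {0}"]
    by (rule continuous_open_preimage) (auto intro!: continuous_intros open1)
  moreover have "(\<lambda>z. 1 / z) -` (k1 ` W1) \<inter> (- {0}) = ?V" by auto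
  ultimately have openV: "open ?V" by simp
  have "(\<lambda>z. ?F (Some z)) \<circ> (\<lambda>z. 1 / z) holomorphic_on ?V"
    by (rule holomorphic_on_compose_gen[OF _ F1]) (auto intro!: holomorphic_intros)
  then have F3: "(\<lambda>z. ?F (sphere_inverse z)) holomorphic_on ?V"
    by (rule holomorphic_transform) (auto simp: sphere_inverse_def)
  have sub: "{z. sphere_inverse z \<in> K ` W} \<subseteq> ?V \<union> k2 ` W2"
  proof
    fix z assume "z \<in> {z. sphere_inverse z \<in> K ` W}"
    then obtain w where w: "w \<in> W" "sphere_inverse z = K w" by auto
    show "z \<in> ?V \<union> k2 ` W2"
    proof (cases "w \<in> W2")
      case True
      then have "z = k2 w" using w k2 inj_sphere_inverse by (metis injD)
      then show ?thesis using True by auto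
    next
      case False
      then have "w \<in> W1" using w cover by auto
      then have "sphere_inverse z = Some (k1 w)" using w k1 by simp
      then show ?thesis using \<open>w \<in> W1\<close> by (auto simp: sphere_inverse_def split: if_splits)
    qed
  qed
  have "(\<lambda>z. ?F (sphere_inverse z)) holomorphic_on {z. sphere_inverse z \<in> K ` W}"
    using holomorphic_on_Un[OF F3 F2 openV open2] sub holomorphic_on_subset by blast
  moreover have "bij_betw ?F (K ` W) unit_disc"
    using bij_betw_trans[OF bij_betw_inv_into[OF inj_on_imp_bij_betw[OF inj_K]] bij] .
  ultimately show ?thesis using F1 unfolding sphere_riemann_map_def image_k1 by simp
qed

lemma density_ratio:
  assumes "simply_connected W" "W \<noteq> UNIV" and w0: "w0 \<in> W1"
  shows "hyperbolic_density W w0 / sphere_hyperbolic_density (K ` W) (k1 w0) = norm (deriv k1 w0)"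
proof -
  have w0W: "w0 \<in> W" using w0 by (simp add: W1)
  obtain f where f: "riemann_map W f" using ex_riemann_map[OF open_W assms(1) _ assms(2)] w0W by blast
  define d where "d = hyperbolic_density W w0"
  have k1': "deriv k1 w0 \<noteq> 0"
    by (rule holomorphic_injective_imp_regular[OF hol_k1 open_W1 inj_k1 w0])
  have dens: "disc_density (F (Some (k1 w0))) * norm (deriv (\<lambda>w. F (Some w)) (k1 w0)) = d / norm (deriv k1 w0)"
    if F: "sphere_riemann_map (K ` W) F" for F
  proof -
    have "(\<lambda>z. F (Some z)) holomorphic_on k1 ` W1"
      using F unfolding sphere_riemann_map_def image_k1 by simp
    then have "((\<lambda>z. F (Some z)) has_field_derivative deriv (\<lambda>z. F (Some z)) (k1 w0)) (at (k1 w0))"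
      using open_mapping_thm3[OF hol_k1 open_W1 inj_k1] w0 by (intro holomorphic_derivI) auto
    moreover have "(k1 has_field_derivative deriv k1 w0) (at w0)"
      using hol_k1 open_W1 w0 by (rule holomorphic_derivI)
    ultimately have "((\<lambda>z. F (Some z)) \<circ> k1 has_field_derivative
        deriv (\<lambda>z. F (Some z)) (k1 w0) * deriv k1 w0) (at w0)"
      by (rule DERIV_chain)
    then have "(F \<circ> K has_field_derivative deriv (\<lambda>z. F (Some z)) (k1 w0) * deriv k1 w0) (at w0)"
      by (rule has_field_derivative_transform_within_open[OF _ open_W1 w0]) (simp add: k1)
    then have "deriv (F \<circ> K) w0 = deriv (\<lambda>z. F (Some z)) (k1 w0) * deriv k1 w0"
      by (rule DERIV_imp_deriv)
    then have "d = disc_density (F (Some (k1 w0))) *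
        (norm (deriv (\<lambda>z. F (Some z)) (k1 w0)) * norm (deriv k1 w0))"
      unfolding d_def hyperbolic_density_eq[OF open_W pullback_riemann_map[OF F] w0W]
      by (simp add: k1[OF w0] norm_mult)
    then show ?thesis using k1' by simp
  qed
  have "sphere_hyperbolic_density (K ` W) (k1 w0) = d / norm (deriv k1 w0)"
    unfolding sphere_hyperbolic_density_def
  proof (rule the_equality)
    show "\<exists>F. sphere_riemann_map (K ` W) F \<and> d / norm (deriv k1 w0) =
        disc_density (F (Some (k1 w0))) * norm (deriv (\<lambda>w. F (Some w)) (k1 w0))"
      using pushforward_riemann_map[OF f] dens by metis
  qed (use dens in auto)
  moreover have "d \<noteq> 0"
  proof -
    have "f holomorphic_on W" "inj_on f W" "norm (f w0) < 1"
      using f w0W by (auto simp: riemann_map_def bij_betw_def)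
    then have "deriv f w0 \<noteq> 0" "(norm (f w0))\<^sup>2 \<noteq> 1"
      using holomorphic_injective_imp_regular[OF _ open_W _ w0W] abs_square_less_1[of "norm (f w0)"] by auto
    then show ?thesis
      unfolding d_def hyperbolic_density_eq[OF open_W f w0W] by (simp add: disc_density_def)
  qed
  ultimately show ?thesis by (simp add: d_def)
qed

end


section \<open>The derivative along the slit\<close>

lemma sphere_inverse_cnj: "sphere_inverse (cnj z) = map_option cnj (sphere_inverse z)"
  by (simp add: sphere_inverse_def)

lemma circle_reflection_cnj: "circle_reflection (cnj z) = map_option cnj (circle_reflection z)"
  unfolding circle_reflection_def by (rule sphere_inverse_cnj)

lemma open_diff_Collect: "open {w. w - p \<in> U}" if "open U" for U :: "complex set"
proof -
  have "open ((\<lambda>w. w - p) -` U)" by (intro open_vimage that continuous_intros)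
  then show ?thesis by (simp add: vimage_def)
qed

context sphere_chart
begin

lemma sphere_chart_translate:
  "sphere_chart {w. w - p \<in> W} {w. w - p \<in> W1} {w. w - p \<in> W2}
    (\<lambda>w. K (w - p)) (\<lambda>w. k1 (w - p)) (\<lambda>w. k2 (w - p))"
proof
  have "k1 \<circ> (\<lambda>w. w - p) holomorphic_on {w. w - p \<in> W1}"
    by (rule holomorphic_on_compose_gen[OF _ hol_k1]) (auto intro!: holomorphic_intros)
  then show "(\<lambda>w. k1 (w - p)) holomorphic_on {w. w - p \<in> W1}" by (simp add: o_def)
  have "k2 \<circ> (\<lambda>w. w - p) holomorphic_on {w. w - p \<in> W2}"
    by (rule holomorphic_on_compose_gen[OF _ hol_k2]) (auto intro!: holomorphic_intros)
  then show "(\<lambda>w. k2 (w - p)) holomorphic_on {w. w - p \<in> W2}" by (simp add: o_def)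
  show "inj_on (\<lambda>w. K (w - p)) {w. w - p \<in> W}"
  proof (rule inj_onI)
    fix x y assume "x \<in> {w. w - p \<in> W}" "y \<in> {w. w - p \<in> W}" "K (x - p) = K (y - p)"
    then have "x - p = y - p" using inj_K by (auto dest: inj_onD)
    then show "x = y" by simp
  qed
  show "open {w. w - p \<in> W}" "open {w. w - p \<in> W1}" "open {w. w - p \<in> W2}"
    by (intro open_diff_Collect open_W open_W1 open_W2)+
  show "{w. w - p \<in> W1} = {w \<in> {w. w - p \<in> W}. K (w - p) \<noteq> None}" by (auto simp: W1)
  show "{w. w - p \<in> W2} \<subseteq> {w. w - p \<in> W}"
    "{w. w - p \<in> W} \<subseteq> {w. w - p \<in> W1} \<union> {w. w - p \<in> W2}" using W2 cover by blast+
qed (simp_all add: k1 k2)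

lemma sphere_chart_cnj:
  "sphere_chart {w. cnj w \<in> W} {w. cnj w \<in> W1} {w. cnj w \<in> W2}
    (\<lambda>w. map_option cnj (K (cnj w))) (\<lambda>w. cnj (k1 (cnj w))) (\<lambda>w. cnj (k2 (cnj w)))"
proof
  have inj: "inj (map_option cnj)" by (intro option.inj_map) (auto simp: inj_def)
  show "inj_on (\<lambda>w. map_option cnj (K (cnj w))) {w. cnj w \<in> W}"
    using inj_K injD[OF inj] by (force simp: inj_on_def)
  show "open {w. cnj w \<in> W}" "open {w. cnj w \<in> W1}" "open {w. cnj w \<in> W2}"
    by (intro open_cnj_Collect open_W open_W1 open_W2)+
  show "{w. cnj w \<in> W1} = {w \<in> {w. cnj w \<in> W}. map_option cnj (K (cnj w)) \<noteq> None}"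
    by (auto simp: W1)
  show "{w. cnj w \<in> W2} \<subseteq> {w. cnj w \<in> W}"
    "{w. cnj w \<in> W} \<subseteq> {w. cnj w \<in> W1} \<union> {w. cnj w \<in> W2}" using W2 cover by blast+
  show "(\<lambda>w. cnj (k1 (cnj w))) holomorphic_on {w. cnj w \<in> W1}"
    by (rule holomorphic_cnj_Collect[OF hol_k1 open_W1])
  show "(\<lambda>w. cnj (k2 (cnj w))) holomorphic_on {w. cnj w \<in> W2}"
    by (rule holomorphic_cnj_Collect[OF hol_k2 open_W2])
qed (simp_all add: k1 k2 sphere_inverse_cnj)

end

lemma simply_connected_diff_Collect:
  assumes "simply_connected (U :: complex set)"
  shows "simply_connected {w. w - p \<in> U}"
proof -
  have "{w. w - p \<in> U} = (+) p ` U"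
    by (auto simp: image_iff intro!: bexI[of _ "_ - p"])
  then show ?thesis
    using assms homeomorphic_simply_connected_eq[OF homeomorphic_translation, of U p] by simp
qed

lemma has_field_derivative_of_real_tendsto:
  assumes "(f has_field_derivative D) (at (of_real t :: complex))"
  shows "((\<lambda>s. (f (of_real s) - f (of_real t)) / of_real (s - t)) \<longlongrightarrow> D) (at (t :: real))"
proof -
  have "filterlim (of_real :: real \<Rightarrow> complex) (at (of_real t)) (at t)"
    unfolding filterlim_at by (auto intro!: tendsto_intros simp: eventually_at_filter)
  then show ?thesis
    using filterlim_compose assms unfolding has_field_derivative_iff by fastforce
qed

lemma Limsup_ereal_less_PInfty_iff:
  "Limsup F (\<lambda>x. ereal (f x)) < \<infinity> \<longleftrightarrow> (\<exists>B. \<forall>\<^sub>F x in F. f x \<le> B)"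
proof
  assume "Limsup F (\<lambda>x. ereal (f x)) < \<infinity>"
  then have "Limsup F (\<lambda>x. ereal (f x)) \<noteq> \<infinity>" by simp
  then obtain B :: real where "Limsup F (\<lambda>x. ereal (f x)) < ereal B"
    unfolding less_PInf_Ex_of_nat by blast
  then have "\<forall>\<^sub>F x in F. ereal (f x) < ereal B" by (rule Limsup_lessD)
  then show "\<exists>B. \<forall>\<^sub>F x in F. f x \<le> B"
    by (intro exI[of _ B]) (auto elim!: eventually_mono)
next
  assume "\<exists>B. \<forall>\<^sub>F x in F. f x \<le> B"
  then obtain B where "\<forall>\<^sub>F x in F. f x \<le> B" by blast
  then have "Limsup F (\<lambda>x. ereal (f x)) \<le> ereal B" by (intro Limsup_bounded) simp
  then show "Limsup F (\<lambda>x. ereal (f x)) < \<infinity>" by (metis ereal_infty_less(1) le_less_trans PInfty_neq_ereal(1))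
qed

context slit_domain_access
begin

lemma Lipschitz_iff_deriv_bounded:
  "(\<exists>C>0. C-lipschitz_on {0..S} \<gamma>) \<longleftrightarrow> (\<exists>B. \<forall>\<^sub>F t in at_left S. norm (deriv g_refl (of_real t)) \<le> B)"
proof
  assume "\<exists>C>0. C-lipschitz_on {0..S} \<gamma>"
  then obtain C where C: "C-lipschitz_on {0..S} \<gamma>" by blast
  have "norm (deriv g_refl (of_real t)) \<le> C" if t: "0 < t" "t < S" for t
  proof -
    have "(g_refl has_field_derivative deriv g_refl (of_real t)) (at (of_real t))"
      using g_refl_holomorphic open_refl_dom_fin real_points[OF t] by (rule holomorphic_derivI)
    then have "((\<lambda>s. norm ((g_refl (of_real s) - g_refl (of_real t)) / of_real (s - t)))
        \<longlongrightarrow> norm (deriv g_refl (of_real t))) (at t)"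
      by (intro tendsto_norm has_field_derivative_of_real_tendsto)
    moreover have "\<forall>\<^sub>F s in at t. s \<in> {0<..<S} - {t}"
      by (rule eventually_at_in_open) (use t in auto)
    then have "\<forall>\<^sub>F s in at t. norm ((g_refl (of_real s) - g_refl (of_real t)) / of_real (s - t)) \<le> C"
    proof eventually_elim
      case (elim s)
      then have "dist (\<gamma> s) (\<gamma> t) \<le> C * dist s t" using t by (intro lipschitz_onD[OF C]) auto
      then have "norm (\<gamma> s - \<gamma> t) \<le> C * \<bar>s - t\<bar>" by (simp add: dist_norm)
      moreover have "0 < \<bar>s - t\<bar>" using elim by simp
      ultimately show ?case
        by (simp only: g_refl_of_real norm_divide norm_of_real pos_divide_le_eq)
    qed
    ultimately show ?thesis by (intro tendsto_upperbound) auto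
  qed
  moreover have "\<forall>\<^sub>F t in at_left S. t \<in> {0<..<S}" using S_pos by (intro eventually_at_leftI) auto
  ultimately show "\<exists>B. \<forall>\<^sub>F t in at_left S. norm (deriv g_refl (of_real t)) \<le> B"
    by (intro exI[of _ C]) (auto elim!: eventually_mono)
next
  assume "\<exists>B. \<forall>\<^sub>F t in at_left S. norm (deriv g_refl (of_real t)) \<le> B"
  then obtain B where "\<forall>\<^sub>F t in at_left S. norm (deriv g_refl (of_real t)) \<le> B" by blast
  then obtain b where b: "b < S" "\<And>t. b < t \<Longrightarrow> t < S \<Longrightarrow> norm (deriv g_refl (of_real t)) \<le> B"
    unfolding eventually_at_left_field by blast
  obtain C where C: "0 < C" "\<And>t. 0 < t \<Longrightarrow> t < S \<Longrightarrow> norm (deriv g_refl (of_real t)) \<le> C / sqrt (S - t)"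
    using deriv_g_refl_bound by blast
  define M where "M = max B (C / sqrt (S - b))"
  have M: "norm (deriv g_refl (of_real t)) \<le> M" if t: "0 < t" "t < S" for t
  proof (cases "b < t")
    case True then show ?thesis using b(2)[OF True t(2)] by (simp add: M_def)
  next
    case False
    then have "C / sqrt (S - t) \<le> C / sqrt (S - b)"
      using b(1) C(1) t by (intro divide_left_mono mult_pos_pos) auto
    then show ?thesis using C(2)[OF t] by (simp add: M_def)
  qed
  have "0 < C / sqrt (S - b)" using C(1) b(1) by simp
  then have "0 < M" by (simp add: M_def less_max_iff_disj)
  have cont: "continuous_on {0..S} \<gamma>"
  proof -
    have "continuous (at t within {0..S}) \<gamma>" if t: "t \<in> {0..S}" for t
    proof (cases "t = 0")
      case True
      have "at 0 within {0..S} = at_right 0"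
        using S_pos by (simp add: at_within_Icc_at_right)
      then show ?thesis using \<gamma>_tendsto_start True by (simp add: continuous_within)
    next
      case False
      then have "continuous (at t within {0<..S}) \<gamma>"
        using \<gamma>_continuous t by (simp add: continuous_on_eq_continuous_within)
      moreover have "at t within {0<..S} = at t within {0..S}"
        using False t by (intro at_within_nhd[of _ "{0<..}"]) auto
      ultimately show ?thesis by simp
    qed
    then show ?thesis by (simp add: continuous_on_eq_continuous_within)
  qed
  have le: "norm (\<gamma> t - \<gamma> s) \<le> M * (t - s)" if st: "0 \<le> s" "s < t" "t \<le> S" for s t
  proof -
    have "norm (\<gamma> t - \<gamma> s) \<le> M * t - M * s"
    proof (rule differentiable_bound_general[OF st(2)])
      show "continuous_on {s..t} \<gamma>" by (rule continuous_on_subset[OF cont]) (use st in auto)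
      show "continuous_on {s..t} ((*) M)" by (intro continuous_intros)
      fix x assume x: "s < x" "x < t"
      show "(\<gamma> has_vector_derivative deriv g_refl (of_real x)) (at x)"
        using x st by (intro \<gamma>_has_derivative) auto
      show "((*) M has_vector_derivative M) (at x)"
        by (auto intro!: derivative_eq_intros simp flip: has_real_derivative_iff_has_vector_derivative)
      show "norm (deriv g_refl (of_real x)) \<le> M" using x st by (intro M) auto
    qed
    then show ?thesis by (simp add: algebra_simps)
  qed
  have "M-lipschitz_on {0..S} \<gamma>"
  proof (rule lipschitz_onI)
    fix x y assume "x \<in> {0..S}" "y \<in> {0..S}"
    then show "dist (\<gamma> x) (\<gamma> y) \<le> M * dist x y"
      using le[of x y] le[of y x]
      by (cases x y rule: linorder_cases) (auto simp: dist_norm norm_minus_commute)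
  qed (use \<open>0 < M\<close> in simp)
  then show "\<exists>C>0. C-lipschitz_on {0..S} \<gamma>" using \<open>0 < M\<close> by blast
qed

definition sphere_refl :: "complex \<Rightarrow> complex option" where
  "sphere_refl w = (if 0 \<le> Im w then Some (g_refl w) else circle_reflection (g (cnj w)))"

lemma sphere_refl_eq_Some: "w \<in> refl_dom_fin \<Longrightarrow> sphere_refl w = Some (g_refl w)"
  by (auto simp: sphere_refl_def g_refl_def refl_dom_fin_def circle_reflection_def sphere_inverse_def)

lemma sphere_chart_refl:
  "sphere_chart refl_dom refl_dom_fin {w. cnj w \<in> \<Omega> \<and> Im w < 0} sphere_refl g_refl (\<lambda>w. cnj (g (cnj w)))"
proof
  show fin: "refl_dom_fin = {w \<in> refl_dom. sphere_refl w \<noteq> None}"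
    by (auto simp: sphere_refl_def refl_dom_fin_def circle_reflection_def sphere_inverse_def)
  show "(\<lambda>w. cnj (g (cnj w))) holomorphic_on {w. cnj w \<in> \<Omega> \<and> Im w < 0}"
    by (rule holomorphic_on_subset[OF holg_cnj]) auto
  show "inj_on sphere_refl refl_dom"
  proof (rule inj_onI)
    fix x y assume xy: "x \<in> refl_dom" "y \<in> refl_dom" "sphere_refl x = sphere_refl y"
    show "x = y"
    proof (cases "x \<in> refl_dom_fin")
      case True
      then have "y \<in> refl_dom_fin" using xy by (auto simp: fin)
      then show ?thesis using True xy g_refl_inj by (auto simp: sphere_refl_eq_Some dest: inj_onD)
    next
      case False
      then have "y \<notin> refl_dom_fin" using xy by (auto simp: fin)
      then have "g (cnj x) = g (cnj y)" "cnj x \<in> \<Omega>" "cnj y \<in> \<Omega>"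
        using False xy(1,2) by (auto simp: refl_dom_fin_def refl_dom_def)
      then have "cnj x = cnj y" using injg by (auto dest: inj_onD)
      then show ?thesis by simp
    qed
  qed
  show "refl_dom \<subseteq> refl_dom_fin \<union> {w. cnj w \<in> \<Omega> \<and> Im w < 0}"
    by (auto simp: refl_dom_def refl_dom_fin_def)
qed (use open_refl_dom open_refl_dom_fin open_lower g_refl_holomorphic sphere_refl_eq_Some in
    \<open>auto simp: sphere_refl_def circle_reflection_def refl_dom_def\<close>)

lemma image_sphere_refl:
  "sphere_refl ` refl_dom = Some ` g ` {w \<in> \<Omega>. 0 < Im w} \<union> Some ` \<gamma> ` {0<..<S} \<union>
    circle_reflection ` g ` {w \<in> \<Omega>. 0 < Im w}"
proof -
  have dom: "refl_dom = {w \<in> \<Omega>. 0 < Im w} \<union> of_real ` {0<..<S} \<union> cnj ` {w \<in> \<Omega>. 0 < Im w}"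
    unfolding image_cnj_conv_vimage_cnj
    by (auto simp: refl_dom_def complex_eq_iff image_iff)
  have "sphere_refl ` {w \<in> \<Omega>. 0 < Im w} = Some ` g ` {w \<in> \<Omega>. 0 < Im w}"
    unfolding image_image by (intro image_cong) (auto simp: sphere_refl_def g_refl_def)
  moreover have "sphere_refl ` of_real ` {0<..<S} = Some ` \<gamma> ` {0<..<S}"
    unfolding image_image by (intro image_cong) (auto simp: sphere_refl_def)
  moreover have "sphere_refl ` cnj ` {w \<in> \<Omega>. 0 < Im w} = circle_reflection ` g ` {w \<in> \<Omega>. 0 < Im w}"
    unfolding image_image by (intro image_cong) (auto simp: sphere_refl_def)
  ultimately show ?thesis unfolding dom image_Un by simp
qed

lemma refl_dom_cnj: "{w. cnj w \<in> refl_dom} = refl_dom"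
  by (auto simp: refl_dom_def)

lemma refl_dom_shift_not_UNIV: "{w. w - p \<in> refl_dom} \<noteq> UNIV"
proof -
  have "p + of_real S \<notin> {w. w - p \<in> refl_dom}" by (simp add: refl_dom_def)
  then show ?thesis by blast
qed

lemma density_ratio_upper:
  assumes t: "0 < t" "t < S"
  shows "hyperbolic_density {w. w - p \<in> refl_dom} (p + of_real t) /
    sphere_hyperbolic_density (sphere_refl ` refl_dom) (\<gamma> t) = norm (deriv g_refl (of_real t))"
proof -
  interpret sphere_chart refl_dom refl_dom_fin "{w. cnj w \<in> \<Omega> \<and> Im w < 0}" sphere_refl g_refl
    "\<lambda>w. cnj (g (cnj w))"
    by (rule sphere_chart_refl)
  interpret shifted: sphere_chart "{w. w - p \<in> refl_dom}" "{w. w - p \<in> refl_dom_fin}"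
    "{w. w - p \<in> {w. cnj w \<in> \<Omega> \<and> Im w < 0}}" "\<lambda>w. sphere_refl (w - p)" "\<lambda>w. g_refl (w - p)"
    "\<lambda>w. cnj (g (cnj (w - p)))"
    by (rule sphere_chart_translate)
  have img: "(\<lambda>w. sphere_refl (w - p)) ` {w. w - p \<in> refl_dom} = sphere_refl ` refl_dom"
    by (auto simp: image_iff intro!: exI[of _ "_ + p"])
  have "(g_refl has_field_derivative deriv g_refl (of_real t)) (at (p + of_real t - p))"
    using holomorphic_derivI[OF g_refl_holomorphic open_refl_dom_fin real_points[OF t]] by simp
  then have "((\<lambda>w. g_refl (w - p)) has_field_derivative deriv g_refl (of_real t) * 1) (at (p + of_real t))"
    by (rule DERIV_chain2) (auto intro!: derivative_eq_intros)
  then have "deriv (\<lambda>w. g_refl (w - p)) (p + of_real t) = deriv g_refl (of_real t)"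
    by (simp add: DERIV_imp_deriv)
  then show ?thesis
    using shifted.density_ratio[OF simply_connected_diff_Collect[OF simply_connected_refl_dom]
        refl_dom_shift_not_UNIV, of "p + of_real t"] real_points[OF t] by (simp add: img)
qed

lemma density_ratio_lower:
  assumes t: "0 < t" "t < S"
  shows "hyperbolic_density {w. w - p \<in> refl_dom} (p + of_real t) /
    sphere_hyperbolic_density (map_option cnj ` sphere_refl ` refl_dom) (cnj (\<gamma> t)) =
      norm (deriv g_refl (of_real t))"
proof -
  interpret upper: sphere_chart refl_dom refl_dom_fin "{w. cnj w \<in> \<Omega> \<and> Im w < 0}" sphere_refl g_refl
    "\<lambda>w. cnj (g (cnj w))"
    by (rule sphere_chart_refl)
  interpret sphere_chart "{w. cnj w \<in> refl_dom}" "{w. cnj w \<in> refl_dom_fin}"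
    "{w. cnj w \<in> {w. cnj w \<in> \<Omega> \<and> Im w < 0}}" "\<lambda>w. map_option cnj (sphere_refl (cnj w))"
    "\<lambda>w. cnj (g_refl (cnj w))" "\<lambda>w. cnj (cnj (g (cnj (cnj w))))"
    by (rule upper.sphere_chart_cnj)
  interpret shifted: sphere_chart "{w. w - p \<in> {w. cnj w \<in> refl_dom}}" "{w. w - p \<in> {w. cnj w \<in> refl_dom_fin}}"
    "{w. w - p \<in> {w. cnj w \<in> {w. cnj w \<in> \<Omega> \<and> Im w < 0}}}"
    "\<lambda>w. map_option cnj (sphere_refl (cnj (w - p)))" "\<lambda>w. cnj (g_refl (cnj (w - p)))"
    "\<lambda>w. cnj (cnj (g (cnj (cnj (w - p)))))"
    by (rule sphere_chart_translate)
  have img: "(\<lambda>w. map_option cnj (sphere_refl (cnj (w - p)))) ` {w. w - p \<in> refl_dom} =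
      map_option cnj ` sphere_refl ` refl_dom"
  proof -
    have "(\<lambda>w. cnj (w - p)) ` {w. w - p \<in> refl_dom} = {w. cnj w \<in> refl_dom}"
      by (auto simp: image_iff intro!: exI[of _ "cnj _ + p"])
    then have "(\<lambda>w. cnj (w - p)) ` {w. w - p \<in> refl_dom} = refl_dom" by (simp only: refl_dom_cnj)
    then show ?thesis by (metis (no_types, lifting) image_cong image_image)
  qed
  have "(g_refl has_field_derivative deriv g_refl (of_real t)) (at (cnj (of_real t)))"
    using holomorphic_derivI[OF g_refl_holomorphic open_refl_dom_fin real_points[OF t]] by simp
  then have "(cnj \<circ> g_refl \<circ> cnj has_field_derivative cnj (deriv g_refl (of_real t))) (at (p + of_real t - p))"
    using has_field_derivative_cnj_cnj[of g_refl "deriv g_refl (of_real t)" "of_real t"] by simp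
  then have "((\<lambda>w. (cnj \<circ> g_refl \<circ> cnj) (w - p)) has_field_derivative cnj (deriv g_refl (of_real t)) * 1)
      (at (p + of_real t))"
    by (rule DERIV_chain2) (auto intro!: derivative_eq_intros)
  then have "deriv (\<lambda>w. cnj (g_refl (cnj (w - p)))) (p + of_real t) = cnj (deriv g_refl (of_real t))"
    by (simp add: DERIV_imp_deriv o_def)
  moreover note shifted.density_ratio[unfolded mem_Collect_eq refl_dom_cnj[unfolded set_eq_iff mem_Collect_eq, rule_format],
        OF simply_connected_diff_Collect[OF simply_connected_refl_dom] refl_dom_shift_not_UNIV, of "p + of_real t", unfolded img]
  ultimately show ?thesis using real_points[OF t] by simp
qed

end


section \<open>Boundary orbits of the third type\<close>

lemma nontangential_imp_radial:
  assumes "has_nontangential_limit f l \<zeta>" "norm \<zeta> = 1"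
  shows "((\<lambda>r. f (of_real r * \<zeta>)) \<longlongrightarrow> l) (at_left 1)"
proof -
  have "(f \<longlongrightarrow> l) (at \<zeta> within stolz_region \<zeta> 2)"
    using assms(1) by (simp add: has_nontangential_limit_def)
  moreover have "filterlim (\<lambda>r. of_real r * \<zeta>) (at \<zeta> within stolz_region \<zeta> 2) (at_left 1)"
    unfolding filterlim_at
  proof
    have "((\<lambda>r. of_real r * \<zeta>) \<longlongrightarrow> of_real 1 * \<zeta>) (at_left 1)" by (intro tendsto_intros)
    then show "((\<lambda>r. of_real r * \<zeta>) \<longlongrightarrow> \<zeta>) (at_left 1)" by simp
    have "\<forall>\<^sub>F r in at_left (1::real). r \<in> {0<..<1}" by (intro eventually_at_leftI) auto
    then show "\<forall>\<^sub>F r in at_left 1. of_real r * \<zeta> \<in> stolz_region \<zeta> 2 \<and> of_real r * \<zeta> \<noteq> \<zeta>"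
    proof eventually_elim
      case (elim r)
      then have n: "norm (of_real r * \<zeta>) = r" using assms(2) by (simp add: norm_mult)
      have "of_real r * \<zeta> - \<zeta> = of_real (r - 1) * \<zeta>" by (simp add: algebra_simps)
      then have "norm (of_real r * \<zeta> - \<zeta>) = 1 - r"
        using elim assms(2) by (simp only: norm_mult norm_of_real) simp
      then show ?case using n elim by (auto simp: stolz_region_def)
    qed
  qed
  ultimately show ?thesis by (rule filterlim_compose)
qed

lemma rectangles_cover_disc:
  assumes op: "open \<Omega>" and shift: "\<And>w t. w \<in> \<Omega> \<Longrightarrow> 0 \<le> t \<Longrightarrow> w + of_real t \<in> \<Omega>"
    and right: "\<And>x. S < x \<Longrightarrow> p + of_real x \<in> \<Omega>"
    and up: "upper_rectangle p S a d \<subseteq> \<Omega>" "a < S" "0 < d"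
    and low: "lower_rectangle p S a' d' \<subseteq> \<Omega>" "a' < S" "0 < d'"
  shows "\<exists>\<epsilon>>0. ball (p + of_real S) \<epsilon> \<inter> frontier \<Omega> \<subseteq> {p + of_real s |s. s \<le> S}"
proof -
  define \<epsilon> where "\<epsilon> = min (min d d') (min (S - a) (S - a'))"
  have \<epsilon>: "0 < \<epsilon>" "\<epsilon> \<le> d" "\<epsilon> \<le> d'" "\<epsilon> \<le> S - a" "\<epsilon> \<le> S - a'"
    unfolding \<epsilon>_def min_le_iff_disj using up low by simp_all
  have "w \<in> \<Omega>" if w: "w \<in> ball (p + of_real S) \<epsilon>" "w \<notin> {p + of_real s |s. s \<le> S}" for w
  proof -
    have "\<bar>Re w - Re p - S\<bar> < \<epsilon>" "\<bar>Im w - Im p\<bar> < \<epsilon>"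
      using w(1) abs_Re_le_cmod[of "w - (p + of_real S)"] abs_Im_le_cmod[of "w - (p + of_real S)"]
      by (auto simp: dist_norm norm_minus_commute algebra_simps)
    note near = this
    define x where "x = min (Re w) (Re p + (max a a' + S) / 2)"
    have x: "x \<le> Re w" "x < Re p + S" "Re p + a < x" "Re p + a' < x"
    proof -
      define m where "m = max a a'"
      have m: "a \<le> m" "a' \<le> m" "m < S" "\<epsilon> \<le> S - m" using up low \<epsilon> by (auto simp: m_def)
      have "x = min (Re w) (Re p + (m + S) / 2)" by (simp add: x_def m_def)
      then have "x \<le> Re w \<and> x \<le> Re p + (m + S) / 2 \<and> (x = Re w \<or> x = Re p + (m + S) / 2)"
        by (auto simp: min_def)
      then show "x \<le> Re w" "x < Re p + S" "Re p + a < x" "Re p + a' < x"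
        using near m by (auto simp: field_simps)
    qed
    have weq: "Complex x (Im w) + of_real (Re w - x) = w" by (simp add: complex_eq_iff)
    consider "Im p < Im w" | "Im w = Im p" | "Im w < Im p" by linarith
    then show ?thesis
    proof cases
      case 1
      then have "Complex x (Im w) \<in> \<Omega>"
        using x near \<epsilon> up(1) by (intro subsetD[OF up(1)]) (auto simp: upper_rectangle_def)
      then have "Complex x (Im w) + of_real (Re w - x) \<in> \<Omega>" using x by (intro shift) auto
      then show ?thesis by (simp only: weq)
    next
      case 2
      then have "w = p + of_real (Re w - Re p)" by (simp add: complex_eq_iff)
      then show ?thesis using w(2) right[of "Re w - Re p"] by (metis (mono_tags, lifting) mem_Collect_eq not_less)
    next
      case 3
      then have "Complex x (Im w) \<in> \<Omega>"
        using x near \<epsilon> low(1) by (intro subsetD[OF low(1)]) (auto simp: lower_rectangle_def)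
      then have "Complex x (Im w) + of_real (Re w - x) \<in> \<Omega>" using x by (intro shift) auto
      then show ?thesis by (simp only: weq)
    qed
  qed
  moreover have "w \<notin> frontier \<Omega>" if "w \<in> \<Omega>" for w
    using that op by (simp add: frontier_def interior_open)
  ultimately show ?thesis using \<epsilon>(1) by blast
qed

locale koenigs_orbit =
  fixes \<phi> :: "real \<Rightarrow> complex \<Rightarrow> complex" and h :: "complex \<Rightarrow> complex"
    and \<zeta> p :: complex and \<gamma> :: "real \<Rightarrow> complex" and S :: real
  assumes semigroup: "disc_semigroup \<phi>" and koenigs: "koenigs_function \<phi> h"
    and \<zeta>: "norm \<zeta> = 1" and traj: "boundary_trajectory \<phi> \<zeta> \<gamma>"
    and h_lim: "has_nontangential_limit h p \<zeta>"
    and third: "third_type_orbit (h ` unit_disc) p \<zeta> \<gamma>" and life: "life_time \<gamma> = ereal S"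
begin

definition \<Omega> :: "complex set" where "\<Omega> = h ` unit_disc"

definition g :: "complex \<Rightarrow> complex" where "g = inv_into unit_disc h"

definition \<Gamma> :: "real \<Rightarrow> complex" where "\<Gamma> r = h (of_real r * \<zeta>) - p"

lemma hol_h: "h holomorphic_on unit_disc" and inj_h: "inj_on h unit_disc"
  and h_\<phi>: "0 \<le> t \<Longrightarrow> z \<in> unit_disc \<Longrightarrow> h (\<phi> t z) = h z + of_real t"
  using koenigs by (auto simp: koenigs_function_def)

lemma \<phi>_in: "0 \<le> t \<Longrightarrow> z \<in> unit_disc \<Longrightarrow> \<phi> t z \<in> unit_disc"
  using semigroup unfolding disc_semigroup_def by blast

lemma open_\<Omega>: "open \<Omega>"
  unfolding \<Omega>_def by (rule open_mapping_thm3[OF hol_h open_ball inj_h])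

lemma g_h: "z \<in> unit_disc \<Longrightarrow> g (h z) = z"
  unfolding g_def by (rule inv_into_f_f[OF inj_h])

lemma g_in: "w \<in> \<Omega> \<Longrightarrow> g w \<in> unit_disc" and h_g: "w \<in> \<Omega> \<Longrightarrow> h (g w) = w"
  by (auto simp: \<Omega>_def g_h)

lemma h_in: "z \<in> unit_disc \<Longrightarrow> h z \<in> \<Omega>"
  by (simp add: \<Omega>_def)

lemma hol_g: "g holomorphic_on \<Omega>"
proof -
  obtain k where k: "k holomorphic_on (h ` unit_disc)" "\<And>z. z \<in> unit_disc \<Longrightarrow> k (h z) = z"
    using holomorphic_has_inverse[OF hol_h open_ball inj_h] by metis
  show ?thesis
    unfolding \<Omega>_def by (rule holomorphic_transform[OF k(1)]) (auto simp: k(2) g_h)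
qed

lemma g_inj: "inj_on g \<Omega>"
  by (metis h_g inj_onI)

lemma g_image: "g ` \<Omega> = unit_disc"
  using g_in h_in g_h by (auto simp: image_iff) (metis h_in g_h mem_ball_0)

lemma shift: "w \<in> \<Omega> \<Longrightarrow> 0 \<le> t \<Longrightarrow> w + of_real t \<in> \<Omega>"
  using h_\<phi>[of t "g w"] \<phi>_in[of t "g w"] g_in h_g h_in by metis

lemma \<phi>_eq: "z \<in> unit_disc \<Longrightarrow> 0 \<le> t \<Longrightarrow> \<phi> t z = g (h z + of_real t)"
  using h_\<phi> \<phi>_in g_h by metis

lemma S_pos: "0 < S"
  using third life by (simp add: third_type_orbit_def)

lemma radial_in: "0 \<le> r \<Longrightarrow> r < 1 \<Longrightarrow> of_real r * \<zeta> \<in> unit_disc"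
  using \<zeta> by (simp add: norm_mult)

lemma eventually_radial_in: "\<forall>\<^sub>F r in at_left 1. of_real r * \<zeta> \<in> unit_disc"
proof -
  have "\<forall>\<^sub>F r in at_left (1::real). r \<in> {0<..<1}" by (intro eventually_at_leftI) auto
  then show ?thesis by (rule eventually_mono) (use radial_in in auto)
qed

lemma \<gamma>_radial: "0 \<le> t \<Longrightarrow> ((\<lambda>r. \<phi> t (of_real r * \<zeta>)) \<longlongrightarrow> \<gamma> t) (at_left 1)"
  using traj \<zeta> by (intro nontangential_imp_radial) (auto simp: boundary_trajectory_def)

lemma h_radial: "((\<lambda>r. h (of_real r * \<zeta>)) \<longlongrightarrow> p) (at_left 1)"
  by (rule nontangential_imp_radial[OF h_lim \<zeta>])

lemma norm_\<gamma>_le_1: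
  assumes "0 \<le> t"
  shows "norm (\<gamma> t) \<le> 1"
proof (rule tendsto_upperbound)
  show "((\<lambda>r. norm (\<phi> t (of_real r * \<zeta>))) \<longlongrightarrow> norm (\<gamma> t)) (at_left 1)"
    by (intro tendsto_norm \<gamma>_radial assms)
  show "\<forall>\<^sub>F r in at_left 1. norm (\<phi> t (of_real r * \<zeta>)) \<le> 1"
    using eventually_radial_in
    by (rule eventually_mono) (use \<phi>_in[OF assms] in \<open>force intro: less_imp_le\<close>)
qed simp

lemma interior_absorbing:
  assumes t: "0 \<le> t0" "t0 \<le> t" and in0: "norm (\<gamma> t0) < 1"
  shows "norm (\<gamma> t) < 1"
proof -
  have "continuous_on unit_disc (\<phi> (t - t0))"
    using semigroup t by (intro holomorphic_on_imp_continuous_on) (simp add: disc_semigroup_def)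
  then have "isCont (\<phi> (t - t0)) (\<gamma> t0)"
    using in0 by (simp add: continuous_on_eq_continuous_at)
  then have "((\<lambda>r. \<phi> (t - t0) (\<phi> t0 (of_real r * \<zeta>))) \<longlongrightarrow> \<phi> (t - t0) (\<gamma> t0)) (at_left 1)"
    by (rule isCont_tendsto_compose[OF _ \<gamma>_radial[OF t(1)]])
  moreover have "\<forall>\<^sub>F r in at_left 1. \<phi> (t - t0) (\<phi> t0 (of_real r * \<zeta>)) = \<phi> t (of_real r * \<zeta>)"
    using eventually_radial_in
  proof eventually_elim
    case (elim r)
    then have "\<phi> ((t - t0) + t0) (of_real r * \<zeta>) = \<phi> (t - t0) (\<phi> t0 (of_real r * \<zeta>))"
      using semigroup t unfolding disc_semigroup_def by (meson diff_ge_0_iff_ge)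
    then show ?case by simp
  qed
  ultimately have "((\<lambda>r. \<phi> t (of_real r * \<zeta>)) \<longlongrightarrow> \<phi> (t - t0) (\<gamma> t0)) (at_left 1)"
    by (rule Lim_transform_eventually)
  moreover have "((\<lambda>r. \<phi> t (of_real r * \<zeta>)) \<longlongrightarrow> \<gamma> t) (at_left 1)" using t by (intro \<gamma>_radial) auto
  ultimately have "\<gamma> t = \<phi> (t - t0) (\<gamma> t0)" by (intro tendsto_unique[of "at_left (1::real)"]) auto
  then show ?thesis using \<phi>_in[of "t - t0" "\<gamma> t0"] t in0 by simp
qed

lemma norm_\<gamma>_before:
  assumes "0 \<le> t" "t < S"
  shows "norm (\<gamma> t) = 1"
proof -
  have "ereal t < (SUP t\<in>{t. 0 \<le> t \<and> \<gamma> t \<in> unit_circle}. ereal t)"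
    using life assms by (simp add: life_time_def)
  then obtain t' where t': "0 \<le> t'" "norm (\<gamma> t') = 1" "t < t'"
    unfolding less_SUP_iff by auto
  then have "\<not> norm (\<gamma> t) < 1" using interior_absorbing[of t t'] assms by auto
  then show ?thesis using norm_\<gamma>_le_1[OF assms(1)] by simp
qed

lemma norm_\<gamma>_after:
  assumes "S < t"
  shows "norm (\<gamma> t) < 1"
proof (rule ccontr)
  assume "\<not> ?thesis"
  then have "t \<in> {t. 0 \<le> t \<and> \<gamma> t \<in> unit_circle}"
    using norm_\<gamma>_le_1[of t] assms S_pos by auto
  then have "ereal t \<le> life_time \<gamma>" unfolding life_time_def by (rule SUP_upper)
  then show False using life assms by simp
qed

lemma h_shift_radial: "((\<lambda>r. h (of_real r * \<zeta>) + of_real t) \<longlongrightarrow> p + of_real t) (at_left 1)"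
  by (intro tendsto_intros h_radial)

lemma right_in:
  assumes "S < t"
  shows "p + of_real t \<in> \<Omega>"
proof -
  have t: "0 \<le> t" using assms S_pos by simp
  have "\<gamma> t \<in> unit_disc" using norm_\<gamma>_after[OF assms] by simp
  then have "isCont h (\<gamma> t)"
    using hol_h holomorphic_on_imp_continuous_on continuous_on_eq_continuous_at[OF open_ball] by blast
  then have "((\<lambda>r. h (\<phi> t (of_real r * \<zeta>))) \<longlongrightarrow> h (\<gamma> t)) (at_left 1)"
    by (rule isCont_tendsto_compose[OF _ \<gamma>_radial[OF t]])
  moreover have "\<forall>\<^sub>F r in at_left 1. h (\<phi> t (of_real r * \<zeta>)) = h (of_real r * \<zeta>) + of_real t"
    using eventually_radial_in by (rule eventually_mono) (use h_\<phi>[OF t] in auto)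
  ultimately have "((\<lambda>r. h (of_real r * \<zeta>) + of_real t) \<longlongrightarrow> h (\<gamma> t)) (at_left 1)"
    by (rule Lim_transform_eventually)
  then have "h (\<gamma> t) = p + of_real t"
    using h_shift_radial[of t] by (intro tendsto_unique[of "at_left (1::real)"]) auto
  then show ?thesis using h_in[OF \<open>\<gamma> t \<in> unit_disc\<close>] by simp
qed

lemma slit_before:
  assumes t: "0 \<le> t" "t < S"
  shows "p + of_real t \<notin> \<Omega>"
proof
  assume in\<Omega>: "p + of_real t \<in> \<Omega>"
  then have "isCont g (p + of_real t)"
    using hol_g holomorphic_on_imp_continuous_on continuous_on_eq_continuous_at[OF open_\<Omega>] by blast
  then have "((\<lambda>r. g (h (of_real r * \<zeta>) + of_real t)) \<longlongrightarrow> g (p + of_real t)) (at_left 1)"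
    by (rule isCont_tendsto_compose[OF _ h_shift_radial])
  moreover have "\<forall>\<^sub>F r in at_left 1. g (h (of_real r * \<zeta>) + of_real t) = \<phi> t (of_real r * \<zeta>)"
    using eventually_radial_in by (rule eventually_mono) (use \<phi>_eq t in auto)
  ultimately have "((\<lambda>r. \<phi> t (of_real r * \<zeta>)) \<longlongrightarrow> g (p + of_real t)) (at_left 1)"
    by (rule Lim_transform_eventually)
  then have "\<gamma> t = g (p + of_real t)"
    using \<gamma>_radial[OF t(1)] by (intro tendsto_unique[of "at_left (1::real)"]) auto
  then show False using g_in[OF in\<Omega>] norm_\<gamma>_before[OF t] by simp
qed

lemma slit:
  assumes "x \<le> S"
  shows "p + of_real x \<notin> \<Omega>"
proof
  assume in\<Omega>: "p + of_real x \<in> \<Omega>"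
  consider "x < 0" | "0 \<le> x" "x < S" | "x = S" using assms by linarith
  then show False
  proof cases
    case 1
    then have "p + of_real 0 \<in> \<Omega>" using shift[OF in\<Omega>, of "- x"] by simp
    then show False using slit_before[of 0] S_pos by blast
  next
    case 2 then show False using slit_before in\<Omega> by blast
  next
    case 3
    obtain e where e: "0 < e" "ball (p + of_real S) e \<subseteq> \<Omega>" using in\<Omega> 3 open_\<Omega> openE by blast
    define t where "t = max 0 (S - e / 2)"
    have t: "0 \<le> t" "t < S" "S - t < e" using e(1) S_pos by (auto simp: t_def)
    have "dist (p + of_real S) (p + of_real t) = \<bar>S - t\<bar>"
      by (metis add_diff_cancel_left dist_norm norm_of_real of_real_diff)
    then have "p + of_real t \<in> \<Omega>" using t e(2) by auto
    then show False using slit_before t by blast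
  qed
qed

lemma \<Gamma>_lim: "(\<Gamma> \<longlongrightarrow> 0) (at_left 1)"
  using tendsto_diff[OF h_radial tendsto_const[of p]] by (simp add: \<Gamma>_def[abs_def])

lemma \<Gamma>_in: "0 \<le> r \<Longrightarrow> r < 1 \<Longrightarrow> p + \<Gamma> r \<in> \<Omega>"
  using radial_in h_in by (simp add: \<Gamma>_def)

lemma cont_\<Gamma>: "0 \<le> r0 \<Longrightarrow> continuous_on {r0<..<1} \<Gamma>"
  unfolding \<Gamma>_def[abs_def]
  by (intro continuous_intros continuous_on_compose2[OF holomorphic_on_imp_continuous_on[OF hol_h]])
    (use radial_in in auto)

lemma g_\<Gamma>_lim:
  assumes "0 \<le> t"
  shows "((\<lambda>r. g (p + \<Gamma> r + of_real t)) \<longlongrightarrow> \<gamma> t) (at_left 1)"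
proof (rule Lim_transform_eventually[OF \<gamma>_radial[OF assms]])
  show "\<forall>\<^sub>F r in at_left 1. \<phi> t (of_real r * \<zeta>) = g (p + \<Gamma> r + of_real t)"
    using eventually_radial_in by (rule eventually_mono) (use \<phi>_eq assms in \<open>auto simp: \<Gamma>_def\<close>)
qed

lemma access_side:
  obtains r0 where "0 \<le> r0" "r0 < 1" "\<And>r. r0 < r \<Longrightarrow> r < 1 \<Longrightarrow> 0 < Im (\<Gamma> r)"
  | r0 where "0 \<le> r0" "r0 < 1" "\<And>r. r0 < r \<Longrightarrow> r < 1 \<Longrightarrow> Im (\<Gamma> r) < 0"
proof -
  have "\<forall>\<^sub>F r in at_left 1. dist (\<Gamma> r) 0 < S" using \<Gamma>_lim S_pos by (rule tendstoD)
  then obtain r' where r': "r' < 1" "\<And>r. r' < r \<Longrightarrow> r < 1 \<Longrightarrow> norm (\<Gamma> r) < S"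
    unfolding eventually_at_left_field by auto
  define r0 where "r0 = max r' 0"
  have r0: "0 \<le> r0" "r0 < 1" "r' \<le> r0" using r'(1) by (auto simp: r0_def)
  have nz: "Im (\<Gamma> r) \<noteq> 0" if "r0 < r" "r < 1" for r
  proof
    assume "Im (\<Gamma> r) = 0"
    then have "p + \<Gamma> r = p + of_real (Re (\<Gamma> r))" by (simp add: complex_eq_iff)
    moreover have "Re (\<Gamma> r) \<le> S"
      using r'(2)[of r] that r0 complex_Re_le_cmod[of "\<Gamma> r"] by linarith
    ultimately show False using slit[of "Re (\<Gamma> r)"] \<Gamma>_in[of r] that r0 by simp
  qed
  have conn: "connected ((\<lambda>r. Im (\<Gamma> r)) ` {r0<..<1})"
    by (intro connected_continuous_image continuous_intros cont_\<Gamma> r0) simp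
  have "(\<forall>r. r0 < r \<longrightarrow> r < 1 \<longrightarrow> 0 < Im (\<Gamma> r)) \<or> (\<forall>r. r0 < r \<longrightarrow> r < 1 \<longrightarrow> Im (\<Gamma> r) < 0)"
  proof (rule ccontr)
    assume "\<not> ?thesis"
    then obtain r1 r2 where r: "r0 < r1" "r1 < 1" "r0 < r2" "r2 < 1" "Im (\<Gamma> r1) \<le> 0" "0 \<le> Im (\<Gamma> r2)"
      by (auto simp: not_less)
    then have "0 \<in> (\<lambda>r. Im (\<Gamma> r)) ` {r0<..<1}"
      using connectedD_interval[OF conn, of "Im (\<Gamma> r1)" "Im (\<Gamma> r2)" 0] by auto
    then show False using nz by auto
  qed
  then show thesis using that r0 by blast
qed

lemma not_isolated:
  "\<not> (\<exists>\<epsilon>>0. ball (p + of_real S) \<epsilon> \<inter> frontier \<Omega> \<subseteq> {p + of_real s |s. s \<le> S})"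
  using third life by (auto simp: third_type_orbit_def isolated_orbit_def \<Omega>_def)

lemma not_both_sides:
  assumes "upper_rectangle p S a d \<subseteq> \<Omega>" "a < S" "0 < d"
    and "lower_rectangle p S a' d' \<subseteq> \<Omega>" "a' < S" "0 < d'"
  shows False
  using rectangles_cover_disc[OF open_\<Omega> shift right_in assms] not_isolated by blast

lemma disc_star_eq: "disc_star h p S = g ` Omega_star \<Omega> p S"
proof -
  have sub: "Omega_star \<Omega> p S \<subseteq> \<Omega>" by (auto simp: Omega_star_def)
  have "z \<in> g ` Omega_star \<Omega> p S" if "z \<in> unit_disc" "h z \<in> Omega_star \<Omega> p S" for z
    using that g_h by (metis imageI)
  then show ?thesis
    using sub g_in h_g by (auto simp: disc_star_def \<Omega>_def[symmetric] subset_eq)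
qed

lemma line_reflection_minus: "line_reflection p w - p = cnj (w - p)"
  by (simp add: line_reflection_def complex_eq_iff)

lemma characterization:
  assumes lip: "(\<exists>C>0. C-lipschitz_on {0..S} \<gamma>) \<longleftrightarrow> (\<exists>B. \<forall>\<^sub>F t in at_left S. D t \<le> B)"
    and ratio: "\<And>t. 0 < t \<Longrightarrow> t < S \<Longrightarrow> hyperbolic_density (Omega_tilde \<Omega> p S) (p + of_real t) /
      sphere_hyperbolic_density (disc_tilde h p S \<gamma>) (\<gamma> t) = D t"
  shows "(\<exists>C>0. C-lipschitz_on {0..S} \<gamma>) \<longleftrightarrow>
    Limsup (at_left S) (\<lambda>t. ereal (hyperbolic_density (Omega_tilde \<Omega> p S) (p + of_real t) /
      sphere_hyperbolic_density (disc_tilde h p S \<gamma>) (\<gamma> t))) < \<infinity>"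
proof -
  let ?q = "\<lambda>t. hyperbolic_density (Omega_tilde \<Omega> p S) (p + of_real t) /
      sphere_hyperbolic_density (disc_tilde h p S \<gamma>) (\<gamma> t)"
  have "\<forall>\<^sub>F t in at_left S. t \<in> {0<..<S}" using S_pos by (intro eventually_at_leftI) auto
  then have eq: "\<forall>\<^sub>F t in at_left S. ?q t = D t" by (rule eventually_mono) (use ratio in auto)
  have "(\<forall>\<^sub>F t in at_left S. ?q t \<le> B) \<longleftrightarrow> (\<forall>\<^sub>F t in at_left S. D t \<le> B)" for B
    by (rule eventually_cong[OF eq]) simp
  then show ?thesis unfolding lip Limsup_ereal_less_PInfty_iff by simp
qed

lemma Lipschitz_iff_upper:
  assumes r0: "0 \<le> r0" "r0 < 1" and side: "\<And>r. r0 < r \<Longrightarrow> r < 1 \<Longrightarrow> 0 < Im (\<Gamma> r)"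
  shows "(\<exists>C>0. C-lipschitz_on {0..S} \<gamma>) \<longleftrightarrow>
    Limsup (at_left S) (\<lambda>t. ereal (hyperbolic_density (Omega_tilde \<Omega> p S) (p + of_real t) /
      sphere_hyperbolic_density (disc_tilde h p S \<gamma>) (\<gamma> t))) < \<infinity>"
proof -
  let ?U = "{w. p + w \<in> \<Omega>}"
  interpret N: slit_domain_access ?U "\<lambda>w. g (p + w)" S \<Gamma> \<gamma> r0
  proof
    have "open ((\<lambda>w. p + w) -` \<Omega>)" by (intro open_vimage open_\<Omega> continuous_intros)
    then show "open ?U" by (simp add: vimage_def)
    have "g \<circ> (\<lambda>w. p + w) holomorphic_on ?U"
      by (rule holomorphic_on_compose_gen[OF _ hol_g]) (auto intro!: holomorphic_intros)
    then show "(\<lambda>w. g (p + w)) holomorphic_on ?U" by (simp add: o_def)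
    show "inj_on (\<lambda>w. g (p + w)) ?U"
      using g_inj by (intro inj_onI) (metis add_left_cancel inj_onD mem_Collect_eq)
    have "(\<lambda>w. g (p + w)) ` ?U = g ` \<Omega>"
      by (force simp: image_iff intro: exI[of _ "_ - p"])
    then show "(\<lambda>w. g (p + w)) ` ?U = ball 0 1" by (simp add: g_image)
    show "w + of_real t \<in> ?U" if "w \<in> ?U" "0 \<le> t" for w t
      using shift[of "p + w" t] that by (simp add: add.assoc)
  qed (use S_pos slit r0 side \<Gamma>_in \<Gamma>_lim cont_\<Gamma> g_\<Gamma>_lim in \<open>auto simp: add.assoc\<close>)
  have up: "\<exists>d>0. upper_rectangle p S (S / 2) d \<subseteq> \<Omega>"
  proof -
    obtain d where d: "0 < d" "\<And>w. S / 2 < Re w \<Longrightarrow> 0 < Im w \<Longrightarrow> Im w < d \<Longrightarrow> p + w \<in> \<Omega>"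
      using N.half_strip[of "S / 2"] S_pos by auto
    have "w \<in> \<Omega>" if "w \<in> upper_rectangle p S (S / 2) d" for w
      using d(2)[of "w - p"] that by (auto simp: upper_rectangle_def)
    then show ?thesis using d(1) by blast
  qed
  then obtain d where d: "0 < d" "upper_rectangle p S (S / 2) d \<subseteq> \<Omega>" by blast
  have no_low: "\<not> lower_rectangle p S a' d' \<subseteq> \<Omega>" if "a' < S" "0 < d'" for a' d'
    using not_both_sides[OF d(2) _ d(1) _ that] S_pos by auto
  have "upper_side \<Omega> p S"
    unfolding upper_side_def
    using d no_low[of "S / 2" d] S_pos by (intro exI[of _ "S / 2"] conjI exI[of _ d]) auto
  moreover have "\<not> lower_side \<Omega> p S"
  proof
    assume "lower_side \<Omega> p S"
    then obtain a' d' where a': "0 < d'" "lower_rectangle p S a' d' \<subseteq> \<Omega>" "\<not> upper_rectangle p S a' d' \<subseteq> \<Omega>"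
      unfolding lower_side_def by blast
    then have "a' < S" by (auto simp: upper_rectangle_def)
    then show False using no_low a' by blast
  qed
  ultimately have star: "Omega_star \<Omega> p S = {w \<in> \<Omega>. Im p < Im w}" by (auto simp: Omega_star_def)
  have star': "Omega_star \<Omega> p S = (\<lambda>w. p + w) ` {w \<in> ?U. 0 < Im w}"
    unfolding star by (force simp: image_iff intro: exI[of _ "_ - p"])
  have tilde: "Omega_tilde \<Omega> p S = {w. w - p \<in> N.refl_dom}"
  proof -
    have "w \<in> line_reflection p ` {w \<in> \<Omega>. Im p < Im w} \<longleftrightarrow> Im (w - p) < 0 \<and> p + cnj (w - p) \<in> \<Omega>" for w
    proof
      assume "w \<in> line_reflection p ` {w \<in> \<Omega>. Im p < Im w}"
      then obtain v where v: "v \<in> \<Omega>" "Im p < Im v" "w = line_reflection p v" by auto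
      then have "cnj (w - p) = v - p" using line_reflection_minus[of v] by simp
      then show "Im (w - p) < 0 \<and> p + cnj (w - p) \<in> \<Omega>" using v by (simp add: line_reflection_def)
    next
      assume "Im (w - p) < 0 \<and> p + cnj (w - p) \<in> \<Omega>"
      then show "w \<in> line_reflection p ` {w \<in> \<Omega>. Im p < Im w}"
        by (intro image_eqI[of _ _ "p + cnj (w - p)"]) (auto simp: line_reflection_def complex_eq_iff)
    qed
    moreover have "w \<in> {p + of_real t |t. 0 < t \<and> t < S} \<longleftrightarrow> Im (w - p) = 0 \<and> 0 < Re (w - p) \<and> Re (w - p) < S" for w
      by (auto simp: complex_eq_iff intro!: exI[of _ "Re w - Re p"])
    ultimately show ?thesis
      unfolding Omega_tilde_def star by (auto simp: N.refl_dom_def)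
  qed
  have "disc_tilde h p S \<gamma> = N.sphere_refl ` N.refl_dom"
    unfolding disc_tilde_def N.image_sphere_refl disc_star_eq star' image_image ..
  then show ?thesis
    using N.density_ratio_upper[of _ p] N.Lipschitz_iff_deriv_bounded by (intro characterization) (auto simp: tilde)
qed

lemma Lipschitz_iff_lower:
  assumes r0: "0 \<le> r0" "r0 < 1" and side: "\<And>r. r0 < r \<Longrightarrow> r < 1 \<Longrightarrow> Im (\<Gamma> r) < 0"
  shows "(\<exists>C>0. C-lipschitz_on {0..S} \<gamma>) \<longleftrightarrow>
    Limsup (at_left S) (\<lambda>t. ereal (hyperbolic_density (Omega_tilde \<Omega> p S) (p + of_real t) /
      sphere_hyperbolic_density (disc_tilde h p S \<gamma>) (\<gamma> t))) < \<infinity>"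
proof -
  let ?U = "{w. p + cnj w \<in> \<Omega>}"
  interpret N: slit_domain_access ?U "\<lambda>w. cnj (g (p + cnj w))" S "\<lambda>r. cnj (\<Gamma> r)" "\<lambda>t. cnj (\<gamma> t)" r0
  proof
    let ?V = "{w. p + w \<in> \<Omega>}"
    have "open ((\<lambda>w. p + w) -` \<Omega>)" by (intro open_vimage open_\<Omega> continuous_intros)
    then have openV: "open ?V" by (simp add: vimage_def)
    then show "open ?U" using open_cnj_Collect[of ?V] by simp
    have "g \<circ> (\<lambda>w. p + w) holomorphic_on ?V"
      by (rule holomorphic_on_compose_gen[OF _ hol_g]) (auto intro!: holomorphic_intros)
    then show "(\<lambda>w. cnj (g (p + cnj w))) holomorphic_on ?U"
      using holomorphic_cnj_Collect[OF _ openV, of "\<lambda>w. g (p + w)"] by (simp add: o_def)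
    show "inj_on (\<lambda>w. cnj (g (p + cnj w))) ?U"
      using g_inj by (intro inj_onI) (metis add_left_cancel complex_cnj_cancel_iff inj_onD mem_Collect_eq)
    have "(\<lambda>w. p + cnj w) ` ?U = \<Omega>"
      by (force simp: image_iff intro: exI[of _ "cnj (_ - p)"])
    then have "(\<lambda>w. cnj (g (p + cnj w))) ` ?U = cnj ` g ` \<Omega>" by (metis (no_types, lifting) image_cong image_image)
    also have "\<dots> = ball 0 1" unfolding g_image image_cnj_conv_vimage_cnj by auto
    finally show "(\<lambda>w. cnj (g (p + cnj w))) ` ?U = ball 0 1" .
    show "w + of_real t \<in> ?U" if "w \<in> ?U" "0 \<le> t" for w t
      using shift[of "p + cnj w" t] that by (simp add: add.assoc)
    show "((\<lambda>r. cnj (\<Gamma> r)) \<longlongrightarrow> 0) (at_left 1)" using tendsto_cnj[OF \<Gamma>_lim] by simp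
    show "((\<lambda>r. cnj (g (p + cnj (cnj (\<Gamma> r) + of_real t)))) \<longlongrightarrow> cnj (\<gamma> t)) (at_left 1)" if "0 \<le> t" "t \<le> S" for t
      using tendsto_cnj[OF g_\<Gamma>_lim[OF that(1)]] by (simp add: add.assoc)
    show "continuous_on {r0<..<1} (\<lambda>r. cnj (\<Gamma> r))" using cont_\<Gamma>[OF r0(1)] by (intro continuous_intros)
  qed (use S_pos slit r0 side \<Gamma>_in in auto)
  have low: "\<exists>d>0. lower_rectangle p S (S / 2) d \<subseteq> \<Omega>"
  proof -
    obtain d where d: "0 < d" "\<And>w. S / 2 < Re w \<Longrightarrow> 0 < Im w \<Longrightarrow> Im w < d \<Longrightarrow> p + cnj w \<in> \<Omega>"
      using N.half_strip[of "S / 2"] S_pos by auto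
    have "w \<in> \<Omega>" if "w \<in> lower_rectangle p S (S / 2) d" for w
      using d(2)[of "cnj (w - p)"] that by (auto simp: lower_rectangle_def)
    then show ?thesis using d(1) by blast
  qed
  then obtain d where d: "0 < d" "lower_rectangle p S (S / 2) d \<subseteq> \<Omega>" by blast
  have no_up: "\<not> upper_rectangle p S a' d' \<subseteq> \<Omega>" if "a' < S" "0 < d'" for a' d'
    using not_both_sides[OF _ that d(2) _ d(1)] S_pos by auto
  have "lower_side \<Omega> p S"
    unfolding lower_side_def
    using d no_up[of "S / 2" d] S_pos by (intro exI[of _ "S / 2"] conjI exI[of _ d]) auto
  moreover have "\<not> upper_side \<Omega> p S"
  proof
    assume "upper_side \<Omega> p S"
    then obtain a' d' where a': "0 < d'" "upper_rectangle p S a' d' \<subseteq> \<Omega>" "\<not> lower_rectangle p S a' d' \<subseteq> \<Omega>"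
      unfolding upper_side_def by blast
    then have "a' < S" by (auto simp: lower_rectangle_def)
    then show False using no_up a' by blast
  qed
  ultimately have star: "Omega_star \<Omega> p S = {w \<in> \<Omega>. Im w < Im p}" by (auto simp: Omega_star_def)
  have star': "Omega_star \<Omega> p S = (\<lambda>w. p + cnj w) ` {w \<in> ?U. 0 < Im w}"
    unfolding star by (force simp: image_iff intro: exI[of _ "cnj (_ - p)"])
  have tilde: "Omega_tilde \<Omega> p S = {w. w - p \<in> N.refl_dom}"
  proof -
    have "w \<in> line_reflection p ` {w \<in> \<Omega>. Im w < Im p} \<longleftrightarrow> 0 < Im (w - p) \<and> p + cnj (w - p) \<in> \<Omega>" for w
    proof
      assume "w \<in> line_reflection p ` {w \<in> \<Omega>. Im w < Im p}"
      then obtain v where v: "v \<in> \<Omega>" "Im v < Im p" "w = line_reflection p v" by auto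
      then have "cnj (w - p) = v - p" using line_reflection_minus[of v] by simp
      then show "0 < Im (w - p) \<and> p + cnj (w - p) \<in> \<Omega>" using v by (simp add: line_reflection_def)
    next
      assume "0 < Im (w - p) \<and> p + cnj (w - p) \<in> \<Omega>"
      then show "w \<in> line_reflection p ` {w \<in> \<Omega>. Im w < Im p}"
        by (intro image_eqI[of _ _ "p + cnj (w - p)"]) (auto simp: line_reflection_def complex_eq_iff)
    qed
    moreover have "w \<in> {p + of_real t |t. 0 < t \<and> t < S} \<longleftrightarrow> Im (w - p) = 0 \<and> 0 < Re (w - p) \<and> Re (w - p) < S" for w
      by (auto simp: complex_eq_iff intro!: exI[of _ "Re w - Re p"])
    ultimately show ?thesis
      unfolding Omega_tilde_def star by (auto simp: N.refl_dom_def)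
  qed
  have "disc_tilde h p S \<gamma> = map_option cnj ` N.sphere_refl ` N.refl_dom"
    unfolding disc_tilde_def N.image_sphere_refl disc_star_eq star' image_Un image_image
    by (simp add: circle_reflection_cnj[symmetric])
  moreover have "(\<exists>C>0. C-lipschitz_on {0..S} \<gamma>) \<longleftrightarrow> (\<exists>C>0. C-lipschitz_on {0..S} (\<lambda>t. cnj (\<gamma> t)))"
  proof -
    have "dist (cnj x) (cnj y) = dist x y" for x y
      by (metis complex_cnj_diff complex_mod_cnj dist_norm)
    then show ?thesis by (simp add: lipschitz_on_def)
  qed
  ultimately show ?thesis
    using N.density_ratio_lower[of _ p] N.Lipschitz_iff_deriv_bounded by (intro characterization) (auto simp: tilde)
qed

end

theorem theorem5p2:
  fixes \<phi> :: "real \<Rightarrow> complex \<Rightarrow> complex" and h :: "complex \<Rightarrow> complex"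
    and \<zeta> h\<zeta> :: complex and \<gamma> :: "real \<Rightarrow> complex" and S :: real
  assumes "disc_semigroup \<phi>" and "non_elliptic \<phi>"
    and "koenigs_function \<phi> h"
    and "\<zeta> \<in> unit_circle"
    and "boundary_trajectory \<phi> \<zeta> \<gamma>"
    and "has_nontangential_limit h h\<zeta> \<zeta>"
    and "third_type_orbit (h ` unit_disc) h\<zeta> \<zeta> \<gamma>"
    and "life_time \<gamma> = ereal S"
  shows "(\<exists>C>0. C-lipschitz_on {0..S} \<gamma>) \<longleftrightarrow>
    Limsup (at_left S)
      (\<lambda>t. ereal (hyperbolic_density (Omega_tilde (h ` unit_disc) h\<zeta> S) (h\<zeta> + of_real t) /
        sphere_hyperbolic_density (disc_tilde h h\<zeta> S \<gamma>) (\<gamma> t))) < \<infinity>"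
proof -
  interpret koenigs_orbit \<phi> h \<zeta> h\<zeta> \<gamma> S
    using assms by unfold_locales auto
  show ?thesis
  proof (cases rule: access_side)
    case (1 r0) then show ?thesis by (rule Lipschitz_iff_upper[unfolded \<Omega>_def])
  next
    case (2 r0) then show ?thesis by (rule Lipschitz_iff_lower[unfolded \<Omega>_def])
  qed
qed


end
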